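(* Let $\beta\le0$ and $1<p<q<np/(n-p)<\infty$. Suppose that $G$ is a non-empty proper open set in $\mathbb{R}^n$, $n\ge2$, such that $\underline{\dim}_A(G^c)>n-p+\beta$; if $G$ is unbounded, assume that $G^c$ is unbounded as well. Then there is a constant $C>0$ such that $$\biggl(\int_{G} |f(x)|^q\,\delta_{\partial G}(x)^{\frac{q}{p}(n-p+\beta)-n}\,dx\biggr)^{1/q}\le C\biggl(\int_{\mathbb{R}^n} |\nabla f(x)|^p \,\delta_{\partial G}(x)^{\beta}\, dx\biggr)^{1/p}$$ whenever $f\in C^\infty_0(\mathbb{R}^n)$ and $f(x)=0$ for all $x\in G^c$.
   Context: $G^c=\mathbb{R}^n\setminus G$ and $\delta_{\partial G}(x)=\operatorname{dist}(x,\partial G)$ for all $x\in\mathbb{R}^n$; negative powers of $\delta_{\partial G}$ are understood to equal $+\infty$ on $\partial G$, with $0\cdot\infty=0$, and $\delta_{\partial G}^0\equiv 1$. $B(x,R)$ is the open ball, $d(E)$ is the diameter of $E$, and $C_0^\infty(\mathbb{R}^n)$ denotes smooth functions with compact support in $\mathbb{R}^n$. For bounded $A\subset\mathbb{R}^n$ and $r>0$, $N(A,r)$ is the minimal number of open balls of radius $r$ centered at points of $A$ needed to cover $A$. The lower Assouad dimension is $\underline{\dim}_A(E)=\sup\{\lambda\ge 0:\ \exists\, c_\lambda>0 \text{ such that } N(E\cap B(x,R),r)\ge c_\lambda (r/R)^{-\lambda}\text{ for all } x\in E,\ 0<r<R<d(E)\}$. *)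

theory Defs
  imports "HOL-Analysis.Analysis"
begin

text \<open>Power with real exponent on \<open>[0, \<infinity>]\<close>: \<open>0\<close> to a negative power is \<open>\<infinity>\<close> and every
  zeroth power is \<open>1\<close>. (Note \<open>0 powr s = 0\<close> for all real \<open>s\<close>, so \<open>powr\<close> alone would be wrong
  at \<open>0\<close>.) The convention \<open>0 * \<infinity> = 0\<close> is that of \<^typ>\<open>ennreal\<close>.\<close>

definition ennreal_powr :: "ennreal \<Rightarrow> real \<Rightarrow> ennreal" where
  "ennreal_powr a s =
     (if s = 0 then 1
      else if a = 0 then (if s < 0 then \<infinity> else 0)
      else if a = \<infinity> then (if s < 0 then 0 else \<infinity>)
      else ennreal (enn2real a powr s))"

definition bdry_weight :: "'a::metric_space set \<Rightarrow> real \<Rightarrow> 'a \<Rightarrow> ennreal" where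
  "bdry_weight G s x = ennreal_powr (ennreal (infdist x (frontier G))) s"

text \<open>Meaningful for \<open>r > 0\<close> and totally bounded \<open>A\<close>, in particular bounded subsets of Euclidean
  space; otherwise no finite cover need exist.\<close>

definition covering_number :: "'a::metric_space set \<Rightarrow> real \<Rightarrow> nat" where
  "covering_number A r =
     (LEAST k. \<exists>F. finite F \<and> F \<subseteq> A \<and> card F = k \<and> A \<subseteq> (\<Union>c\<in>F. ball c r))"

text \<open>Extended-valued, since \<^const>\<open>diameter\<close> is meaningful only for bounded sets.\<close>

definition ediameter :: "'a::metric_space set \<Rightarrow> ennreal" where
  "ediameter E = (SUP x\<in>E. SUP y\<in>E. ennreal (dist x y))"

text \<open>If \<open>E\<close> is empty or a single point there are no admissible \<open>x, r, R\<close>, and the value is \<open>\<infinity>\<close>.\<close>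

definition lower_assouad_dim :: "'a::metric_space set \<Rightarrow> ereal" where
  "lower_assouad_dim E =
     Sup (ereal ` {l. 0 \<le> l \<and>
       (\<exists>c>0. \<forall>x\<in>E. \<forall>r R. 0 < r \<and> r < R \<and> ennreal R < ediameter E \<longrightarrow>
          real (covering_number (E \<inter> ball x R) r) \<ge> c * (r / R) powr (- l))})"

definition partial_deriv :: "'n \<Rightarrow> (real ^ 'n::finite \<Rightarrow> real) \<Rightarrow> real ^ 'n \<Rightarrow> real" where
  "partial_deriv i f x = frechet_derivative f (at x) (axis i 1)"

definition gradient :: "(real ^ 'n::finite \<Rightarrow> real) \<Rightarrow> real ^ 'n \<Rightarrow> real ^ 'n" where
  "gradient f x = (\<chi> i. partial_deriv i f x)"

primrec Ck :: "nat \<Rightarrow> (real ^ 'n::finite \<Rightarrow> real) \<Rightarrow> bool" where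
  "Ck 0 f \<longleftrightarrow> continuous_on UNIV f"
| "Ck (Suc k) f \<longleftrightarrow> (\<forall>x. f differentiable (at x)) \<and> (\<forall>i. Ck k (partial_deriv i f))"

definition test_function :: "(real ^ 'n::finite \<Rightarrow> real) \<Rightarrow> bool" where
  "test_function f \<longleftrightarrow> (\<forall>k. Ck k f) \<and> compact (closure {x. f x \<noteq> 0})"

end

theory Submission
  imports Defs
begin

text \<open>Write \<open>E\<close> for the complement of \<open>G\<close> and \<open>\<delta>\<close> for the distance to the boundary.
The bound on \<open>|f|\<close> at a point \<open>y\<close> of \<open>G\<close> has two sources. On the ball \<open>B(y, \<delta>(y)/2)\<close> the value
\<open>|f(y)|\<close> is at most the average of \<open>|f|\<close> plus a Riesz potential of \<open>|\<nabla>f|\<close>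
(\<open>pointwise_le_average_plus_riesz\<close>). The potential is under control because \<open>q\<close> is below the Sobolev
exponent (\<open>riesz_integral_le\<close>, in the manner of Young's convolution inequality). The average is
where \<open>E\<close> enters: \<open>f\<close> vanishes on \<open>E\<close>, so the average is bounded by an integral of
\<open>|\<nabla>f(z)| |z - w|\<^bsup>1-n\<^esup>\<close> for every \<open>w \<in> E\<close> near \<open>y\<close>. The freedom to choose \<open>w\<close> replaces a Frostman
measure: given a mass distribution, here \<open>|\<nabla>f|\<^sup>p \<delta>\<^sup>b dz\<close>, the lower Assouad dimension supplies, in each
ball around a point of \<open>E\<close>, so many separated points of \<open>E\<close> that one of their small balls carries only
a small fraction of the mass. Iterating this choice yields a point \<open>w \<in> E\<close> at which the mass of
\<open>B(w, r)\<close> decays like \<open>r\<close> to a power above \<open>\<kappa>\<close>, so that \<open>|z - w|\<^bsup>-\<kappa>\<^esup>\<close> is integrable, for any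
\<open>\<kappa>\<close> below the dimension (\<open>point_with_small_riesz_integral\<close>). Jensen's inequality then gives the weighted
Poincare inequality \<open>average_powr_le_energy\<close>, with the weight \<open>\<delta>\<^sup>b\<close>, whenever \<open>n - p + b\<close> is below the
dimension and \<open>b \<le> 0\<close>.

Integrating these local bounds over \<open>G\<close> with Tonelli costs a gap: with the Poincare inequality for the
exponent \<open>b\<close> one obtains the claim for \<open>b - \<gamma>\<close>, with a constant of order \<open>1/\<gamma>\<close>
(\<open>sobolev_hardy_below_critical\<close>). The case \<open>q = p\<close>, a Hardy inequality, is included.

If \<open>\<beta> < 0\<close>, then \<open>b = \<beta> + \<gamma>\<close> is still admissible for small \<open>\<gamma>\<close>, and the proof is complete. If
\<open>\<beta> = 0\<close>, there is no room above \<open>\<beta>\<close>. Then the inequality for the exponent \<open>-pt\<close> is applied to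
\<open>f \<delta>\<^sup>t\<close>, whose gradient is at most \<open>|\<nabla>f| \<delta>\<^sup>t + t |f| \<delta>\<^bsup>t-1\<^esup>\<close>. With \<open>q = p\<close> the second term contributes
\<open>t\<^sup>p\<close> times the left-hand side, against a constant of order \<open>1/t\<close>; as \<open>p > 1\<close> it is absorbed for small \<open>t\<close>
(\<open>hardy_unweighted\<close>). With the Hardy inequality at hand the same substitution gives every \<open>q\<close>
(\<open>sobolev_hardy_unweighted\<close>). Since \<open>f \<delta>\<^sup>t\<close> is not smooth, the whole argument is carried out for pairs
\<open>(u, g)\<close> in which \<open>g\<close> bounds the local Lipschitz constant of \<open>u\<close>.\<close>

section \<open>Powers of extended nonnegative integrals\<close>

lemma ennreal_powr_ennreal: "0 \<le> x \<Longrightarrow> 0 < s \<Longrightarrow> ennreal_powr (ennreal x) s = ennreal (x powr s)"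
  by (auto simp: ennreal_powr_def)

lemma ennreal_powr_top: "0 < s \<Longrightarrow> ennreal_powr top s = top"
  by (auto simp: ennreal_powr_def)

lemma ennreal_powr_0[simp]: "0 < s \<Longrightarrow> ennreal_powr 0 s = 0"
  by (auto simp: ennreal_powr_def)

lemma ennreal_powr_zero_exp[simp]: "ennreal_powr a 0 = 1"
  by (auto simp: ennreal_powr_def)

lemma ennreal_powr_1[simp]: "ennreal_powr a 1 = a"
  by (cases a) (auto simp: ennreal_powr_def)

lemma ennreal_powr_mono: assumes "a \<le> b" "0 \<le> s" shows "ennreal_powr a s \<le> ennreal_powr b s"
proof (cases "s = 0")
  case False
  then have "0 < s" using assms by auto
  then show ?thesis using assms
    by (cases a; cases b) (auto simp: ennreal_powr_ennreal ennreal_powr_top top_unique intro!: powr_mono2 ennreal_leI)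
qed auto

lemma ennreal_powr_mult: assumes "0 \<le> s"
  shows "ennreal_powr (a * b) s = ennreal_powr a s * ennreal_powr b s"
proof (cases "s = 0")
  case False
  then have s: "0 < s" using assms by auto
  show ?thesis
  proof (cases "a = 0 \<or> b = 0")
    case True then show ?thesis using s by auto
  next
    case False
    show ?thesis
    proof (cases "a = top \<or> b = top")
      case True
      have nz: "ennreal_powr c s \<noteq> 0" if "c \<noteq> 0" for c
        using that s by (cases c) (auto simp: ennreal_powr_ennreal ennreal_powr_top)
      have "a * b = top" using True False by (auto simp: ennreal_mult_eq_top_iff)
      moreover have "ennreal_powr a s * ennreal_powr b s = top"
        unfolding ennreal_mult_eq_top_iff using True nz[of a] nz[of b] False ennreal_powr_top[OF s] by metis
      ultimately show ?thesis using s by (simp add: ennreal_powr_top)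
    next
      case False
      then obtain x y where "a = ennreal x" "b = ennreal y" "0 \<le> x" "0 \<le> y"
        by (metis ennreal_cases)
      moreover have "ennreal_powr (ennreal (x * y)) s = ennreal (x powr s * y powr s)"
        using s \<open>0 \<le> x\<close> \<open>0 \<le> y\<close> by (subst ennreal_powr_ennreal) (auto simp: powr_mult)
      ultimately show ?thesis using s
        by (simp add: ennreal_powr_ennreal ennreal_mult)
    qed
  qed
qed auto

lemma ennreal_powr_powr: assumes "0 < s" "0 < t"
  shows "ennreal_powr (ennreal_powr a s) t = ennreal_powr a (s * t)"
  using assms by (cases a) (auto simp: ennreal_powr_ennreal ennreal_powr_top powr_powr)

lemma ennreal_powr_add_exp: assumes "0 \<le> s" "0 \<le> t"
  shows "ennreal_powr a (s + t) = ennreal_powr a s * ennreal_powr a t"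
proof (cases "s = 0 \<or> t = 0")
  case False
  then have "0 < s" "0 < t" using assms by auto
  then show ?thesis by (cases a) (auto simp: ennreal_powr_ennreal ennreal_powr_top powr_add ennreal_mult ennreal_top_mult)
qed auto

lemma ennreal_powr_add_le: assumes "0 \<le> s"
  shows "ennreal_powr (a + b) s \<le> ennreal (2 powr s) * (ennreal_powr a s + ennreal_powr b s)"
proof -
  have "ennreal_powr (a + b) s \<le> ennreal_powr (ennreal 2 * max a b) s"
  proof (intro ennreal_powr_mono assms)
    have "a + b \<le> max a b + max a b" by (intro add_mono) auto
    then show "a + b \<le> ennreal 2 * max a b" by (simp add: mult_2)
  qed
  also have "\<dots> = ennreal (2 powr s) * ennreal_powr (max a b) s"
    using assms ennreal_powr_ennreal[of 2 s] by (cases "s = 0") (auto simp: ennreal_powr_mult simp del: ennreal_numeral)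
  also have "\<dots> \<le> ennreal (2 powr s) * (ennreal_powr a s + ennreal_powr b s)"
    by (intro mult_left_mono) (auto simp: max_def)
  finally show ?thesis .
qed

lemma ennreal_powr_eq_0_iff: "0 < s \<Longrightarrow> ennreal_powr a s = 0 \<longleftrightarrow> a = 0"
  by (cases a) (auto simp: ennreal_powr_ennreal ennreal_powr_top)

lemma le_scale_trans:
  fixes X Y Z :: ennreal
  assumes "X \<le> ennreal a * Y" "Y \<le> ennreal b * Z" "0 \<le> a" "0 \<le> b"
  shows "X \<le> ennreal (a * b) * Z"
proof -
  have "X \<le> ennreal a * (ennreal b * Z)" using assms(1) mult_left_mono[OF assms(2), of "ennreal a"] by simp
  then show ?thesis using assms by (simp add: ennreal_mult mult.assoc)
qed

lemma ennreal_powr_scale_le: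
  assumes "X \<le> ennreal a * Y" "0 < a" "0 \<le> s"
  shows "ennreal_powr X s \<le> ennreal (a powr s) * ennreal_powr Y s"
proof -
  have "ennreal_powr X s \<le> ennreal_powr (ennreal a * Y) s" using assms by (intro ennreal_powr_mono)
  also have "\<dots> = ennreal_powr (ennreal a) s * ennreal_powr Y s" using assms by (intro ennreal_powr_mult)
  also have "ennreal_powr (ennreal a) s = ennreal (a powr s)"
    using assms by (cases "s = 0") (auto simp: ennreal_powr_ennreal)
  finally show ?thesis .
qed

lemma ennreal_powr_split:
  assumes "1 \<le> m" shows "ennreal_powr X m = ennreal_powr X (m - 1) * X"
  using ennreal_powr_add_exp[of "m - 1" 1 X] assms by simp

lemma borel_measurable_ennreal_powr[measurable]:
  assumes [measurable]: "f \<in> borel_measurable M"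
  shows "(\<lambda>x. ennreal_powr (f x) s) \<in> borel_measurable M"
  unfolding ennreal_powr_def by measurable

text \<open>This is Jensen's inequality for the measure \<open>h dM\<close>, up to the factor \<open>2\<^sup>m\<close>; it is the only form of
Hoelder's inequality that is used. The factor is harmless and lets a two-case bound replace
convexity: for every \<open>c > 0\<close> either \<open>\<phi> \<le> c\<close> or \<open>\<phi> \<le> c\<^bsup>1-m\<^esup> \<phi>\<^sup>m\<close>, so the integral of \<open>h \<phi>\<close> is at most
\<open>c\<close> times that of \<open>h\<close> plus \<open>c\<^bsup>1-m\<^esup>\<close> times that of \<open>h \<phi>\<^sup>m\<close>, and \<open>c\<close> can be chosen to balance the two.\<close>

lemma nn_integral_powr_le:
  assumes [measurable]: "h \<in> borel_measurable M" "\<phi> \<in> borel_measurable M" and m: "1 \<le> m"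
  shows "ennreal_powr (\<integral>\<^sup>+x. h x * \<phi> x \<partial>M) m
    \<le> ennreal (2 powr m) * (ennreal_powr (\<integral>\<^sup>+x. h x \<partial>M) (m - 1) * (\<integral>\<^sup>+x. h x * ennreal_powr (\<phi> x) m \<partial>M))"
proof -
  define H I J where "H = (\<integral>\<^sup>+x. h x \<partial>M)" and "I = (\<integral>\<^sup>+x. h x * \<phi> x \<partial>M)"
    and "J = (\<integral>\<^sup>+x. h x * ennreal_powr (\<phi> x) m \<partial>M)"
  have zero: "I = 0" if "H = 0 \<or> J = 0"
  proof -
    from that have "AE x in M. h x * \<phi> x = 0"
    proof
      assume "H = 0" then have "AE x in M. h x = 0" unfolding H_def by (subst (asm) nn_integral_0_iff_AE) auto
      then show ?thesis by auto
    next
      assume "J = 0" then have "AE x in M. h x * ennreal_powr (\<phi> x) m = 0" unfolding J_def by (subst (asm) nn_integral_0_iff_AE) auto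
      then show ?thesis using m by (auto simp: ennreal_powr_eq_0_iff)
    qed
    then show ?thesis unfolding I_def by (subst nn_integral_0_iff_AE) auto
  qed
  have main: "ennreal_powr I m \<le> ennreal (2 powr m) * (ennreal_powr H (m - 1) * J)"
  proof (cases "m = 1")
    case True then show ?thesis using m by (simp add: I_def J_def mult_right_mono[of 1 "ennreal 2", simplified])
  next
    case False
    with m have m1: "1 < m" by auto
    show ?thesis
    proof (cases "H = 0 \<or> J = 0")
      case True then show ?thesis using zero m by auto
    next
      case nz: False
      show ?thesis
      proof (cases "H = top \<or> J = top")
        case True
        then have "ennreal_powr H (m - 1) * J = top" using nz m1
          by (auto simp: ennreal_powr_top ennreal_mult_top ennreal_top_mult ennreal_powr_eq_0_iff)
        then show ?thesis by (simp add: ennreal_mult_top)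
      next
        case False
        then obtain a b where ab: "H = ennreal a" "J = ennreal b" "0 < a" "0 < b"
          using nz by (metis ennreal_cases ennreal_0 less_eq_real_def)
        \<comment> \<open>this choice balances \<open>c a\<close> and \<open>c\<^bsup>1-m\<^esup> b\<close>\<close>
        define c where "c = (b / a) powr (1 / m)"
        have c: "0 < c" using ab by (auto simp: c_def)
        have pt: "y \<le> ennreal c + ennreal (c powr (1 - m)) * ennreal_powr y m" for y
        proof (cases y)
          case (real v)
          have "v \<le> c + c powr (1 - m) * v powr m"
          proof (cases "v \<le> c")
            case True then show ?thesis by (simp add: add_increasing2)
          next
            case False
            then have "v powr (1 - m) \<le> c powr (1 - m)" using c m by (intro powr_mono2') auto
            then have "v powr (1 - m) * v powr m \<le> c powr (1 - m) * v powr m" by (intro mult_right_mono) auto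
            then show ?thesis using False c by (simp flip: powr_add)
          qed
          then show ?thesis using real c m
            by (simp add: ennreal_powr_ennreal flip: ennreal_mult ennreal_plus) 
        next
          case top then show ?thesis using c m by (simp add: ennreal_powr_top ennreal_mult_top)
        qed
        have "I \<le> (\<integral>\<^sup>+x. ennreal c * h x + ennreal (c powr (1 - m)) * (h x * ennreal_powr (\<phi> x) m) \<partial>M)"
          unfolding I_def
        proof (intro nn_integral_mono)
          fix x show "h x * \<phi> x \<le> ennreal c * h x + ennreal (c powr (1 - m)) * (h x * ennreal_powr (\<phi> x) m)"
            using mult_left_mono[OF pt[of "\<phi> x"], of "h x"] by (simp add: distrib_left mult_ac)
        qed
        also have "\<dots> = ennreal c * H + ennreal (c powr (1 - m)) * J"
          unfolding H_def J_def by (simp add: nn_integral_add nn_integral_cmult)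
        also have "\<dots> = ennreal (c * a + c powr (1 - m) * b)"
          using ab c by (simp flip: ennreal_mult)
        finally have I: "I \<le> ennreal (c * a + c powr (1 - m) * b)" .
        have cb: "c powr (1 - m) * b = c * a"
        proof -
          have "c powr m = b / a" using ab m1 by (simp add: c_def powr_powr)
          then have "b = c powr m * a" using ab by simp
          then show ?thesis using c by (simp add: mult.assoc[symmetric] flip: powr_add)
        qed
        have "ennreal_powr I m \<le> ennreal_powr (ennreal (2 * (c * a))) m"
          using I m cb by (intro ennreal_powr_mono) (auto simp: mult.commute)
        also have "\<dots> = ennreal ((2 * (c * a)) powr m)" using ab c m by (subst ennreal_powr_ennreal) auto
        also have "(2 * (c * a)) powr m = 2 powr m * (a powr (m - 1) * b)"
        proof -
          have "c powr m = b / a" using ab m1 by (simp add: c_def powr_powr)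
          then show ?thesis using ab by (simp add: powr_mult powr_diff)
        qed
        also have "ennreal (2 powr m * (a powr (m - 1) * b)) = ennreal (2 powr m) * (ennreal_powr H (m - 1) * J)"
          using ab m1 by (simp add: ennreal_powr_ennreal ennreal_mult)
        finally show ?thesis .
      qed
    qed
  qed
  then show ?thesis unfolding H_def I_def J_def .
qed

section \<open>Points of low mass in sets of large lower Assouad dimension\<close>

lemma sets_ball_borel[measurable]: "ball a r \<in> sets borel"
  by (simp add: borel_open)

lemma borel_measurable_powr_ball:
  fixes a :: "'a::euclidean_space"
  shows "(\<lambda>z. ennreal (dist z a powr s) * indicator (ball a r) z) \<in> borel_measurable borel"
    "(\<lambda>z. ennreal c * indicator (ball a r) z) \<in> borel_measurable borel"
  by measurable

text \<open>A set with fewer than \<open>covering_number A r\<close> points cannot be the set of centres of a cover, so a point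
that it leaves uncovered can always be added.\<close>

lemma separated_subset_of_covering_number:
  fixes A :: "'a::metric_space set"
  assumes "m \<le> covering_number A r" "0 < r"
  shows "\<exists>F. finite F \<and> F \<subseteq> A \<and> card F = m \<and> (\<forall>x\<in>F. \<forall>y\<in>F. x \<noteq> y \<longrightarrow> r \<le> dist x y)"
  using assms(1)
proof (induction m)
  case 0 then show ?case by (intro exI[of _ "{}"]) auto
next
  case (Suc m)
  then obtain F where F: "finite F" "F \<subseteq> A" "card F = m" "\<forall>x\<in>F. \<forall>y\<in>F. x \<noteq> y \<longrightarrow> r \<le> dist x y"
    by auto
  have "\<not> A \<subseteq> (\<Union>c\<in>F. ball c r)"
    using not_less_Least[of m "\<lambda>k. \<exists>F. finite F \<and> F \<subseteq> A \<and> card F = k \<and> A \<subseteq> (\<Union>c\<in>F. ball c r)"] Suc.prems F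
    unfolding covering_number_def by auto
  then obtain a where a: "a \<in> A" "\<And>c. c \<in> F \<Longrightarrow> r \<le> dist c a" by force
  then have "a \<notin> F" using \<open>0 < r\<close> by force
  then show ?case using F a by (intro exI[of _ "insert a F"]) (auto simp: dist_commute)
qed

text \<open>The pigeonhole step: at scale \<open>\<tau> R\<close> the ball around \<open>w\<close> contains at least \<open>2 \<tau>\<^bsup>-\<kappa>\<^esup>\<close> separated points of
\<open>E\<close>, so their disjoint small balls cannot all carry more than the fraction \<open>\<tau>\<^sup>\<kappa>/2\<close> of the mass. The
surplus \<open>l - \<kappa>\<close> in the dimension pays for the constants, once \<open>\<tau>\<close> is small.\<close>

lemma child_ball_of_small_mass:
  fixes E :: "'a::euclidean_space set"
  assumes c: "0 < c" and cov: "\<And>x r R. x \<in> E \<Longrightarrow> 0 < r \<Longrightarrow> r < R \<Longrightarrow>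
      c * (r / R) powr (- l) \<le> real (covering_number (E \<inter> ball x R) r)"
    and \<kappa>: "0 < \<kappa>" "\<kappa> < l"
  shows "\<exists>\<tau>>0. \<tau> \<le> 1/8 \<and> (\<forall>w\<in>E. \<forall>R>0. \<forall>\<nu>. sets \<nu> = sets borel \<longrightarrow>
      (\<exists>w'\<in>E. dist w w' < R / 2 \<and>
        emeasure \<nu> (ball w' (\<tau> * R)) \<le> ennreal (\<tau> powr \<kappa> / 2) * emeasure \<nu> (ball w R)))"
proof -
  define b where "b = c * 4 powr (- l) / 2"
  have b: "0 < b" using c by (simp add: b_def)
  \<comment> \<open>small enough for \<open>c (4\<tau>)\<^bsup>-l\<^esup> \<ge> 2 \<tau>\<^bsup>-\<kappa>\<^esup>\<close>, a bound on the number of separated points\<close>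
  define \<tau> where "\<tau> = min (1/8) (b powr (1 / (l - \<kappa>)))"
  have \<tau>: "0 < \<tau>" "\<tau> \<le> 1/8" using b by (auto simp: \<tau>_def)
  have "\<tau> powr (l - \<kappa>) \<le> (b powr (1 / (l - \<kappa>))) powr (l - \<kappa>)"
    using \<tau> \<kappa> by (intro powr_mono2) (auto simp: \<tau>_def)
  then have small: "\<tau> powr (l - \<kappa>) \<le> b" using b \<kappa> by (simp add: powr_powr)
  show ?thesis
  proof (intro exI[of _ \<tau>] conjI \<tau> ballI allI impI)
    fix w :: 'a and R :: real and \<nu> :: "'a measure"
    assume w: "w \<in> E" and R: "0 < R" and [simp]: "sets \<nu> = sets borel"
    define N where "N = covering_number (E \<inter> ball w (R / 2)) (2 * \<tau> * R)"
    obtain F where F: "finite F" "F \<subseteq> E \<inter> ball w (R / 2)" "card F = N"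
        "\<And>x y. x \<in> F \<Longrightarrow> y \<in> F \<Longrightarrow> x \<noteq> y \<Longrightarrow> 2 * \<tau> * R \<le> dist x y"
      using separated_subset_of_covering_number[OF eq_refl[OF N_def]] \<tau> R
      by (metis mult_pos_pos zero_less_numeral)
    have "2 * \<tau> powr (- \<kappa>) = 2 * \<tau> powr (- l) * \<tau> powr (l - \<kappa>)" using \<tau> by (simp flip: powr_add)
    also have "\<dots> \<le> 2 * \<tau> powr (- l) * b" using small by (intro mult_left_mono) auto
    also have "\<dots> = c * (4 * \<tau>) powr (- l)" using \<tau> by (simp only: b_def powr_mult) simp
    also have "\<dots> = c * (2 * \<tau> * R / (R / 2)) powr (- l)" using R by simp
    also have "\<dots> \<le> real N" unfolding N_def using w \<tau> R by (intro cov) auto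
    finally have N: "2 * \<tau> powr (- \<kappa>) \<le> real N" .
    have "\<tau> powr \<kappa> / 2 * (2 * \<tau> powr (- \<kappa>)) \<le> \<tau> powr \<kappa> / 2 * real N"
      using N by (intro mult_left_mono) auto
    then have N1: "1 \<le> \<tau> powr \<kappa> / 2 * real N" using \<tau> by (simp add: mult.commute flip: powr_add)
    then have "N \<noteq> 0" by (intro notI) simp
    then have "F \<noteq> {}" using F by auto
    then obtain v where v: "v \<in> F" "\<And>x. x \<in> F \<Longrightarrow> emeasure \<nu> (ball v (\<tau> * R)) \<le> emeasure \<nu> (ball x (\<tau> * R))"
      using ex_is_arg_min_if_finite[OF F(1), of "\<lambda>x. emeasure \<nu> (ball x (\<tau> * R))"]
      by (auto simp: is_arg_min_linorder)
    have disj: "disjoint_family_on (\<lambda>x. ball x (\<tau> * R)) F"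
      unfolding disjoint_family_on_def
    proof (intro ballI impI equals0I)
      fix x y z assume xy: "x \<in> F" "y \<in> F" "x \<noteq> y" and z: "z \<in> ball x (\<tau> * R) \<inter> ball y (\<tau> * R)"
      have "dist x y \<le> dist x z + dist y z" by (rule dist_triangle2)
      then show False using F(4)[OF xy] z by auto
    qed
    have "of_nat N * emeasure \<nu> (ball v (\<tau> * R)) \<le> (\<Sum>x\<in>F. emeasure \<nu> (ball x (\<tau> * R)))"
      using v F(3) sum_bounded_below[of F "emeasure \<nu> (ball v (\<tau> * R))"] by auto
    also have "\<dots> = emeasure \<nu> (\<Union>x\<in>F. ball x (\<tau> * R))"
      using F(1) disj by (intro sum_emeasure) auto
    also have "\<dots> \<le> emeasure \<nu> (ball w R)"
    proof (intro emeasure_mono UN_least subsetI)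
      fix x z assume "x \<in> F" "z \<in> ball x (\<tau> * R)"
      moreover have "\<tau> * R \<le> 1/8 * R" using \<tau> R by (intro mult_right_mono) auto
      ultimately have "dist w x < R / 2" "dist x z < R / 8" using F(2) by auto
      then show "z \<in> ball w R" using dist_triangle[of w z x] R by simp
    qed auto
    finally have mass: "of_nat N * emeasure \<nu> (ball v (\<tau> * R)) \<le> emeasure \<nu> (ball w R)" .
    have "emeasure \<nu> (ball v (\<tau> * R)) \<le> ennreal (\<tau> powr \<kappa> / 2 * real N) * emeasure \<nu> (ball v (\<tau> * R))"
      using mult_right_mono[of 1 "ennreal (\<tau> powr \<kappa> / 2 * real N)"] N1 by auto
    also have "\<dots> = ennreal (\<tau> powr \<kappa> / 2) * (of_nat N * emeasure \<nu> (ball v (\<tau> * R)))"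
      by (subst ennreal_mult) (auto simp: ennreal_of_nat_eq_real_of_nat mult.assoc)
    also have "\<dots> \<le> ennreal (\<tau> powr \<kappa> / 2) * emeasure \<nu> (ball w R)"
      using mass by (intro mult_left_mono) auto
    finally show "\<exists>w'\<in>E. dist w w' < R / 2 \<and> emeasure \<nu> (ball w' (\<tau> * R)) \<le> ennreal (\<tau> powr \<kappa> / 2) * emeasure \<nu> (ball w R)"
      using v(1) F(2) by (intro bexI[of _ v]) auto
  qed
qed

text \<open>The ball is split into the annuli between the radii \<open>\<tau>\<^sup>n \<rho>\<close>, which contribute a geometric series with
ratio \<open>\<theta>\<close>. The centre needs no attention, because \<open>0 powr (- \<kappa>) = 0\<close>.\<close>

lemma riesz_integral_of_decaying_mass:
  fixes a :: "'a::euclidean_space" and \<nu> :: "'a measure"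
  assumes sets[simp]: "sets \<nu> = sets borel" and \<tau>: "0 < \<tau>" "\<tau> < 1" and \<rho>: "0 < \<rho>"
    and \<kappa>: "0 < \<kappa>" and \<theta>: "0 \<le> \<theta>" "\<theta> < 1"
    and mass: "\<And>n. emeasure \<nu> (ball a (\<tau> ^ n * \<rho>)) \<le> ennreal ((\<tau> powr \<kappa> * \<theta>) ^ n) * M"
  shows "(\<integral>\<^sup>+z. ennreal (dist z a powr (- \<kappa>)) * indicator (ball a \<rho>) z \<partial>\<nu>)
    \<le> ennreal ((\<tau> * \<rho>) powr (- \<kappa>) / (1 - \<theta>)) * M"
proof -
  define r where "r n = \<tau> ^ n * \<rho>" for n
  have r: "0 < r n" for n using \<tau> \<rho> by (auto simp: r_def)
  have r0: "r \<longlonglongrightarrow> 0" unfolding r_def using \<tau> by (intro tendsto_mult_left_zero LIMSEQ_power_zero) auto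
  define k where "k n z = ennreal (r (Suc n) powr (- \<kappa>)) * indicator (ball a (r n)) z" for n z
  have k_meas: "k n \<in> borel_measurable \<nu>" for n
    unfolding measurable_cong_sets[OF sets refl] k_def[abs_def] by (intro borel_measurable_times_ennreal borel_measurable_const borel_measurable_indicator) simp
  have pt: "ennreal (dist z a powr (- \<kappa>)) * indicator (ball a \<rho>) z \<le> (\<Sum>n. k n z)" for z
  proof (cases "z \<in> ball a \<rho> \<and> z \<noteq> a")
    case True
    \<comment> \<open>\<open>n - 1\<close> is the index of the annulus that contains \<open>z\<close>\<close>
    define n where "n = (LEAST n. r n \<le> dist z a)"
    have "\<forall>\<^sub>F n in sequentially. r n < dist z a"
      using order_tendstoD(2)[OF r0, of "dist z a"] True by auto
    then have "\<exists>n. r n \<le> dist z a" by (auto simp: eventually_sequentially intro: less_imp_le)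
    then have n: "r n \<le> dist z a" and nmin: "\<And>m. m < n \<Longrightarrow> dist z a < r m"
      unfolding n_def by (auto intro: LeastI_ex dest: not_less_Least)
    have "n \<noteq> 0"
    proof
      assume "n = 0"
      then show False using n True by (simp add: r_def dist_commute)
    qed
    then obtain m where m: "n = Suc m" by (cases n) auto
    have "dist z a powr (- \<kappa>) \<le> r (Suc m) powr (- \<kappa>)"
      using n m \<kappa> r[of "Suc m"] by (intro powr_mono2') auto
    then have "ennreal (dist z a powr (- \<kappa>)) * indicator (ball a \<rho>) z \<le> k m z"
      using True nmin[of m] m unfolding k_def by (auto simp: dist_commute intro!: ennreal_leI)
    also have "\<dots> \<le> (\<Sum>n. k n z)" using sum_le_suminf[of "\<lambda>n. k n z" "{m}"] by (auto intro: summableI)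
    finally show ?thesis .
  qed auto
  have eq: "r (Suc n) powr (- \<kappa>) * (\<tau> powr \<kappa> * \<theta>) ^ n = (\<tau> * \<rho>) powr (- \<kappa>) * \<theta> ^ n" for n
  proof -
    have "(\<tau> powr \<kappa>) ^ n = (\<tau> ^ n) powr \<kappa>" using \<tau> by (simp add: powr_powr mult.commute flip: powr_realpow)
    moreover have "r (Suc n) powr (- \<kappa>) = (\<tau> ^ n) powr (- \<kappa>) * (\<tau> * \<rho>) powr (- \<kappa>)"
      using \<tau> \<rho> by (simp add: r_def mult_ac flip: powr_mult)
    ultimately show ?thesis using \<tau> \<rho> by (simp add: power_mult_distrib powr_minus field_simps)
  qed
  have "(\<integral>\<^sup>+z. k n z \<partial>\<nu>) \<le> ennreal ((\<tau> * \<rho>) powr (- \<kappa>)) * M * ennreal (\<theta> ^ n)" for n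
  proof -
    have "(\<integral>\<^sup>+z. k n z \<partial>\<nu>) = ennreal (r (Suc n) powr (- \<kappa>)) * emeasure \<nu> (ball a (r n))"
      unfolding k_def by (subst nn_integral_cmult_indicator) auto
    also have "\<dots> \<le> ennreal (r (Suc n) powr (- \<kappa>)) * (ennreal ((\<tau> powr \<kappa> * \<theta>) ^ n) * M)"
      using mass[of n] by (intro mult_left_mono) (auto simp: r_def)
    also have "\<dots> = ennreal (r (Suc n) powr (- \<kappa>) * (\<tau> powr \<kappa> * \<theta>) ^ n) * M"
      using \<theta> by (simp add: ennreal_mult mult.assoc)
    finally show ?thesis unfolding eq using \<theta> by (simp add: ennreal_mult mult_ac)
  qed
  note summand = this
  have "(\<integral>\<^sup>+z. ennreal (dist z a powr (- \<kappa>)) * indicator (ball a \<rho>) z \<partial>\<nu>) \<le> (\<integral>\<^sup>+z. (\<Sum>n. k n z) \<partial>\<nu>)"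
    by (intro nn_integral_mono pt)
  also have "\<dots> = (\<Sum>n. \<integral>\<^sup>+z. k n z \<partial>\<nu>)"
    by (intro nn_integral_suminf k_meas)
  also have "\<dots> \<le> (\<Sum>n. ennreal ((\<tau> * \<rho>) powr (- \<kappa>)) * M * ennreal (\<theta> ^ n))"
    by (intro suminf_le summand summableI)
  also have "\<dots> = ennreal ((\<tau> * \<rho>) powr (- \<kappa>)) * M * (\<Sum>n. ennreal (\<theta> ^ n))"
    by (simp only: ennreal_suminf_cmult)
  also have "(\<Sum>n. ennreal (\<theta> ^ n)) = ennreal (1 / (1 - \<theta>))"
    using geometric_sums[of \<theta>] \<theta> by (intro suminf_ennreal_eq) auto
  also have "ennreal ((\<tau> * \<rho>) powr (- \<kappa>)) * M * ennreal (1 / (1 - \<theta>))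
     = ennreal ((\<tau> * \<rho>) powr (- \<kappa>) / (1 - \<theta>)) * M"
    using \<theta> ennreal_mult[of "(\<tau> * \<rho>) powr (- \<kappa>)" "1 / (1 - \<theta>)"] by (simp add: mult_ac)
  finally show ?thesis .
qed

text \<open>Iterating the choice of a child ball of small mass gives nested balls whose centres converge to a point
of \<open>E\<close>. All the smaller balls around that limit have small mass, which is the decay required by
\<open>riesz_integral_of_decaying_mass\<close>.\<close>

lemma point_with_small_riesz_integral_positive:
  fixes E :: "'a::euclidean_space set"
  assumes E: "closed E" and c: "0 < c" and cov: "\<And>x r R. x \<in> E \<Longrightarrow> 0 < r \<Longrightarrow> r < R \<Longrightarrow>
      c * (r / R) powr (- l) \<le> real (covering_number (E \<inter> ball x R) r)"
    and \<kappa>: "0 < \<kappa>" "\<kappa> < l"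
  shows "\<exists>C>0. \<forall>w\<in>E. \<forall>R>0. \<forall>\<nu>. sets \<nu> = sets borel \<longrightarrow> (\<exists>w'\<in>E. dist w w' \<le> R \<and>
      (\<integral>\<^sup>+z. ennreal (dist z w' powr (- \<kappa>)) * indicator (ball w' (4 * R)) z \<partial>\<nu>)
        \<le> ennreal (C * R powr (- \<kappa>)) * emeasure \<nu> (ball w (5 * R)))"
proof -
  obtain \<tau> where \<tau>: "0 < \<tau>" "\<tau> \<le> 1/8" and child:
    "\<And>w R \<nu>. w \<in> E \<Longrightarrow> 0 < R \<Longrightarrow> sets \<nu> = sets borel \<Longrightarrow>
      \<exists>w'\<in>E. dist w w' < R / 2 \<and> emeasure \<nu> (ball w' (\<tau> * R)) \<le> ennreal (\<tau> powr \<kappa> / 2) * emeasure \<nu> (ball w R)"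
    using child_ball_of_small_mass[OF c cov \<kappa>] by blast
  define C where "C = 4 powr \<kappa> + 2 * (\<tau> / 4) powr (- \<kappa>)"
  have C: "0 < C" by (auto simp: C_def intro!: add_pos_nonneg)
  show ?thesis
  proof (intro exI[of _ C] conjI C ballI allI impI)
    fix w :: 'a and R :: real and \<nu> :: "'a measure"
    assume w: "w \<in> E" and R: "0 < R" and sets[simp]: "sets \<nu> = sets borel"
    have "\<exists>f. \<forall>n::nat. (f n \<in> E \<and> (n = 0 \<longrightarrow> f n = w)) \<and> (dist (f n) (f (Suc n)) < \<tau> ^ n * R / 2 \<and>
        emeasure \<nu> (ball (f (Suc n)) (\<tau> ^ Suc n * R)) \<le> ennreal (\<tau> powr \<kappa> / 2) * emeasure \<nu> (ball (f n) (\<tau> ^ n * R)))"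
    proof (rule dependent_nat_choice)
      show "\<exists>x. x \<in> E \<and> ((0::nat) = 0 \<longrightarrow> x = w)" using w by auto
      fix x :: 'a and n :: nat assume "x \<in> E \<and> (n = 0 \<longrightarrow> x = w)"
      then show "\<exists>y. (y \<in> E \<and> (Suc n = 0 \<longrightarrow> y = w)) \<and> (dist x y < \<tau> ^ n * R / 2 \<and>
        emeasure \<nu> (ball y (\<tau> ^ Suc n * R)) \<le> ennreal (\<tau> powr \<kappa> / 2) * emeasure \<nu> (ball x (\<tau> ^ n * R)))"
        using child[of x "\<tau> ^ n * R" \<nu>] R \<tau> by (auto simp: mult.assoc)
    qed
    then obtain f where f0: "f 0 = w" and fE: "\<And>n. f n \<in> E"
      and fd: "\<And>n. dist (f n) (f (Suc n)) < \<tau> ^ n * R / 2"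
      and fm: "\<And>n. emeasure \<nu> (ball (f (Suc n)) (\<tau> ^ Suc n * R)) \<le> ennreal (\<tau> powr \<kappa> / 2) * emeasure \<nu> (ball (f n) (\<tau> ^ n * R))"
      by blast
    define r where "r n = \<tau> ^ n * R" for n
    have r: "0 < r n" "r (Suc n) = \<tau> * r n" "r (Suc n) \<le> r n / 8" for n
      using \<tau> R by (auto simp: r_def)
    have r0: "r \<longlonglongrightarrow> 0" unfolding r_def using \<tau> by (intro tendsto_mult_left_zero LIMSEQ_power_zero) auto
    have mass: "emeasure \<nu> (ball (f n) (r n)) \<le> ennreal ((\<tau> powr \<kappa> / 2) ^ n) * emeasure \<nu> (ball w R)" for n
    proof (induction n)
      case 0 then show ?case by (simp add: f0 r_def)
    next
      case (Suc n)
      have "emeasure \<nu> (ball (f (Suc n)) (r (Suc n))) \<le> ennreal (\<tau> powr \<kappa> / 2) * emeasure \<nu> (ball (f n) (r n))"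
        using fm[of n] by (simp add: r_def)
      also have "\<dots> \<le> ennreal (\<tau> powr \<kappa> / 2) * (ennreal ((\<tau> powr \<kappa> / 2) ^ n) * emeasure \<nu> (ball w R))"
        by (intro mult_left_mono Suc) auto
      also have "\<dots> = ennreal ((\<tau> powr \<kappa> / 2) ^ Suc n) * emeasure \<nu> (ball w R)"
        by (simp only: power_Suc ennreal_mult[OF _ zero_le_power] mult.assoc) (subst ennreal_mult, auto simp: mult.assoc)
      finally show ?case .
    qed
    \<comment> \<open>the margin of a quarter radius makes room for balls around the limit point\<close>
    have nest1: "cball (f (Suc n)) (r (Suc n)) \<subseteq> cball (f n) (3 / 4 * r n)" for n
    proof
      fix z assume "z \<in> cball (f (Suc n)) (r (Suc n))"
      then show "z \<in> cball (f n) (3 / 4 * r n)"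
        using dist_triangle[of "f n" z "f (Suc n)"] fd[of n] r[of n] by (simp add: r_def[of n])
    qed
    obtain a where a: "\<And>n. a \<in> cball (f n) (r n)"
    proof (rule decreasing_closed_nest[of "\<lambda>n. cball (f n) (r n)"])
      show "cball (f n) (r n) \<noteq> {}" for n using r(1)[of n] by auto
      show "cball (f n) (r n) \<subseteq> cball (f m) (r m)" if "m \<le> n" for m n
      proof (rule lift_Suc_antimono_le[OF _ that, of "\<lambda>n. cball (f n) (r n)"])
        fix n show "cball (f (Suc n)) (r (Suc n)) \<subseteq> cball (f n) (r n)"
          using nest1[of n] subset_cball[of "3 / 4 * r n" "r n" "f n"] r(1)[of n] by auto
      qed
      fix e :: real assume "e > 0"
      then obtain n where n: "r n < e / 2"
        using order_tendstoD(2)[OF r0, of "e / 2"] by (auto simp: eventually_sequentially)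
      show "\<exists>n. \<forall>x\<in>cball (f n) (r n). \<forall>y\<in>cball (f n) (r n). dist x y < e"
      proof (intro exI[of _ n] ballI)
        fix x y assume "x \<in> cball (f n) (r n)" "y \<in> cball (f n) (r n)"
        then show "dist x y < e" using n dist_triangle3[of x y "f n"] by simp
      qed
    qed auto
    have fa: "f \<longlonglongrightarrow> a"
    proof (rule tendstoI)
      fix e :: real assume "e > 0"
      show "\<forall>\<^sub>F n in sequentially. dist (f n) a < e"
        using order_tendstoD(2)[OF r0 \<open>e > 0\<close>] by eventually_elim (use a in \<open>auto intro: le_less_trans\<close>)
    qed
    have aE: "a \<in> E" using closed_sequentially[OF E] fE fa by blast
    have "dist w a \<le> R" using a[of 0] by (simp add: f0 r_def)
    have massa: "emeasure \<nu> (ball a (r n / 4)) \<le> ennreal ((\<tau> powr \<kappa> / 2) ^ n) * emeasure \<nu> (ball w R)" for n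
    proof -
      have "dist (f n) a \<le> 3 / 4 * r n" using a[of "Suc n"] nest1[of n] by auto
      then have "ball a (r n / 4) \<subseteq> ball (f n) (r n)"
        by (auto intro!: le_less_trans[OF dist_triangle[where y = a]])
      then have "emeasure \<nu> (ball a (r n / 4)) \<le> emeasure \<nu> (ball (f n) (r n))"
        by (intro emeasure_mono) auto
      then show ?thesis using mass[of n] by simp
    qed
    have near: "(\<integral>\<^sup>+z. ennreal (dist z a powr (- \<kappa>)) * indicator (ball a (R / 4)) z \<partial>\<nu>)
        \<le> ennreal ((\<tau> * (R / 4)) powr (- \<kappa>) / (1 - 1/2)) * emeasure \<nu> (ball w R)"
      using \<tau> \<kappa> R massa by (intro riesz_integral_of_decaying_mass[OF sets]) (auto simp: r_def)
    have pt: "ennreal (dist z a powr (- \<kappa>)) * indicator (ball a (4 * R)) z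
        \<le> ennreal ((R / 4) powr (- \<kappa>)) * indicator (ball a (4 * R)) z
          + ennreal (dist z a powr (- \<kappa>)) * indicator (ball a (R / 4)) z" for z
    proof (cases "dist z a < R / 4")
      case True
      then show ?thesis using R by (simp add: indicator_def dist_commute)
    next
      case False
      then have "dist z a powr (- \<kappa>) \<le> (R / 4) powr (- \<kappa>)" using R \<kappa> by (intro powr_mono2') auto
      then show ?thesis by (intro add_increasing2 mult_right_mono ennreal_leI) auto
    qed
    have "(\<integral>\<^sup>+z. ennreal (dist z a powr (- \<kappa>)) * indicator (ball a (4 * R)) z \<partial>\<nu>)
        \<le> (\<integral>\<^sup>+z. ennreal ((R / 4) powr (- \<kappa>)) * indicator (ball a (4 * R)) z
          + ennreal (dist z a powr (- \<kappa>)) * indicator (ball a (R / 4)) z \<partial>\<nu>)"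
      by (intro nn_integral_mono pt)
    also have "\<dots> = ennreal ((R / 4) powr (- \<kappa>)) * emeasure \<nu> (ball a (4 * R))
        + (\<integral>\<^sup>+z. ennreal (dist z a powr (- \<kappa>)) * indicator (ball a (R / 4)) z \<partial>\<nu>)"
    proof (subst nn_integral_add)
      show "(\<lambda>z. ennreal (dist z a powr (- \<kappa>)) * indicator (ball a (R / 4)) z) \<in> borel_measurable \<nu>"
        "(\<lambda>z. ennreal ((R / 4) powr (- \<kappa>)) * indicator (ball a (4 * R)) z) \<in> borel_measurable \<nu>"
        unfolding measurable_cong_sets[OF sets refl] by (rule borel_measurable_powr_ball)+
    qed (simp add: nn_integral_cmult_indicator)
    also have "\<dots> \<le> ennreal ((R / 4) powr (- \<kappa>)) * emeasure \<nu> (ball w (5 * R))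
        + ennreal ((\<tau> * (R / 4)) powr (- \<kappa>) / (1 - 1/2)) * emeasure \<nu> (ball w (5 * R))"
    proof (intro add_mono mult_left_mono emeasure_mono order_trans[OF near])
      show "ball a (4 * R) \<subseteq> ball w (5 * R)"
        using \<open>dist w a \<le> R\<close> by (auto intro!: le_less_trans[OF dist_triangle[where y = a]])
      show "ball w R \<subseteq> ball w (5 * R)" using R by auto
    qed auto
    also have "\<dots> = ennreal ((R / 4) powr (- \<kappa>) + (\<tau> * (R / 4)) powr (- \<kappa>) / (1 - 1/2)) * emeasure \<nu> (ball w (5 * R))"
      by (subst ennreal_plus) (auto simp: distrib_right)
    also have "(R / 4) powr (- \<kappa>) + (\<tau> * (R / 4)) powr (- \<kappa>) / (1 - 1/2) = C * R powr (- \<kappa>)"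
    proof -
      have "(\<tau> * (R / 4)) powr (- \<kappa>) = (\<tau> / 4) powr (- \<kappa>) * R powr (- \<kappa>)"
        using \<tau> R by (simp flip: powr_mult)
      moreover have "(R / 4) powr (- \<kappa>) = 4 powr \<kappa> * R powr (- \<kappa>)"
        using R by (simp add: powr_divide powr_minus field_simps)
      ultimately show ?thesis by (simp add: C_def algebra_simps)
    qed
    finally show "\<exists>w'\<in>E. dist w w' \<le> R \<and>
      (\<integral>\<^sup>+z. ennreal (dist z w' powr (- \<kappa>)) * indicator (ball w' (4 * R)) z \<partial>\<nu>)
        \<le> ennreal (C * R powr (- \<kappa>)) * emeasure \<nu> (ball w (5 * R))"
      using aE \<open>dist w a \<le> R\<close> by (intro bexI[of _ a]) auto
  qed
qed

text \<open>This is the substitute for a Frostman measure on \<open>E\<close>: instead of averaging over \<open>E\<close> one picks a point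
that is good for the given mass distribution, with a constant that does not depend on the distribution.
For \<open>\<kappa> \<le> 0\<close> the kernel is bounded and \<open>w\<close> itself will do.\<close>

lemma point_with_small_riesz_integral:
  fixes E :: "'a::euclidean_space set"
  assumes E: "closed E" and c: "0 < c" and cov: "\<And>x r R. x \<in> E \<Longrightarrow> 0 < r \<Longrightarrow> r < R \<Longrightarrow>
      c * (r / R) powr (- l) \<le> real (covering_number (E \<inter> ball x R) r)"
    and \<kappa>: "\<kappa> < l"
  shows "\<exists>C>0. \<forall>w\<in>E. \<forall>R>0. \<forall>\<nu>. sets \<nu> = sets borel \<longrightarrow> (\<exists>w'\<in>E. dist w w' \<le> R \<and>
      (\<integral>\<^sup>+z. ennreal (dist z w' powr (- \<kappa>)) * indicator (ball w' (4 * R)) z \<partial>\<nu>)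
        \<le> ennreal (C * R powr (- \<kappa>)) * emeasure \<nu> (ball w (5 * R)))"
proof (cases "0 < \<kappa>")
  case True
  then show ?thesis using point_with_small_riesz_integral_positive[OF E c cov _ \<kappa>] by blast
next
  case False
  show ?thesis
  proof (intro exI[of _ "4 powr (- \<kappa>)"] conjI ballI allI impI)
    fix w :: 'a and R :: real and \<nu> :: "'a measure"
    assume w: "w \<in> E" and R: "0 < R" and sets[simp]: "sets \<nu> = sets borel"
    have "(\<integral>\<^sup>+z. ennreal (dist z w powr (- \<kappa>)) * indicator (ball w (4 * R)) z \<partial>\<nu>)
        \<le> (\<integral>\<^sup>+z. ennreal ((4 * R) powr (- \<kappa>)) * indicator (ball w (5 * R)) z \<partial>\<nu>)"
      using False R by (intro nn_integral_mono) (auto simp: indicator_def dist_commute intro!: ennreal_leI powr_mono2)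
    also have "\<dots> = ennreal (4 powr (- \<kappa>) * R powr (- \<kappa>)) * emeasure \<nu> (ball w (5 * R))"
      using R by (subst nn_integral_cmult_indicator) (auto simp: powr_mult)
    finally show "\<exists>w'\<in>E. dist w w' \<le> R \<and>
      (\<integral>\<^sup>+z. ennreal (dist z w' powr (- \<kappa>)) * indicator (ball w' (4 * R)) z \<partial>\<nu>)
        \<le> ennreal (4 powr (- \<kappa>) * R powr (- \<kappa>)) * emeasure \<nu> (ball w (5 * R))"
      using w R by (intro bexI[of _ w]) auto
  qed auto
qed

section \<open>Kernel integrals\<close>

lemma nn_integral_lborel_affine:
  fixes f :: "'a::euclidean_space \<Rightarrow> ennreal"
  assumes [measurable]: "f \<in> borel_measurable borel" and c: "c \<noteq> 0"
  shows "(\<integral>\<^sup>+x. f x \<partial>lborel) = ennreal (\<bar>c\<bar> ^ DIM('a)) * (\<integral>\<^sup>+x. f (t + c *\<^sub>R x) \<partial>lborel)"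
  by (subst lborel_affine[OF c, of t])
    (simp add: nn_integral_density nn_integral_distr nn_integral_cmult)

lemma nn_integral_ball_powr_le:
  fixes s :: real
  assumes "s < real DIM('a::euclidean_space)"
  shows "\<exists>C>0. \<forall>w::'a. \<forall>\<rho>>0. (\<integral>\<^sup>+z. ennreal (dist z w powr (- s)) * indicator (ball w \<rho>) z \<partial>lborel)
    \<le> ennreal (C * \<rho> powr (real DIM('a) - s))"
proof (cases "0 < s")
  case True
  define n where "n = real DIM('a)"
  define \<omega> where "\<omega> = unit_ball_vol n"
  have \<omega>: "0 < \<omega>" by (simp add: \<omega>_def n_def)
  define \<theta> where "\<theta> = (1/2) powr (n - s)"
  have \<theta>: "0 < \<theta>" "\<theta> < 1" using assms powr_less_mono2_neg[of "s - n" 1 "2"] by (auto simp: \<theta>_def n_def powr_divide powr_minus powr_diff divide_simps powr_less_mono)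
  define C where "C = (1/2) powr (- s) / (1 - \<theta>) * \<omega>"
  show ?thesis
  proof (intro exI[of _ C] conjI allI impI)
    show "0 < C" using \<theta> \<omega> by (simp add: C_def)
    fix w :: 'a and \<rho> :: real assume \<rho>: "0 < \<rho>"
    have "(\<integral>\<^sup>+z. ennreal (dist z w powr (- s)) * indicator (ball w \<rho>) z \<partial>lborel)
      \<le> ennreal ((1/2 * \<rho>) powr (- s) / (1 - \<theta>)) * ennreal (\<omega> * \<rho> ^ DIM('a))"
    proof (rule riesz_integral_of_decaying_mass)
      fix k
      have "(1/2) powr s * \<theta> = (1/2 :: real) ^ DIM('a)"
        by (simp add: \<theta>_def n_def powr_realpow flip: powr_add)
      then have "((1/2) powr s * \<theta>) ^ k * (\<omega> * \<rho> ^ DIM('a)) = \<omega> * ((1/2) ^ k * \<rho>) ^ DIM('a)"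
        by (simp add: power_mult_distrib mult_ac flip: power_mult)
      then show "emeasure lborel (ball w ((1/2) ^ k * \<rho>)) \<le> ennreal (((1/2) powr s * \<theta>) ^ k) * ennreal (\<omega> * \<rho> ^ DIM('a))"
        using \<rho> \<theta> \<omega> by (simp add: emeasure_ball flip: ennreal_mult \<omega>_def n_def)
    qed (use True \<rho> \<theta> in auto)
    also have "\<dots> = ennreal ((1/2 * \<rho>) powr (- s) / (1 - \<theta>) * (\<omega> * \<rho> ^ DIM('a)))"
      using \<theta> \<omega> \<rho> by (intro ennreal_mult[symmetric]) auto
    also have "(1/2 * \<rho>) powr (- s) / (1 - \<theta>) * (\<omega> * \<rho> ^ DIM('a)) = C * \<rho> powr (real DIM('a) - s)"
      unfolding C_def powr_mult using \<rho> by (simp add: powr_diff powr_minus powr_realpow field_simps)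
    finally show "(\<integral>\<^sup>+z. ennreal (dist z w powr (- s)) * indicator (ball w \<rho>) z \<partial>lborel)
      \<le> ennreal (C * \<rho> powr (real DIM('a) - s))" .
  qed
next
  case False
  define \<omega> where "\<omega> = unit_ball_vol (real DIM('a))"
  have \<omega>: "0 < \<omega>" by (simp add: \<omega>_def)
  show ?thesis
  proof (intro exI[of _ \<omega>] conjI allI impI \<omega>)
    fix w :: 'a and \<rho> :: real assume \<rho>: "0 < \<rho>"
    have "(\<integral>\<^sup>+z. ennreal (dist z w powr (- s)) * indicator (ball w \<rho>) z \<partial>lborel)
      \<le> (\<integral>\<^sup>+z. ennreal (\<rho> powr (- s)) * indicator (ball w \<rho>) z \<partial>lborel)"
      using False by (intro nn_integral_mono) (auto simp: indicator_def dist_commute intro!: ennreal_leI powr_mono2)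
    also have "\<dots> = ennreal (\<rho> powr (- s)) * ennreal (\<omega> * \<rho> ^ DIM('a))"
      using \<rho> by (subst nn_integral_cmult_indicator) (auto simp: emeasure_ball \<omega>_def)
    also have "\<dots> = ennreal (\<omega> * \<rho> powr (real DIM('a) - s))"
      using \<rho> \<omega> by (subst ennreal_mult[symmetric]) (auto simp: powr_diff powr_minus powr_realpow field_simps)
    finally show "(\<integral>\<^sup>+z. ennreal (dist z w powr (- s)) * indicator (ball w \<rho>) z \<partial>lborel)
      \<le> ennreal (\<omega> * \<rho> powr (real DIM('a) - s))" .
  qed
qed

lemma nn_integral_powr_tail:
  fixes a c :: real
  assumes a: "0 < a" and c: "0 < c"
  shows "(\<integral>\<^sup>+t. ennreal (t powr (- a - 1)) * indicator {c..} t \<partial>lborel) = ennreal (c powr (- a) / a)"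
proof -
  have "(\<integral>\<^sup>+t. ennreal (t powr (- a - 1)) * indicator {c..} t \<partial>lborel) = ennreal (0 - (- (c powr (- a) / a)))"
  proof (rule nn_integral_FTC_atLeast)
    fix x assume "c \<le> x"
    then show "((\<lambda>x. - (x powr (- a) / a)) has_real_derivative x powr (- a - 1)) (at x)"
      using a c by (auto intro!: derivative_eq_intros)
  next
    show "((\<lambda>x. - (x powr (- a) / a)) \<longlongrightarrow> 0) at_top"
      using a tendsto_minus[OF tendsto_divide[OF tendsto_neg_powr[of "- a" "\<lambda>x. x"] tendsto_const, of at_top a]]
      by (simp add: filterlim_ident)
  qed auto
  then show ?thesis by simp
qed

text \<open>The case of interest is \<open>d = \<delta> z\<close>. The points of the region with \<open>\<delta> x \<le> t\<close> lie in the ball of radius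
\<open>6t\<close> around \<open>z\<close>, and there are none for \<open>t < d/7\<close>. By the layer-cake formula the integral is therefore at
most a multiple of that of \<open>t\<^bsup>-1-\<gamma>\<^esup>\<close> over \<open>t \<ge> d/7\<close>. The order \<open>1/\<gamma>\<close> of the bound is what makes the
absorption in \<open>hardy_unweighted\<close> possible.\<close>

lemma nn_integral_nontangential_le:
  fixes \<delta> :: "'a::euclidean_space \<Rightarrow> real"
  assumes [measurable]: "\<delta> \<in> borel_measurable borel" "G \<in> sets borel"
    and pos: "\<And>x. x \<in> G \<Longrightarrow> 0 < \<delta> x" and d: "0 < d"
    and far: "\<And>x. x \<in> G \<Longrightarrow> dist x z < 6 * \<delta> x \<Longrightarrow> d \<le> 7 * \<delta> x"
    and \<gamma>: "0 < \<gamma>" "\<gamma> \<le> 1"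
  shows "(\<integral>\<^sup>+x. ennreal (\<delta> x powr (- real DIM('a) - \<gamma>)) * indicator {x\<in>G. dist x z < 6 * \<delta> x} x \<partial>lborel)
    \<le> ennreal (7 * (real DIM('a) + 1) * 6 ^ DIM('a) * unit_ball_vol (real DIM('a)) / \<gamma> * d powr (- \<gamma>))"
proof -
  define n where "n = real DIM('a)"
  define \<omega> where "\<omega> = unit_ball_vol n"
  have \<omega>: "0 < \<omega>" by (simp add: \<omega>_def n_def)
  have n: "0 < n" by (simp add: n_def)
  let ?S = "{x\<in>G. dist x z < 6 * \<delta> x}"
  have [measurable]: "?S \<in> sets borel" by measurable
  \<comment> \<open>layer-cake formula for \<open>\<delta>\<^bsup>-n-\<gamma>\<^esup>\<close>\<close>
  define A where "A x t = ennreal (n + \<gamma>) * (ennreal (t powr (- (n + \<gamma>) - 1)) * indicator {\<delta> x..} t) * indicator ?S x" for x t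
  have "(\<integral>\<^sup>+x. ennreal (\<delta> x powr (- n - \<gamma>)) * indicator ?S x \<partial>lborel) = (\<integral>\<^sup>+x. \<integral>\<^sup>+t. A x t \<partial>lborel \<partial>lborel)"
  proof (intro nn_integral_cong)
    fix x
    show "ennreal (\<delta> x powr (- n - \<gamma>)) * indicator ?S x = (\<integral>\<^sup>+t. A x t \<partial>lborel)"
    proof (cases "x \<in> ?S")
      case True
      then have "0 < \<delta> x" using pos by auto
      then have "(\<integral>\<^sup>+t. A x t \<partial>lborel) = ennreal (n + \<gamma>) * ennreal (\<delta> x powr (- (n + \<gamma>)) / (n + \<gamma>))"
        unfolding A_def using True n \<gamma> nn_integral_powr_tail[of "n + \<gamma>" "\<delta> x"] by (simp add: nn_integral_cmult)
      also have "\<dots> = ennreal (\<delta> x powr (- n - \<gamma>))"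
        using n \<gamma> by (subst ennreal_mult[symmetric]) auto
      finally show ?thesis using True by simp
    qed (simp add: A_def)
  qed
  also have "\<dots> = (\<integral>\<^sup>+t. \<integral>\<^sup>+x. A x t \<partial>lborel \<partial>lborel)"
    unfolding A_def atLeast_def by (intro lborel_pair.Fubini') measurable
  also have "\<dots> \<le> (\<integral>\<^sup>+t. ennreal ((n + \<gamma>) * \<omega> * 6 ^ DIM('a)) * (ennreal (t powr (- \<gamma> - 1)) * indicator {d / 7..} t) \<partial>lborel)"
  proof (intro nn_integral_mono)
    fix t :: real
    show "(\<integral>\<^sup>+x. A x t \<partial>lborel) \<le> ennreal ((n + \<gamma>) * \<omega> * 6 ^ DIM('a)) * (ennreal (t powr (- \<gamma> - 1)) * indicator {d / 7..} t)"
    proof (cases "d / 7 \<le> t")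
      case False
      have "A x t = 0" for x using False far[of x] by (auto simp: A_def indicator_def)
      then show ?thesis by simp
    next
      case True
      then have t: "0 < t" using d by simp
      have "(\<integral>\<^sup>+x. A x t \<partial>lborel) \<le> (\<integral>\<^sup>+x. ennreal ((n + \<gamma>) * t powr (- (n + \<gamma>) - 1)) * indicator (ball z (6 * t)) x \<partial>lborel)"
        using n \<gamma> by (intro nn_integral_mono) (auto simp: A_def indicator_def dist_commute ennreal_mult)
      also have "\<dots> = ennreal ((n + \<gamma>) * t powr (- (n + \<gamma>) - 1)) * ennreal (\<omega> * (6 * t) ^ DIM('a))"
        using t by (subst nn_integral_cmult_indicator) (auto simp: emeasure_ball \<omega>_def n_def)
      also have "\<dots> = ennreal ((n + \<gamma>) * t powr (- (n + \<gamma>) - 1) * (\<omega> * (6 * t) ^ DIM('a)))"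
        using n \<gamma> \<omega> t by (intro ennreal_mult[symmetric]) auto
      also have "(n + \<gamma>) * t powr (- (n + \<gamma>) - 1) * (\<omega> * (6 * t) ^ DIM('a)) = (n + \<gamma>) * \<omega> * 6 ^ DIM('a) * t powr (- \<gamma> - 1)"
      proof -
        have "t powr (- (n + \<gamma>) - 1) * t ^ DIM('a) = t powr (- \<gamma> - 1)"
          using t by (simp add: n_def powr_realpow[symmetric] flip: powr_add)
        then show ?thesis by (simp add: power_mult_distrib mult_ac)
      qed
      finally show ?thesis using True n \<gamma> \<omega> by (simp add: ennreal_mult)
    qed
  qed
  also have "\<dots> = ennreal ((n + \<gamma>) * \<omega> * 6 ^ DIM('a)) * ennreal ((d / 7) powr (- \<gamma>) / \<gamma>)"
    using \<gamma> d by (subst nn_integral_cmult) (auto simp: nn_integral_powr_tail)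
  also have "\<dots> = ennreal ((n + \<gamma>) * \<omega> * 6 ^ DIM('a) * ((d / 7) powr (- \<gamma>) / \<gamma>))"
    using n \<gamma> \<omega> by (intro ennreal_mult[symmetric]) auto
  also have "\<dots> \<le> ennreal (7 * (n + 1) * 6 ^ DIM('a) * \<omega> / \<gamma> * d powr (- \<gamma>))"
  proof (rule ennreal_leI)
    have "(d / 7) powr (- \<gamma>) = 7 powr \<gamma> * d powr (- \<gamma>)" using d by (simp add: powr_divide powr_minus field_simps)
    also have "\<dots> \<le> 7 powr 1 * d powr (- \<gamma>)" using \<gamma> by (intro mult_right_mono powr_mono) auto
    finally have "(n + \<gamma>) * ((d / 7) powr (- \<gamma>)) \<le> (n + 1) * (7 * d powr (- \<gamma>))" using \<gamma> n by (intro mult_mono) auto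
    then have "(n + \<gamma>) * ((d / 7) powr (- \<gamma>)) * (\<omega> * 6 ^ DIM('a) / \<gamma>) \<le> (n + 1) * (7 * d powr (- \<gamma>)) * (\<omega> * 6 ^ DIM('a) / \<gamma>)"
      using \<omega> \<gamma> by (intro mult_right_mono) auto
    then show "(n + \<gamma>) * \<omega> * 6 ^ DIM('a) * ((d / 7) powr (- \<gamma>) / \<gamma>) \<le> 7 * (n + 1) * 6 ^ DIM('a) * \<omega> / \<gamma> * d powr (- \<gamma>)"
      by (simp only: mult_ac times_divide_eq_right times_divide_eq_left)
  qed
  finally show ?thesis unfolding \<omega>_def n_def .
qed

text \<open>Line integrals from a common end point \<open>w\<close>, integrated over the other end point, become a volume integral
by the substitution \<open>z = w + s (v - w)\<close>, \<open>dv = s\<^bsup>-n\<^esup> dz\<close>. A point \<open>z\<close> is met only for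
\<open>s > |z - w|/\<rho>\<close>, and the integral over these \<open>s\<close> produces the Riesz kernel.\<close>

lemma nn_integral_segments_le_riesz:
  fixes F :: "'a::euclidean_space \<Rightarrow> ennreal"
  assumes [measurable]: "F \<in> borel_measurable borel" and \<rho>: "0 < \<rho>"
  shows "(\<integral>\<^sup>+v. ennreal (dist v w) * (\<integral>\<^sup>+s. F (w + s *\<^sub>R (v - w)) * indicator {0<..<1} s \<partial>lborel) * indicator (ball w \<rho>) v \<partial>lborel)
    \<le> ennreal (\<rho> ^ DIM('a) / real DIM('a)) * (\<integral>\<^sup>+z. F z * ennreal (dist z w powr (1 - real DIM('a))) * indicator (ball w \<rho>) z \<partial>lborel)"
proof -
  define n where "n = real DIM('a)"
  have n: "0 < n" by (simp add: n_def)
  have "(\<integral>\<^sup>+v. ennreal (dist v w) * (\<integral>\<^sup>+s. F (w + s *\<^sub>R (v - w)) * indicator {0<..<1} s \<partial>lborel) * indicator (ball w \<rho>) v \<partial>lborel)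
    = (\<integral>\<^sup>+v. \<integral>\<^sup>+s. ennreal (dist v w) * (F (w + s *\<^sub>R (v - w)) * indicator {0<..<1} s) * indicator (ball w \<rho>) v \<partial>lborel \<partial>lborel)"
    by (intro nn_integral_cong) (simp add: nn_integral_cmult nn_integral_multc)
  also have "\<dots> = (\<integral>\<^sup>+s. \<integral>\<^sup>+v. ennreal (dist v w) * (F (w + s *\<^sub>R (v - w)) * indicator {0<..<1} s) * indicator (ball w \<rho>) v \<partial>lborel \<partial>lborel)"
    by (intro lborel_pair.Fubini') measurable
  also have "\<dots> = (\<integral>\<^sup>+s. \<integral>\<^sup>+z. F z * ennreal (dist z w) * (ennreal (s powr (- n - 1)) * indicator {s. 0 < s \<and> s < 1 \<and> dist z w < s * \<rho>} s) \<partial>lborel \<partial>lborel)"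
  proof (rule nn_integral_cong)
    fix s :: real
    show "(\<integral>\<^sup>+v. ennreal (dist v w) * (F (w + s *\<^sub>R (v - w)) * indicator {0<..<1} s) * indicator (ball w \<rho>) v \<partial>lborel)
      = (\<integral>\<^sup>+z. F z * ennreal (dist z w) * (ennreal (s powr (- n - 1)) * indicator {s. 0 < s \<and> s < 1 \<and> dist z w < s * \<rho>} s) \<partial>lborel)"
    proof (cases "s \<in> {0<..<1}")
      case False then show ?thesis by auto
    next
      case True
      then have s: "0 < s" "s < 1" by auto
      define f where "f v = ennreal (dist v w) * F (w + s *\<^sub>R (v - w)) * indicator (ball w \<rho>) v" for v
      have f_meas[measurable]: "f \<in> borel_measurable borel" unfolding f_def by measurable
      have "(\<integral>\<^sup>+v. ennreal (dist v w) * (F (w + s *\<^sub>R (v - w)) * indicator {0<..<1} s) * indicator (ball w \<rho>) v \<partial>lborel)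
        = (\<integral>\<^sup>+v. f v \<partial>lborel)" using True by (simp add: f_def)
      also have "\<dots> = ennreal (\<bar>1 / s\<bar> ^ DIM('a)) * (\<integral>\<^sup>+z. f ((w - (1 / s) *\<^sub>R w) + (1 / s) *\<^sub>R z) \<partial>lborel)"
        using s by (intro nn_integral_lborel_affine) auto
      also have "\<dots> = (\<integral>\<^sup>+z. ennreal (\<bar>1 / s\<bar> ^ DIM('a)) * f ((w - (1 / s) *\<^sub>R w) + (1 / s) *\<^sub>R z) \<partial>lborel)"
        by (subst nn_integral_cmult) auto
      also have "\<dots> = (\<integral>\<^sup>+z. F z * ennreal (dist z w) * (ennreal (s powr (- n - 1)) * indicator {s. 0 < s \<and> s < 1 \<and> dist z w < s * \<rho>} s) \<partial>lborel)"
      proof (intro nn_integral_cong)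
        fix z
        let ?v = "(w - (1 / s) *\<^sub>R w) + (1 / s) *\<^sub>R z"
        have v: "?v - w = (1 / s) *\<^sub>R (z - w)" by (simp add: algebra_simps)
        have dv: "dist ?v w = dist z w / s" unfolding dist_norm v using s by simp
        have zv: "w + s *\<^sub>R (?v - w) = z" unfolding v using s by simp
        have ball: "?v \<in> ball w \<rho> \<longleftrightarrow> dist z w < s * \<rho>"
          unfolding mem_ball dist_commute[of w] dv using s by (simp add: field_simps)
        have "ennreal (\<bar>1 / s\<bar> ^ DIM('a)) * ennreal (dist z w / s) = ennreal (dist z w) * ennreal (s powr (- n - 1))"
          using s by (simp add: n_def powr_diff powr_minus powr_realpow power_one_over field_simps flip: ennreal_mult)
        then show "ennreal (\<bar>1 / s\<bar> ^ DIM('a)) * f ?v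
          = F z * ennreal (dist z w) * (ennreal (s powr (- n - 1)) * indicator {s. 0 < s \<and> s < 1 \<and> dist z w < s * \<rho>} s)"
          unfolding f_def dv zv using ball s by (auto simp: indicator_def mult_ac)
      qed
      finally show ?thesis .
    qed
  qed
  also have "\<dots> = (\<integral>\<^sup>+z. \<integral>\<^sup>+s. F z * ennreal (dist z w) * (ennreal (s powr (- n - 1)) * indicator {s. 0 < s \<and> s < 1 \<and> dist z w < s * \<rho>} s) \<partial>lborel \<partial>lborel)"
    by (intro lborel_pair.Fubini') measurable
  also have "\<dots> \<le> (\<integral>\<^sup>+z. ennreal (\<rho> ^ DIM('a) / n) * (F z * ennreal (dist z w powr (1 - n)) * indicator (ball w \<rho>) z) \<partial>lborel)"
  proof (intro nn_integral_mono)
    fix z :: 'a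
    have "(\<integral>\<^sup>+s. F z * ennreal (dist z w) * (ennreal (s powr (- n - 1)) * indicator {s. 0 < s \<and> s < 1 \<and> dist z w < s * \<rho>} s) \<partial>lborel)
      = F z * ennreal (dist z w) * (\<integral>\<^sup>+s. ennreal (s powr (- n - 1)) * indicator {s. 0 < s \<and> s < 1 \<and> dist z w < s * \<rho>} s \<partial>lborel)"
      by (intro nn_integral_cmult) auto
    also have "\<dots> \<le> ennreal (\<rho> ^ DIM('a) / n) * (F z * ennreal (dist z w powr (1 - n)) * indicator (ball w \<rho>) z)"
    proof (cases "z = w")
      case False
      then have dz: "0 < dist z w" by auto
      show ?thesis
      proof (cases "z \<in> ball w \<rho>")
        case True
        have "(\<integral>\<^sup>+s. ennreal (s powr (- n - 1)) * indicator {s. 0 < s \<and> s < 1 \<and> dist z w < s * \<rho>} s \<partial>lborel)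
          \<le> (\<integral>\<^sup>+s. ennreal (s powr (- n - 1)) * indicator {dist z w / \<rho>..} s \<partial>lborel)"
          using \<rho> by (intro nn_integral_mono) (auto simp: indicator_def field_simps)
        also have "\<dots> = ennreal ((dist z w / \<rho>) powr (- n) / n)"
          using n dz \<rho> by (intro nn_integral_powr_tail) auto
        finally have "ennreal (dist z w) * (\<integral>\<^sup>+s. ennreal (s powr (- n - 1)) * indicator {s. 0 < s \<and> s < 1 \<and> dist z w < s * \<rho>} s \<partial>lborel)
          \<le> ennreal (dist z w) * ennreal ((dist z w / \<rho>) powr (- n) / n)" by (intro mult_left_mono) auto
        also have "\<dots> = ennreal (\<rho> ^ DIM('a) / n) * ennreal (dist z w powr (1 - n))"
          using \<rho> dz n by (simp add: powr_divide powr_minus powr_diff powr_realpow[symmetric] n_def field_simps flip: ennreal_mult)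
        finally show ?thesis using True by (simp add: mult_ac mult_left_mono[of _ _ "F z"])
      next
        case False
        then have "{s. 0 < s \<and> s < 1 \<and> dist z w < s * \<rho>} = {}"
          using \<rho> by (auto simp: dist_commute) (meson less_le_trans less_trans linorder_not_le mult_less_cancel_right2)
        then show ?thesis by simp
      qed
    qed simp
    finally show "(\<integral>\<^sup>+s. F z * ennreal (dist z w) * (ennreal (s powr (- n - 1)) * indicator {s. 0 < s \<and> s < 1 \<and> dist z w < s * \<rho>} s) \<partial>lborel)
      \<le> ennreal (\<rho> ^ DIM('a) / n) * (F z * ennreal (dist z w powr (1 - n)) * indicator (ball w \<rho>) z)" .
  qed
  also have "\<dots> = ennreal (\<rho> ^ DIM('a) / n) * (\<integral>\<^sup>+z. F z * ennreal (dist z w powr (1 - n)) * indicator (ball w \<rho>) z \<partial>lborel)"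
    by (intro nn_integral_cmult) measurable
  finally show ?thesis unfolding n_def .
qed

section \<open>Oscillation on an interval\<close>

text \<open>A mean value inequality without differentiability of \<open>h\<close>. The estimate with an error proportional to the
length of the interval is additive, so by bisection it suffices to have it on short intervals around
each point.\<close>

lemma abs_diff_le_integral_of_local_lipschitz:
  fixes h \<phi> :: "real \<Rightarrow> real"
  assumes ab: "a \<le> b" and \<phi>: "continuous_on {a..b} \<phi>"
    and lip: "\<And>s \<epsilon>. s \<in> {a..b} \<Longrightarrow> 0 < \<epsilon> \<Longrightarrow>
      \<exists>d>0. \<forall>t\<in>{a..b}. \<bar>t - s\<bar> < d \<longrightarrow> \<bar>h t - h s\<bar> \<le> (\<phi> s + \<epsilon>) * \<bar>t - s\<bar>"
  shows "\<bar>h b - h a\<bar> \<le> integral {a..b} \<phi>"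
proof (rule field_le_epsilon)
  fix e :: real assume e: "0 < e"
  define \<epsilon> where "\<epsilon> = e / (2 * (b - a + 1))"
  have \<epsilon>: "0 < \<epsilon>" using e ab by (simp add: \<epsilon>_def)
  define \<Phi> where "\<Phi> s = integral {a..s} \<phi>" for s
  have \<Phi>: "(\<Phi> has_real_derivative \<phi> s) (at s within {a..b})" if "s \<in> {a..b}" for s
    unfolding \<Phi>_def using integral_has_real_derivative[OF \<phi> that] .
  have *: "a \<le> u \<longrightarrow> v \<le> b \<longrightarrow> \<bar>h v - h u\<bar> \<le> \<Phi> v - \<Phi> u + 2 * \<epsilon> * (v - u)" if "u \<le> v" for u v
    using that
  proof (rule Bolzano)
    fix u v w assume "a \<le> u \<longrightarrow> v \<le> b \<longrightarrow> \<bar>h v - h u\<bar> \<le> \<Phi> v - \<Phi> u + 2 * \<epsilon> * (v - u)"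
      "a \<le> v \<longrightarrow> w \<le> b \<longrightarrow> \<bar>h w - h v\<bar> \<le> \<Phi> w - \<Phi> v + 2 * \<epsilon> * (w - v)" "u \<le> v" "v \<le> w"
    then show "a \<le> u \<longrightarrow> w \<le> b \<longrightarrow> \<bar>h w - h u\<bar> \<le> \<Phi> w - \<Phi> u + 2 * \<epsilon> * (w - u)"
      by (auto simp: algebra_simps)
  next
    fix x
    show "\<exists>d>0. \<forall>u v. u \<le> x \<and> x \<le> v \<and> v - u < d \<longrightarrow>
      (a \<le> u \<longrightarrow> v \<le> b \<longrightarrow> \<bar>h v - h u\<bar> \<le> \<Phi> v - \<Phi> u + 2 * \<epsilon> * (v - u))"
    proof (cases "x \<in> {a..b}")
      case False
      then show ?thesis by (intro exI[of _ 1]) auto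
    next
      case True
      obtain d1 where d1: "0 < d1" "\<And>t. t \<in> {a..b} \<Longrightarrow> \<bar>t - x\<bar> < d1 \<Longrightarrow> \<bar>h t - h x\<bar> \<le> (\<phi> x + \<epsilon>) * \<bar>t - x\<bar>"
        using lip[OF True \<epsilon>] by blast
      have "(\<Phi> has_derivative (\<lambda>y. \<phi> x * y)) (at x within {a..b})"
        using \<Phi>[OF True] by (simp add: has_field_derivative_def)
      then obtain d2 where d2: "0 < d2" "\<And>t. t \<in> {a..b} \<Longrightarrow> \<bar>t - x\<bar> < d2 \<Longrightarrow> \<bar>\<Phi> t - \<Phi> x - \<phi> x * (t - x)\<bar> \<le> \<epsilon> * \<bar>t - x\<bar>"
        using \<epsilon> unfolding has_derivative_within_alt by (auto simp: real_norm_def)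
      show ?thesis
      proof (intro exI[of _ "min d1 d2"] conjI allI impI)
        fix u v assume uv: "u \<le> x \<and> x \<le> v \<and> v - u < min d1 d2" "a \<le> u" "v \<le> b"
        have "\<bar>h u - h x\<bar> \<le> (\<phi> x + \<epsilon>) * (x - u)" "\<bar>h v - h x\<bar> \<le> (\<phi> x + \<epsilon>) * (v - x)"
          using d1(2)[of u] d1(2)[of v] uv True by auto
        moreover have "\<bar>\<Phi> u - \<Phi> x - \<phi> x * (u - x)\<bar> \<le> \<epsilon> * (x - u)" "\<bar>\<Phi> v - \<Phi> x - \<phi> x * (v - x)\<bar> \<le> \<epsilon> * (v - x)"
          using d2(2)[of u] d2(2)[of v] uv True by auto
        ultimately show "\<bar>h v - h u\<bar> \<le> \<Phi> v - \<Phi> u + 2 * \<epsilon> * (v - u)"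
          by (simp add: algebra_simps abs_le_iff)
      qed (use d1 d2 in auto)
    qed
  qed
  have "2 * \<epsilon> * (b - a) \<le> e"
  proof -
    have "2 * \<epsilon> * (b - a) = e * ((b - a) / (b - a + 1))" using ab by (simp add: \<epsilon>_def field_simps)
    also have "\<dots> \<le> e * 1" using ab e by (intro mult_left_mono) (auto simp: field_simps)
    finally show ?thesis by simp
  qed
  then show "\<bar>h b - h a\<bar> \<le> integral {a..b} \<phi> + e"
    using *[OF ab] by (auto simp: \<Phi>_def)
qed

text \<open>The left end point is set apart because \<open>\<phi>\<close> will be an upper gradient along a segment that starts on the
boundary of \<open>G\<close>, where it is not controlled. Continuity of \<open>h\<close> lets the left end point be approached from the
right.\<close>

lemma abs_diff_le_nn_integral_of_local_lipschitz:
  fixes h \<phi> :: "real \<Rightarrow> real"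
  assumes ab: "a < b" and h: "continuous_on {a..b} h" and \<phi>: "continuous_on {a<..b} \<phi>"
    and nonneg: "\<And>s. s \<in> {a<..b} \<Longrightarrow> 0 \<le> \<phi> s"
    and lip: "\<And>s \<epsilon>. s \<in> {a<..b} \<Longrightarrow> 0 < \<epsilon> \<Longrightarrow>
      \<exists>d>0. \<forall>t\<in>{a<..b}. \<bar>t - s\<bar> < d \<longrightarrow> \<bar>h t - h s\<bar> \<le> (\<phi> s + \<epsilon>) * \<bar>t - s\<bar>"
  shows "ennreal \<bar>h b - h a\<bar> \<le> (\<integral>\<^sup>+s. ennreal (\<phi> s) * indicator {a<..<b} s \<partial>lborel)"
proof -
  define J where "J = (\<integral>\<^sup>+s. ennreal (\<phi> s) * indicator {a<..<b} s \<partial>lborel)"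
  have le: "ennreal \<bar>h b - h c\<bar> \<le> J" if c: "a < c" "c \<le> b" for c
  proof -
    have cont: "continuous_on {c..b} \<phi>" using \<phi> c by (rule_tac continuous_on_subset) auto
    have "\<bar>h b - h c\<bar> \<le> integral {c..b} \<phi>"
    proof (rule abs_diff_le_integral_of_local_lipschitz[OF c(2) cont])
      fix s \<epsilon> :: real assume "s \<in> {c..b}" "0 < \<epsilon>"
      then obtain d where "0 < d" "\<forall>t\<in>{a<..b}. \<bar>t - s\<bar> < d \<longrightarrow> \<bar>h t - h s\<bar> \<le> (\<phi> s + \<epsilon>) * \<bar>t - s\<bar>"
        using lip[of s \<epsilon>] c by auto
      then show "\<exists>d>0. \<forall>t\<in>{c..b}. \<bar>t - s\<bar> < d \<longrightarrow> \<bar>h t - h s\<bar> \<le> (\<phi> s + \<epsilon>) * \<bar>t - s\<bar>"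
        using c by (intro exI[of _ d]) auto
    qed
    then have "ennreal \<bar>h b - h c\<bar> \<le> ennreal (integral {c..b} \<phi>)" by (rule ennreal_leI)
    also have "ennreal (integral {c..b} \<phi>) = (\<integral>\<^sup>+s. ennreal (\<phi> s) * indicator {c..b} s \<partial>lborel)"
    proof -
      have m: "(\<lambda>s. \<phi> s * indicator {c..b} s) \<in> borel_measurable borel"
        using borel_measurable_continuous_on_indicator[OF _ cont] by (simp add: mult.commute)
      have "((\<lambda>s. \<phi> s * indicator {c..b} s) has_integral integral {c..b} \<phi>) UNIV"
        using integrable_integral[OF integrable_continuous_real[OF cont]]
        by (subst (asm) has_integral_restrict_UNIV[symmetric]) (simp add: indicator_def of_bool_def if_distrib cong: if_cong)
      then have "(\<integral>\<^sup>+s. ennreal (\<phi> s * indicator {c..b} s) \<partial>lborel) = ennreal (integral {c..b} \<phi>)"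
        using nonneg c by (intro nn_integral_has_integral_lborel m) (auto simp: indicator_def)
      then show ?thesis
        by (subst (asm) nn_integral_cong[where v = "\<lambda>s. ennreal (\<phi> s) * indicator {c..b} s"]) (auto simp: indicator_def)
    qed
    also have "\<dots> \<le> J" unfolding J_def
    proof (intro nn_integral_mono_AE)
      show "AE s in lborel. ennreal (\<phi> s) * indicator {c..b} s \<le> ennreal (\<phi> s) * indicator {a<..<b} s"
        using AE_lborel_singleton[of b] by eventually_elim (use c in \<open>auto simp: indicator_def\<close>)
    qed
    finally show ?thesis .
  qed
  show ?thesis
  proof (cases "J = top")
    case False
    then obtain j where j: "J = ennreal j" "0 \<le> j" by (metis ennreal_cases)
    have "\<bar>h b - h a\<bar> \<le> j"
    proof (rule tendsto_upperbound)
      have "(h \<longlongrightarrow> h a) (at a within {a..b})" using h ab by (auto simp: continuous_on_def)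
      then have "(h \<longlongrightarrow> h a) (at a within {a<..b})"
        by (rule tendsto_within_subset) auto
      then show "((\<lambda>c. \<bar>h b - h c\<bar>) \<longlongrightarrow> \<bar>h b - h a\<bar>) (at a within {a<..b})"
        by (intro tendsto_intros)
      show "\<forall>\<^sub>F c in at a within {a<..b}. \<bar>h b - h c\<bar> \<le> j"
        unfolding eventually_at_topological
        using le j by (intro exI[of _ UNIV]) auto
      show "at a within {a<..b} \<noteq> bot"
        using ab by (simp add: at_within_eq_bot_iff trivial_limit_within islimpt_greaterThanLessThan1 flip: islimpt_Ioc)
    qed
    then show ?thesis using j unfolding J_def[symmetric] by simp
  qed (simp add: J_def[symmetric])
qed

section \<open>Distance to the boundary and upper gradients\<close>

locale proper_open_set =
  fixes G :: "'a::euclidean_space set"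
  assumes open_G: "open G" and nonempty: "G \<noteq> {}" and proper: "G \<noteq> UNIV"
begin

definition \<delta> :: "'a \<Rightarrow> real" where "\<delta> x = infdist x (frontier G)"

lemma frontier_G: "frontier G \<noteq> {}" "frontier G \<inter> G = {}" "closed (frontier G)"
  using open_G nonempty proper by (auto simp: frontier_eq_empty frontier_disjoint_eq)

lemma \<delta>_measurable[measurable]: "\<delta> \<in> borel_measurable borel"
  unfolding \<delta>_def by (intro borel_measurable_continuous_onI continuous_intros)

lemma G_measurable[measurable]: "G \<in> sets borel"
  using open_G by (rule borel_open)

lemma \<delta>_nonneg[simp]: "0 \<le> \<delta> x"
  by (simp add: \<delta>_def infdist_nonneg)

lemma \<delta>_lipschitz: "\<delta> x \<le> \<delta> y + dist x y"
  unfolding \<delta>_def by (rule infdist_triangle)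

lemma \<delta>_pos: "x \<in> G \<Longrightarrow> 0 < \<delta> x"
  using infdist_pos_not_in_closed[of "frontier G" x] frontier_G by (auto simp: \<delta>_def)

lemma \<delta>_le_dist: assumes "x \<in> G" "w \<notin> G" shows "\<delta> x \<le> dist x w"
proof -
  have "closed_segment x w \<inter> frontier G \<noteq> {}"
    using assms by (intro connected_Int_frontier) auto
  then obtain z where "z \<in> closed_segment x w" "z \<in> frontier G" by auto
  then show ?thesis using infdist_le[of z "frontier G" x] dist_in_closed_segment[of z x w]
    by (auto simp: \<delta>_def dist_commute)
qed

lemma in_G_if_dist_less: "x \<in> G \<Longrightarrow> dist x y < \<delta> x \<Longrightarrow> y \<in> G"
  using \<delta>_le_dist[of x y] by fastforce

lemma nearest_point: obtains w where "w \<notin> G" "dist x w = \<delta> x"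
  using infdist_attains_inf[of "frontier G" x] frontier_G unfolding \<delta>_def by (metis disjoint_iff)

text \<open>The function \<open>g\<close> is a continuous upper gradient of \<open>u\<close> in \<open>G\<close>. This notion covers \<open>f\<close> with \<open>|\<nabla>f|\<close>
as well as \<open>f \<delta>\<^sup>t\<close>, which is in general not differentiable. It constrains \<open>g\<close> only inside \<open>G\<close>, since
\<open>|\<nabla>f|\<close> need not vanish on the boundary.\<close>

definition upper_pair :: "('a \<Rightarrow> real) \<Rightarrow> ('a \<Rightarrow> real) \<Rightarrow> bool" where
  "upper_pair u g \<longleftrightarrow> continuous_on UNIV u \<and> (\<forall>x. x \<notin> G \<longrightarrow> u x = 0)
     \<and> continuous_on G g \<and> (\<forall>x\<in>G. 0 \<le> g x)
     \<and> (\<forall>z\<in>G. \<forall>\<epsilon>>0. \<exists>d>0. \<forall>y. dist y z < d \<longrightarrow> \<bar>u y - u z\<bar> \<le> (g z + \<epsilon>) * dist y z)"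

lemma upper_pair_measurable:
  assumes "upper_pair u g"
  shows "u \<in> borel_measurable borel" "(\<lambda>z. g z * indicator G z) \<in> borel_measurable borel"
  using assms borel_measurable_continuous_on_indicator[OF G_measurable, of g]
  by (auto simp: upper_pair_def mult.commute intro: borel_measurable_continuous_onI)

definition energy_density :: "('a \<Rightarrow> real) \<Rightarrow> real \<Rightarrow> real \<Rightarrow> 'a \<Rightarrow> ennreal" where
  "energy_density g p b z = ennreal (g z powr p * \<delta> z powr b) * indicator G z"

lemma energy_density_measurable:
  assumes "upper_pair u g" shows "energy_density g p b \<in> borel_measurable borel"
proof -
  note [measurable] = upper_pair_measurable[OF assms]
  have "energy_density g p b = (\<lambda>z. ennreal ((g z * indicator G z) powr p * \<delta> z powr b) * indicator G z)"
    by (auto simp: energy_density_def fun_eq_iff indicator_def)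
  also have "\<dots> \<in> borel_measurable borel" by measurable
  finally show ?thesis .
qed

lemma density_measurable:
  assumes "upper_pair u g" shows "(\<lambda>z. ennreal (g z) * indicator G z) \<in> borel_measurable borel"
proof -
  note [measurable] = upper_pair_measurable[OF assms]
  have "(\<lambda>z. ennreal (g z) * indicator G z) = (\<lambda>z. ennreal (g z * indicator G z))"
    by (auto simp: fun_eq_iff indicator_def)
  also have "\<dots> \<in> borel_measurable borel" by measurable
  finally show ?thesis .
qed

lemma upper_pair_segment:
  assumes ug: "upper_pair u g" and s0: "0 \<le> s0" "s0 < 1"
    and G: "\<And>s. s0 < s \<Longrightarrow> s \<le> 1 \<Longrightarrow> w + s *\<^sub>R (y - w) \<in> G"
  shows "ennreal \<bar>u y - u (w + s0 *\<^sub>R (y - w))\<bar> \<le> ennreal (dist y w) *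
    (\<integral>\<^sup>+s. (ennreal (g (w + s *\<^sub>R (y - w))) * indicator G (w + s *\<^sub>R (y - w))) * indicator {0<..<1} s \<partial>lborel)"
proof -
  note [measurable] = density_measurable[OF ug]
  define \<xi> where "\<xi> s = w + s *\<^sub>R (y - w)" for s
  define D where "D = dist y w"
  have D: "0 \<le> D" by (simp add: D_def)
  have dist_\<xi>: "dist (\<xi> s) (\<xi> t) = \<bar>s - t\<bar> * D" for s t
  proof -
    have "\<xi> s - \<xi> t = (s - t) *\<^sub>R (y - w)" by (simp add: \<xi>_def algebra_simps)
    then show ?thesis by (simp add: dist_norm D_def)
  qed
  have cont_\<xi>: "continuous_on S \<xi>" for S unfolding \<xi>_def by (intro continuous_intros)
  have "ennreal \<bar>u (\<xi> 1) - u (\<xi> s0)\<bar> \<le> (\<integral>\<^sup>+s. ennreal (g (\<xi> s) * D) * indicator {s0<..<1} s \<partial>lborel)"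
  proof (rule abs_diff_le_nn_integral_of_local_lipschitz[where h = "\<lambda>s. u (\<xi> s)"])
    show "continuous_on {s0..1} (\<lambda>s. u (\<xi> s))"
      using ug cont_\<xi> by (auto simp: upper_pair_def intro!: continuous_on_compose2[of UNIV u])
    show "continuous_on {s0<..1} (\<lambda>s. g (\<xi> s) * D)"
      using ug cont_\<xi> G by (auto simp: upper_pair_def \<xi>_def intro!: continuous_intros continuous_on_compose2[of G g])
    show "0 \<le> g (\<xi> s) * D" if "s \<in> {s0<..1}" for s
      using ug G[of s] that D by (auto simp: upper_pair_def \<xi>_def)
    fix s \<epsilon> :: real assume s: "s \<in> {s0<..1}" and \<epsilon>: "0 < \<epsilon>"
    have "\<xi> s \<in> G" using G[of s] s by (simp add: \<xi>_def)
    moreover have "0 < \<epsilon> / (D + 1)" using D \<epsilon> by simp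
    ultimately obtain d where d: "0 < d" "\<And>y. dist y (\<xi> s) < d \<Longrightarrow> \<bar>u y - u (\<xi> s)\<bar> \<le> (g (\<xi> s) + \<epsilon> / (D + 1)) * dist y (\<xi> s)"
      using ug unfolding upper_pair_def by metis
    show "\<exists>d>0. \<forall>t\<in>{s0<..1}. \<bar>t - s\<bar> < d \<longrightarrow> \<bar>u (\<xi> t) - u (\<xi> s)\<bar> \<le> (g (\<xi> s) * D + \<epsilon>) * \<bar>t - s\<bar>"
    proof (intro exI[of _ "d / (D + 1)"] conjI ballI impI)
      fix t assume t: "\<bar>t - s\<bar> < d / (D + 1)"
      then have "\<bar>t - s\<bar> * (D + 1) < d" using D by (simp add: field_simps)
      then have "dist (\<xi> t) (\<xi> s) < d" unfolding dist_\<xi> by (simp add: distrib_left)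
      then have "\<bar>u (\<xi> t) - u (\<xi> s)\<bar> \<le> (g (\<xi> s) + \<epsilon> / (D + 1)) * (\<bar>t - s\<bar> * D)"
        using d(2) dist_\<xi> by metis
      also have "\<dots> = (g (\<xi> s) * D + \<epsilon> * (D / (D + 1))) * \<bar>t - s\<bar>" by (simp add: field_simps)
      also have "\<dots> \<le> (g (\<xi> s) * D + \<epsilon> * 1) * \<bar>t - s\<bar>"
        using D \<epsilon> by (intro mult_right_mono add_left_mono mult_left_mono) auto
      finally show "\<bar>u (\<xi> t) - u (\<xi> s)\<bar> \<le> (g (\<xi> s) * D + \<epsilon>) * \<bar>t - s\<bar>" by simp
    qed (use d D in auto)
  qed (rule s0)
  also have "\<dots> \<le> (\<integral>\<^sup>+s. ennreal D * ((ennreal (g (\<xi> s)) * indicator G (\<xi> s)) * indicator {0<..<1} s) \<partial>lborel)"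
  proof (intro nn_integral_mono)
    fix s
    show "ennreal (g (\<xi> s) * D) * indicator {s0<..<1} s \<le> ennreal D * ((ennreal (g (\<xi> s)) * indicator G (\<xi> s)) * indicator {0<..<1} s)"
    proof (cases "s \<in> {s0<..<1}")
      case True
      then have "\<xi> s \<in> G" using G[of s] by (simp add: \<xi>_def)
      then show ?thesis using True s0 D ug by (simp add: upper_pair_def ennreal_mult mult.commute)
    qed simp
  qed
  also have "\<dots> = ennreal D * (\<integral>\<^sup>+s. (ennreal (g (\<xi> s)) * indicator G (\<xi> s)) * indicator {0<..<1} s \<partial>lborel)"
    unfolding \<xi>_def by (intro nn_integral_cmult) measurable
  finally show ?thesis by (simp add: \<xi>_def D_def)
qed

text \<open>Only the part of the segment after its last point outside \<open>G\<close> matters, because \<open>u\<close> vanishes at that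
point.\<close>

lemma upper_pair_segment_from_complement:
  assumes ug: "upper_pair u g" and w: "w \<notin> G" and y: "y \<in> G"
  shows "ennreal \<bar>u y\<bar> \<le> ennreal (dist y w) *
    (\<integral>\<^sup>+s. (ennreal (g (w + s *\<^sub>R (y - w))) * indicator G (w + s *\<^sub>R (y - w))) * indicator {0<..<1} s \<partial>lborel)"
proof -
  define S where "S = {0..1} \<inter> (\<lambda>s. w + s *\<^sub>R (y - w)) -` (- G)"
  have "closed S"
    unfolding S_def using open_G by (intro closed_Int closed_vimage continuous_intros) (auto simp: closed_def)
  then have "compact S"
    unfolding S_def compact_eq_bounded_closed by (auto intro: bounded_subset[of "{0..1}"])
  moreover have "0 \<in> S" using w by (simp add: S_def)
  ultimately obtain s0 where s0: "s0 \<in> S" "\<And>s. s \<in> S \<Longrightarrow> s \<le> s0"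
    using compact_attains_sup[of S] by blast
  have "s0 \<noteq> 1" using s0(1) y by (auto simp: S_def)
  then have "0 \<le> s0" "s0 < 1" using s0(1) by (auto simp: S_def)
  moreover have "w + s *\<^sub>R (y - w) \<in> G" if "s0 < s" "s \<le> 1" for s
    using s0(2)[of s] that \<open>0 \<le> s0\<close> by (auto simp: S_def)
  moreover have "u (w + s0 *\<^sub>R (y - w)) = 0" using s0(1) ug by (simp add: S_def upper_pair_def)
  ultimately show ?thesis using upper_pair_segment[OF ug, of s0 w y] by simp
qed

end

section \<open>Averages near the boundary\<close>

context proper_open_set begin

text \<open>A weighted Poincare inequality. The function vanishes at every point \<open>w\<close> of the complement, so the average
is controlled by the Riesz potential at \<open>w\<close> of the upper gradient. Jensen's inequality with respect to the
measure with density \<open>|z - w|\<^bsup>-(n-\<eta>)\<^esup>\<close> turns its \<open>p\<close>-th power into the integral of \<open>g\<^sup>p |z - w|\<^bsup>b-\<kappa>\<^esup>\<close>,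
where \<open>|z - w|\<^sup>b \<le> \<delta>(z)\<^sup>b\<close> because \<open>\<delta>(z) \<le> |z - w|\<close> and \<open>b \<le> 0\<close>. What remains is the integral of
\<open>|z - w|\<^bsup>-\<kappa>\<^esup>\<close> against the energy, and a suitable \<open>w\<close> keeps it below a multiple of \<open>\<delta>(x)\<^bsup>-\<kappa>\<^esup>\<close> times the energy near \<open>x\<close>.\<close>

lemma average_powr_le_energy:
  assumes c: "0 < c" and cov: "\<And>x r R. x \<in> - G \<Longrightarrow> 0 < r \<Longrightarrow> r < R \<Longrightarrow>
      c * (r / R) powr (- l) \<le> real (covering_number (- G \<inter> ball x R) r)"
    and p: "1 < p" and b: "b \<le> 0" and l: "real DIM('a) - p + b < l"
  shows "\<exists>C>0. \<forall>u g. upper_pair u g \<longrightarrow> (\<forall>x\<in>G.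
    ennreal_powr (\<integral>\<^sup>+v. ennreal \<bar>u v\<bar> * indicator (ball x (\<delta> x / 2)) v \<partial>lborel) p
      \<le> ennreal (C * \<delta> x powr (real DIM('a) * p + p - real DIM('a) - b))
        * (\<integral>\<^sup>+z. energy_density g p b z * indicator (ball x (6 * \<delta> x)) z \<partial>lborel))"
proof -
  define n where "n = real DIM('a)"
  have n: "0 < n" by (simp add: n_def)
  \<comment> \<open>the room between \<open>n - p + b\<close> and the dimension is shared between \<open>\<kappa> < l\<close> and the integrability of \<open>|z - w|\<^bsup>-(n-\<eta>)\<^esup>\<close>\<close>
  define \<epsilon> where "\<epsilon> = (l - (n - p + b)) / 2"
  define \<kappa> where "\<kappa> = n - p + b + \<epsilon>"
  have \<epsilon>: "0 < \<epsilon>" and \<kappa>: "\<kappa> < l" using l by (auto simp: \<epsilon>_def \<kappa>_def n_def field_simps)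
  define \<eta> where "\<eta> = \<epsilon> / (p - 1)"
  have \<eta>: "0 < \<eta>" "\<eta> * (p - 1) = \<epsilon>" using \<epsilon> p by (auto simp: \<eta>_def)
  have "closed (- G)" using open_G by (simp add: closed_def)
  from point_with_small_riesz_integral[OF this c cov \<kappa>]
  obtain C1 where C1: "0 < C1" and good: "\<And>w R \<nu>. w \<in> - G \<Longrightarrow> 0 < R \<Longrightarrow> sets \<nu> = sets borel \<Longrightarrow> (\<exists>w'\<in>- G. dist w w' \<le> R \<and>
      (\<integral>\<^sup>+z. ennreal (dist z w' powr (- \<kappa>)) * indicator (ball w' (4 * R)) z \<partial>\<nu>)
        \<le> ennreal (C1 * R powr (- \<kappa>)) * emeasure \<nu> (ball w (5 * R)))" by blast
  have "n - \<eta> < real DIM('a)" "real DIM('a) - (n - \<eta>) = \<eta>" using \<eta> by (simp_all add: n_def)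
  from nn_integral_ball_powr_le[OF this(1), unfolded this(2)]
  obtain C2 where C2: "0 < C2" and kernel': "\<forall>w::'a. \<forall>\<rho>>0. (\<integral>\<^sup>+z. ennreal (dist z w powr (- (n - \<eta>))) * indicator (ball w \<rho>) z \<partial>lborel)
    \<le> ennreal (C2 * \<rho> powr \<eta>)" by (elim exE conjE)
  note kernel = kernel'[rule_format]
  define C where "C = (3 powr n / n) powr p * (2 powr p * (C2 powr (p - 1) * 3 powr \<epsilon>) * C1)"
  have C: "0 < C" using n C1 C2 by (simp add: C_def)
  show ?thesis unfolding n_def[symmetric]
  proof (intro exI[of _ C] conjI C allI impI ballI)
    fix u g x assume ug: "upper_pair u g" and x: "x \<in> G"
    note [measurable] = density_measurable[OF ug] energy_density_measurable[OF ug] upper_pair_measurable[OF ug]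
    define d where "d = \<delta> x"
    have d: "0 < d" using \<delta>_pos[OF x] by (simp add: d_def)
    obtain w0 where w0: "w0 \<notin> G" "dist x w0 = d" using nearest_point[of x] by (auto simp: d_def)
    define h where "h = energy_density g p b"
    define \<nu> where "\<nu> = density lborel h"
    have h[measurable]: "h \<in> borel_measurable borel" by (simp add: h_def)
    have "w0 \<in> - G" "sets \<nu> = sets borel" using w0 by (auto simp: \<nu>_def)
    from good[OF this(1) d this(2)] obtain w where w: "w \<notin> G" "dist w0 w \<le> d" and
      gw: "(\<integral>\<^sup>+z. ennreal (dist z w powr (- \<kappa>)) * indicator (ball w (4 * d)) z \<partial>\<nu>)
        \<le> ennreal (C1 * d powr (- \<kappa>)) * emeasure \<nu> (ball w0 (5 * d))" by auto
    define F where "F z = ennreal (g z) * indicator G z" for z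
    have F[measurable]: "F \<in> borel_measurable borel" unfolding F_def[abs_def] by measurable
    define H where "H = (\<integral>\<^sup>+z. h z * indicator (ball x (6 * d)) z \<partial>lborel)"
    define K where "K z = ennreal (dist z w powr (- (n - \<eta>))) * indicator (ball w (3 * d)) z" for z
    define \<phi> where "\<phi> z = F z * ennreal (dist z w powr (1 - \<eta>))" for z
    have [measurable]: "K \<in> borel_measurable borel" "\<phi> \<in> borel_measurable borel"
      unfolding K_def[abs_def] \<phi>_def[abs_def] by measurable
    have xw: "dist x w \<le> 2 * d" using dist_triangle[of x w w0] w0 w by simp
    have bx: "v \<in> G \<and> v \<in> ball w (3 * d)" if "v \<in> ball x (d / 2)" for v
      using that in_G_if_dist_less[OF x, of v] dist_triangle[of w v x] xw d by (auto simp: d_def dist_commute)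
    have "(\<integral>\<^sup>+v. ennreal \<bar>u v\<bar> * indicator (ball x (d / 2)) v \<partial>lborel)
      \<le> (\<integral>\<^sup>+v. ennreal (dist v w) * (\<integral>\<^sup>+s. F (w + s *\<^sub>R (v - w)) * indicator {0<..<1} s \<partial>lborel) * indicator (ball w (3 * d)) v \<partial>lborel)"
    proof (rule nn_integral_mono)
      fix v
      show "ennreal \<bar>u v\<bar> * indicator (ball x (d / 2)) v \<le> ennreal (dist v w) *
        (\<integral>\<^sup>+s. F (w + s *\<^sub>R (v - w)) * indicator {0<..<1} s \<partial>lborel) * indicator (ball w (3 * d)) v"
        using upper_pair_segment_from_complement[OF ug w(1), of v] bx[of v]
        by (cases "v \<in> ball x (d / 2)") (auto simp: F_def)
    qed
    also have "\<dots> \<le> ennreal ((3 * d) ^ DIM('a) / n) * (\<integral>\<^sup>+z. F z * ennreal (dist z w powr (1 - n)) * indicator (ball w (3 * d)) z \<partial>lborel)"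
      unfolding n_def using d by (intro nn_integral_segments_le_riesz) auto
    also have "(\<integral>\<^sup>+z. F z * ennreal (dist z w powr (1 - n)) * indicator (ball w (3 * d)) z \<partial>lborel) = (\<integral>\<^sup>+z. K z * \<phi> z \<partial>lborel)"
    proof (rule nn_integral_cong)
      fix z
      have "dist z w powr (1 - n) = dist z w powr (- (n - \<eta>)) * dist z w powr (1 - \<eta>)" by (simp flip: powr_add)
      then have "ennreal (dist z w powr (1 - n)) = ennreal (dist z w powr (- (n - \<eta>))) * ennreal (dist z w powr (1 - \<eta>))"
        by (simp flip: ennreal_mult)
      then show "F z * ennreal (dist z w powr (1 - n)) * indicator (ball w (3 * d)) z = K z * \<phi> z"
        by (simp add: K_def \<phi>_def mult_ac)
    qed
    finally have step1: "(\<integral>\<^sup>+v. ennreal \<bar>u v\<bar> * indicator (ball x (d / 2)) v \<partial>lborel) \<le> ennreal ((3 * d) ^ DIM('a) / n) * (\<integral>\<^sup>+z. K z * \<phi> z \<partial>lborel)" .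
    have step2: "ennreal_powr (\<integral>\<^sup>+v. ennreal \<bar>u v\<bar> * indicator (ball x (d / 2)) v \<partial>lborel) p
        \<le> ennreal (((3 * d) ^ DIM('a) / n) powr p) * ennreal_powr (\<integral>\<^sup>+z. K z * \<phi> z \<partial>lborel) p"
      using ennreal_powr_scale_le[OF step1, of p] d n p by simp
    have step3: "ennreal_powr (\<integral>\<^sup>+z. K z * \<phi> z \<partial>lborel) p
        \<le> ennreal (2 powr p * (C2 * (3 * d) powr \<eta>) powr (p - 1)) * (\<integral>\<^sup>+z. K z * ennreal_powr (\<phi> z) p \<partial>lborel)"
    proof (rule le_scale_trans)
      show "ennreal_powr (\<integral>\<^sup>+z. K z * \<phi> z \<partial>lborel) p \<le> ennreal (2 powr p) *
        (ennreal_powr (\<integral>\<^sup>+z. K z \<partial>lborel) (p - 1) * (\<integral>\<^sup>+z. K z * ennreal_powr (\<phi> z) p \<partial>lborel))"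
        using p by (intro nn_integral_powr_le) auto
      have "ennreal_powr (\<integral>\<^sup>+z. K z \<partial>lborel) (p - 1) \<le> ennreal_powr (ennreal (C2 * (3 * d) powr \<eta>)) (p - 1)"
        unfolding K_def using p d by (intro ennreal_powr_mono kernel) auto
      also have "\<dots> = ennreal ((C2 * (3 * d) powr \<eta>) powr (p - 1))"
        using p C2 by (intro ennreal_powr_ennreal) auto
      finally show "ennreal_powr (\<integral>\<^sup>+z. K z \<partial>lborel) (p - 1) * (\<integral>\<^sup>+z. K z * ennreal_powr (\<phi> z) p \<partial>lborel)
        \<le> ennreal ((C2 * (3 * d) powr \<eta>) powr (p - 1)) * (\<integral>\<^sup>+z. K z * ennreal_powr (\<phi> z) p \<partial>lborel)"
        by (intro mult_right_mono) auto
    qed auto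
    have step4: "(\<integral>\<^sup>+z. K z * ennreal_powr (\<phi> z) p \<partial>lborel) \<le> ennreal (C1 * d powr (- \<kappa>)) * H"
    proof -
      have "(\<integral>\<^sup>+z. K z * ennreal_powr (\<phi> z) p \<partial>lborel) \<le> (\<integral>\<^sup>+z. h z * (ennreal (dist z w powr (- \<kappa>)) * indicator (ball w (4 * d)) z) \<partial>lborel)"
      proof (rule nn_integral_mono)
        fix z
        show "K z * ennreal_powr (\<phi> z) p \<le> h z * (ennreal (dist z w powr (- \<kappa>)) * indicator (ball w (4 * d)) z)"
        proof (cases "z \<in> G \<and> z \<in> ball w (3 * d)")
          case False
          then show ?thesis using p by (auto simp: K_def \<phi>_def F_def)
        next
          case True
          define t where "t = dist z w"
          have \<delta>t: "0 < \<delta> z" "\<delta> z \<le> t" using \<delta>_pos \<delta>_le_dist[of z w] True w by (auto simp: t_def)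
          have g: "0 \<le> g z" using ug True by (simp add: upper_pair_def)
          have "K z * ennreal_powr (\<phi> z) p = ennreal (t powr (- (n - \<eta>)) * (g z * t powr (1 - \<eta>)) powr p)"
            using True g p by (simp add: K_def \<phi>_def F_def t_def ennreal_powr_ennreal ennreal_mult[symmetric])
          also have "t powr (- (n - \<eta>)) * (g z * t powr (1 - \<eta>)) powr p = g z powr p * (t powr b * t powr (- \<kappa>))"
          proof -
            have "- (n - \<eta>) + (1 - \<eta>) * p = b + - \<kappa>" using \<eta>(2) by (simp add: \<kappa>_def algebra_simps)
            then have "t powr (- (n - \<eta>)) * t powr ((1 - \<eta>) * p) = t powr b * t powr (- \<kappa>)"
              by (simp only: powr_add[symmetric])
            moreover have "(g z * t powr (1 - \<eta>)) powr p = g z powr p * t powr ((1 - \<eta>) * p)"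
              using g by (simp add: powr_mult powr_powr)
            ultimately show ?thesis by (simp add: mult_ac)
          qed
          also have "ennreal \<dots> \<le> ennreal (g z powr p * (\<delta> z powr b * t powr (- \<kappa>)))"
            using \<delta>t b by (intro ennreal_leI mult_left_mono mult_right_mono powr_mono2') auto
          also have "\<dots> = h z * (ennreal (dist z w powr (- \<kappa>)) * indicator (ball w (4 * d)) z)"
            using True d by (simp add: h_def energy_density_def t_def ennreal_mult mult_ac)
          finally show ?thesis .
        qed
      qed
      also have "\<dots> = (\<integral>\<^sup>+z. ennreal (dist z w powr (- \<kappa>)) * indicator (ball w (4 * d)) z \<partial>\<nu>)"
        unfolding \<nu>_def by (subst nn_integral_density) (auto simp: borel_measurable_powr_ball)
      also have "\<dots> \<le> ennreal (C1 * d powr (- \<kappa>)) * emeasure \<nu> (ball w0 (5 * d))" by (rule gw)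
      also have "emeasure \<nu> (ball w0 (5 * d)) \<le> H"
      proof -
        have "ball w0 (5 * d) \<subseteq> ball x (6 * d)"
          using w0(2) by (auto intro!: le_less_trans[OF dist_triangle[where y = w0]])
        then have "emeasure \<nu> (ball w0 (5 * d)) \<le> emeasure \<nu> (ball x (6 * d))"
          by (intro emeasure_mono) (auto simp: \<nu>_def)
        also have "\<dots> = H" unfolding \<nu>_def H_def by (subst emeasure_density) auto
        finally show ?thesis .
      qed
      finally show ?thesis by (simp add: mult_left_mono)
    qed
    have "ennreal_powr (\<integral>\<^sup>+v. ennreal \<bar>u v\<bar> * indicator (ball x (d / 2)) v \<partial>lborel) p
      \<le> ennreal (((3 * d) ^ DIM('a) / n) powr p * ((2 powr p * (C2 * (3 * d) powr \<eta>) powr (p - 1)) * (C1 * d powr (- \<kappa>)))) * H"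
      using C1 d by (intro le_scale_trans[OF step2] le_scale_trans[OF step3] step4) auto
    also have "((3 * d) ^ DIM('a) / n) powr p * ((2 powr p * (C2 * (3 * d) powr \<eta>) powr (p - 1)) * (C1 * d powr (- \<kappa>)))
        = C * d powr (n * p + p - n - b)"
    proof -
      have "(3 * d) ^ DIM('a) / n = 3 powr n / n * d powr n"
        using d by (simp add: n_def powr_realpow power_mult_distrib)
      then have 1: "((3 * d) ^ DIM('a) / n) powr p = (3 powr n / n) powr p * d powr (n * p)"
        using d n by (simp add: powr_mult powr_divide powr_powr)
      have 2: "(C2 * (3 * d) powr \<eta>) powr (p - 1) = C2 powr (p - 1) * 3 powr \<epsilon> * d powr \<epsilon>"
        using d C2 \<eta>(2) by (simp add: powr_mult powr_powr)
      have "n * p + p - n - b = n * p + \<epsilon> + - \<kappa>" by (simp add: \<kappa>_def)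
      then have 3: "d powr (n * p + p - n - b) = d powr (n * p) * d powr \<epsilon> * d powr (- \<kappa>)"
        by (simp only: powr_add)
      show ?thesis unfolding 1 2 3 C_def by (simp only: mult_ac)
    qed
    finally show "ennreal_powr (\<integral>\<^sup>+v. ennreal \<bar>u v\<bar> * indicator (ball x (\<delta> x / 2)) v \<partial>lborel) p
      \<le> ennreal (C * \<delta> x powr (n * p + p - n - b)) * (\<integral>\<^sup>+z. energy_density g p b z * indicator (ball x (6 * \<delta> x)) z \<partial>lborel)"
      by (simp only: H_def h_def d_def)
  qed
qed


text \<open>With \<open>m = q/p\<close>, the weighted Poincare inequality bounds the integrand, up to a constant, by \<open>\<delta>(y)\<^bsup>-n\<^esup>\<close> times the \<open>m\<close>-th power
of \<open>\<delta>(y)\<^bsup>-\<gamma>\<^esup>\<close> times the energy of exponent \<open>b\<close> near \<open>y\<close>. One factor is kept for Tonelli; the other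
\<open>m - 1\<close> are bounded by the total energy of exponent \<open>b - \<gamma>\<close>.\<close>

lemma average_integral_le:
  assumes c: "0 < c" and cov: "\<And>x r R. x \<in> - G \<Longrightarrow> 0 < r \<Longrightarrow> r < R \<Longrightarrow>
      c * (r / R) powr (- l) \<le> real (covering_number (- G \<inter> ball x R) r)"
    and p: "1 < p" and q: "p \<le> q" and b: "b \<le> 0" and l: "real DIM('a) - p + b < l"
  shows "\<exists>C>0. \<forall>\<gamma> u g. 0 < \<gamma> \<longrightarrow> \<gamma> \<le> 1 \<longrightarrow> upper_pair u g \<longrightarrow>
    (\<integral>\<^sup>+y. ennreal_powr (\<integral>\<^sup>+v. ennreal \<bar>u v\<bar> * indicator (ball y (\<delta> y / 2)) v \<partial>lborel) q
        * ennreal (\<delta> y powr (q / p * (real DIM('a) - p + (b - \<gamma>)) - real DIM('a) - real DIM('a) * q)) * indicator G y \<partial>lborel)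
      \<le> ennreal (C / \<gamma>) * ennreal_powr (\<integral>\<^sup>+z. energy_density g p (b - \<gamma>) z \<partial>lborel) (q / p)"
proof -
  define n where "n = real DIM('a)"
  define m where "m = q / p"
  have m: "1 \<le> m" "p * m = q" "m * p = q" using p q by (auto simp: m_def)
  obtain C1 where C1: "0 < C1" and avg: "\<forall>u g. upper_pair u g \<longrightarrow> (\<forall>x\<in>G.
    ennreal_powr (\<integral>\<^sup>+v. ennreal \<bar>u v\<bar> * indicator (ball x (\<delta> x / 2)) v \<partial>lborel) p
      \<le> ennreal (C1 * \<delta> x powr (n * p + p - n - b))
        * (\<integral>\<^sup>+z. energy_density g p b z * indicator (ball x (6 * \<delta> x)) z \<partial>lborel))"
    using average_powr_le_energy[OF c cov p b l] unfolding n_def by blast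
  define K where "K = 7 * (n + 1) * 6 ^ DIM('a) * unit_ball_vol n"
  have K: "0 < K" by (auto simp: K_def n_def intro!: mult_pos_pos add_nonneg_pos)
  define C where "C = C1 powr m * 7 powr (m - 1) * K"
  have C: "0 < C" using C1 K by (simp add: C_def)
  show ?thesis unfolding n_def[symmetric] m_def[symmetric]
  proof (intro exI[of _ C] conjI C allI impI)
    fix \<gamma> :: real and u g assume \<gamma>: "0 < \<gamma>" "\<gamma> \<le> 1" and ug: "upper_pair u g"
    define h0 h1 where "h0 = energy_density g p (b - \<gamma>)" and "h1 = energy_density g p b"
    have [measurable]: "h0 \<in> borel_measurable borel" "h1 \<in> borel_measurable borel"
      unfolding h0_def h1_def by (rule energy_density_measurable[OF ug])+
    define H where "H = (\<integral>\<^sup>+z. h0 z \<partial>lborel)"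
    define Hx where "Hx y = (\<integral>\<^sup>+z. h1 z * indicator (ball y (6 * \<delta> y)) z \<partial>lborel)" for y
    define a where "a y = (\<integral>\<^sup>+v. ennreal \<bar>u v\<bar> * indicator (ball y (\<delta> y / 2)) v \<partial>lborel)" for y
    define E where "E = m * (n - p + (b - \<gamma>)) - n - n * q"
    define A where "A y z = ennreal (\<delta> y powr (- n - \<gamma>)) * h1 z * indicator {y\<in>G. dist y z < 6 * \<delta> y} y" for y z
    have A_meas[measurable]: "case_prod A \<in> borel_measurable (borel \<Otimes>\<^sub>M borel)"
      unfolding A_def[abs_def] by measurable
    have HxA: "ennreal (\<delta> y powr (- n - \<gamma>)) * Hx y = (\<integral>\<^sup>+z. A y z \<partial>lborel)" if "y \<in> G" for y
      unfolding Hx_def A_def using that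
      by (subst nn_integral_cmult[symmetric]) (auto intro!: nn_integral_cong simp: indicator_def mult_ac)
    have pt: "ennreal_powr (a y) q * ennreal (\<delta> y powr E) * indicator G y
      \<le> ennreal (C1 powr m * 7 powr (m - 1)) * ennreal_powr H (m - 1) * (\<integral>\<^sup>+z. A y z \<partial>lborel)" for y
    proof (cases "y \<in> G")
      case True
      define d where "d = \<delta> y"
      have d: "0 < d" using \<delta>_pos[OF True] by (simp add: d_def)
      have s1: "ennreal_powr (a y) q \<le> ennreal ((C1 * d powr (n * p + p - n - b)) powr m) * ennreal_powr (Hx y) m"
      proof -
        have "ennreal_powr (a y) p \<le> ennreal (C1 * d powr (n * p + p - n - b)) * Hx y"
          using avg ug True by (simp add: a_def Hx_def h1_def d_def)
        from ennreal_powr_scale_le[OF this, of m] show ?thesis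
          using C1 d m p by (simp add: ennreal_powr_powr)
      qed
      have "Hx y \<le> (\<integral>\<^sup>+z. ennreal (7 * d powr \<gamma>) * h0 z \<partial>lborel)"
        unfolding Hx_def
      proof (rule nn_integral_mono)
        fix z
        show "h1 z * indicator (ball y (6 * \<delta> y)) z \<le> ennreal (7 * d powr \<gamma>) * h0 z"
        proof (cases "z \<in> G \<and> z \<in> ball y (6 * d)")
          case z: True
          have "\<delta> z \<le> 7 * d" using \<delta>_lipschitz[of z y] z by (simp add: d_def dist_commute)
          then have "\<delta> z powr \<gamma> \<le> (7 * d) powr \<gamma>" using \<gamma> by (intro powr_mono2) auto
          also have "\<dots> = 7 powr \<gamma> * d powr \<gamma>" using d by (simp add: powr_mult)
          also have "\<dots> \<le> 7 powr 1 * d powr \<gamma>" using \<gamma> by (intro mult_right_mono powr_mono) auto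
          finally have *: "\<delta> z powr \<gamma> \<le> 7 * d powr \<gamma>" by simp
          have "\<delta> z powr b = \<delta> z powr (b - \<gamma>) * \<delta> z powr \<gamma>" by (simp flip: powr_add)
          also have "\<dots> \<le> \<delta> z powr (b - \<gamma>) * (7 * d powr \<gamma>)" using * by (intro mult_left_mono) auto
          finally have "g z powr p * \<delta> z powr b \<le> (7 * d powr \<gamma>) * (g z powr p * \<delta> z powr (b - \<gamma>))"
            using mult_left_mono[of _ _ "g z powr p"] by (fastforce simp: mult_ac)
          then show ?thesis using z d
            by (auto simp: h0_def h1_def energy_density_def d_def ennreal_mult[symmetric] intro!: ennreal_leI)
        qed (auto simp: h1_def energy_density_def d_def)
      qed
      also have "\<dots> = ennreal (7 * d powr \<gamma>) * H" unfolding H_def by (intro nn_integral_cmult) measurable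
      finally have s2: "ennreal_powr (Hx y) (m - 1) \<le> ennreal ((7 * d powr \<gamma>) powr (m - 1)) * ennreal_powr H (m - 1)"
        using m d by (intro ennreal_powr_scale_le) auto
      have s3: "ennreal_powr (Hx y) m \<le> ennreal ((7 * d powr \<gamma>) powr (m - 1)) * (ennreal_powr H (m - 1) * Hx y)"
        unfolding ennreal_powr_split[OF m(1), of "Hx y"] mult.assoc[symmetric] by (intro mult_right_mono s2) auto
      have "ennreal_powr (a y) q \<le> ennreal ((C1 * d powr (n * p + p - n - b)) powr m * (7 * d powr \<gamma>) powr (m - 1)) * (ennreal_powr H (m - 1) * Hx y)"
        by (intro le_scale_trans[OF s1 s3]) auto
      then have "ennreal_powr (a y) q * ennreal (d powr E)
        \<le> ennreal ((C1 * d powr (n * p + p - n - b)) powr m * (7 * d powr \<gamma>) powr (m - 1)) * (ennreal_powr H (m - 1) * Hx y) * ennreal (d powr E)"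
        by (intro mult_right_mono) auto
      also have "\<dots> = ennreal ((C1 * d powr (n * p + p - n - b)) powr m * (7 * d powr \<gamma>) powr (m - 1) * d powr E) * (ennreal_powr H (m - 1) * Hx y)"
        by (simp add: ennreal_mult mult_ac)
      also have "(C1 * d powr (n * p + p - n - b)) powr m * (7 * d powr \<gamma>) powr (m - 1) * d powr E = C1 powr m * 7 powr (m - 1) * d powr (- n - \<gamma>)"
      proof -
        have "(n * p + p - n - b) * m + \<gamma> * (m - 1) + E = n * (p * m - q) - n - \<gamma>" by (simp add: E_def algebra_simps)
        then have "(n * p + p - n - b) * m + \<gamma> * (m - 1) + E = - n - \<gamma>" using m by simp
        then have *: "d powr ((n * p + p - n - b) * m) * d powr (\<gamma> * (m - 1)) * d powr E = d powr (- n - \<gamma>)"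
          by (simp only: powr_add[symmetric])
        show ?thesis unfolding *[symmetric] using C1 d by (simp add: powr_mult powr_powr mult_ac)
      qed
      also have "ennreal (C1 powr m * 7 powr (m - 1) * d powr (- n - \<gamma>)) * (ennreal_powr H (m - 1) * Hx y)
        = ennreal (C1 powr m * 7 powr (m - 1)) * ennreal_powr H (m - 1) * (\<integral>\<^sup>+z. A y z \<partial>lborel)"
        unfolding HxA[OF True, symmetric] d_def by (simp add: ennreal_mult mult_ac)
      finally show ?thesis using True by (simp add: d_def)
    qed simp
    have "(\<integral>\<^sup>+y. ennreal_powr (a y) q * ennreal (\<delta> y powr E) * indicator G y \<partial>lborel)
      \<le> (\<integral>\<^sup>+y. ennreal (C1 powr m * 7 powr (m - 1)) * ennreal_powr H (m - 1) * (\<integral>\<^sup>+z. A y z \<partial>lborel) \<partial>lborel)"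
      by (intro nn_integral_mono pt)
    also have "\<dots> = ennreal (C1 powr m * 7 powr (m - 1)) * ennreal_powr H (m - 1) * (\<integral>\<^sup>+y. \<integral>\<^sup>+z. A y z \<partial>lborel \<partial>lborel)"
      by (intro nn_integral_cmult) measurable
    also have "(\<integral>\<^sup>+y. \<integral>\<^sup>+z. A y z \<partial>lborel \<partial>lborel) = (\<integral>\<^sup>+z. \<integral>\<^sup>+y. A y z \<partial>lborel \<partial>lborel)"
      by (intro lborel_pair.Fubini'[symmetric]) measurable
    also have "\<dots> \<le> (\<integral>\<^sup>+z. ennreal (K / \<gamma>) * h0 z \<partial>lborel)"
    proof (rule nn_integral_mono)
      fix z
      show "(\<integral>\<^sup>+y. A y z \<partial>lborel) \<le> ennreal (K / \<gamma>) * h0 z"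
      proof (cases "z \<in> G")
        case True
        have dz: "0 < \<delta> z" using \<delta>_pos True .
        have "(\<integral>\<^sup>+y. A y z \<partial>lborel) = h1 z * (\<integral>\<^sup>+y. ennreal (\<delta> y powr (- n - \<gamma>)) * indicator {y\<in>G. dist y z < 6 * \<delta> y} y \<partial>lborel)"
          unfolding A_def by (subst nn_integral_cmult[symmetric]) (auto simp: mult_ac)
        also have "\<dots> \<le> h1 z * ennreal (K / \<gamma> * \<delta> z powr (- \<gamma>))"
        proof (rule mult_left_mono)
          show "(\<integral>\<^sup>+y. ennreal (\<delta> y powr (- n - \<gamma>)) * indicator {y\<in>G. dist y z < 6 * \<delta> y} y \<partial>lborel) \<le> ennreal (K / \<gamma> * \<delta> z powr (- \<gamma>))"
            unfolding n_def K_def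
          proof (rule nn_integral_nontangential_le)
            fix y assume "y \<in> G" "dist y z < 6 * \<delta> y"
            then show "\<delta> z \<le> 7 * \<delta> y" using \<delta>_lipschitz[of z y] by (simp add: dist_commute)
          qed (use \<delta>_pos dz \<gamma> in auto)
        qed simp
        also have "\<dots> = ennreal (K / \<gamma>) * h0 z"
          using True K \<gamma> by (simp add: h0_def h1_def energy_density_def powr_diff powr_minus field_simps flip: ennreal_mult)
        finally show ?thesis .
      qed (simp add: A_def h1_def energy_density_def)
    qed
    also have "\<dots> = ennreal (K / \<gamma>) * H" unfolding H_def by (intro nn_integral_cmult) measurable
    finally have "(\<integral>\<^sup>+y. ennreal_powr (a y) q * ennreal (\<delta> y powr E) * indicator G y \<partial>lborel)
      \<le> ennreal (C1 powr m * 7 powr (m - 1)) * ennreal_powr H (m - 1) * (ennreal (K / \<gamma>) * H)" by (simp add: mult_left_mono)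
    also have "\<dots> = ennreal (C / \<gamma>) * ennreal_powr H m"
      unfolding ennreal_powr_split[OF m(1), of H] C_def using K \<gamma> C1
      by (simp add: ennreal_mult[symmetric] mult_ac)
    finally show "(\<integral>\<^sup>+y. ennreal_powr (\<integral>\<^sup>+v. ennreal \<bar>u v\<bar> * indicator (ball y (\<delta> y / 2)) v \<partial>lborel) q
        * ennreal (\<delta> y powr (m * (n - p + (b - \<gamma>)) - n - n * q)) * indicator G y \<partial>lborel)
      \<le> ennreal (C / \<gamma>) * ennreal_powr (\<integral>\<^sup>+z. energy_density g p (b - \<gamma>) z \<partial>lborel) m"
      unfolding a_def E_def H_def h0_def .
  qed
qed

end

section \<open>Local Riesz potentials\<close>

context proper_open_set begin

text \<open>A local form of Young's convolution inequality: for \<open>1/r = 1 - 1/p + 1/q\<close> the kernel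
\<open>|z - y|\<^bsup>1-n\<^esup>\<close> is locally in \<open>L\<^sup>r\<close> exactly because \<open>q\<close> is below the Sobolev exponent. Jensen's
inequality is applied twice, first with the density \<open>|z - y|\<^bsup>-(n-1)r\<^esup>\<close> and then with the energy density.\<close>

lemma riesz_integral_le:
  assumes p: "1 < p" and q: "p \<le> q" and sub: "q * (real DIM('a) - p) < real DIM('a) * p" and b: "b \<le> 0"
  shows "\<exists>C>0. \<forall>\<gamma> u g. 0 < \<gamma> \<longrightarrow> \<gamma> \<le> 1 \<longrightarrow> upper_pair u g \<longrightarrow>
    (\<integral>\<^sup>+y. ennreal_powr (\<integral>\<^sup>+z. (ennreal (g z) * indicator G z) * ennreal (dist z y powr (1 - real DIM('a))) * indicator (ball y (\<delta> y / 2)) z \<partial>lborel) q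
        * ennreal (\<delta> y powr (q / p * (real DIM('a) - p + (b - \<gamma>)) - real DIM('a))) * indicator G y \<partial>lborel)
      \<le> ennreal C * ennreal_powr (\<integral>\<^sup>+z. energy_density g p (b - \<gamma>) z \<partial>lborel) (q / p)"
proof -
  define n where "n = real DIM('a)"
  have n: "1 \<le> n" using DIM_positive[where 'a='a] by (simp add: n_def Suc_leI)
  define m where "m = q / p"
  have m: "1 \<le> m" "p * m = q" "m * p = q" using p q by (auto simp: m_def)
  define r where "r = 1 / (1 - 1 / p + 1 / q)"
  have den: "0 < 1 - 1 / p + 1 / q" using p q by (simp add: add_pos_nonneg)
  have r: "0 < r" "r * (1 - 1 / p + 1 / q) = 1" using den by (auto simp: r_def)
  define s where "s = (n - 1) * r"
  have "q * n - q * p < n * p" using sub by (simp add: n_def algebra_simps)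
  then have "n / p - n / q < 1" using p q by (simp add: field_simps)
  then have "n - 1 < n * (1 - 1 / p + 1 / q)" by (simp add: algebra_simps)
  then have sn: "s < n" using den by (simp add: s_def r_def field_simps)
  define \<theta> where "\<theta> = n - s"
  have \<theta>: "0 < \<theta>" using sn by (simp add: \<theta>_def)
  have rm: "r * (m * (p - 1) + 1) = q"
  proof -
    have "m * (p - 1) + 1 = q * (1 - 1 / p + 1 / q)" using p q by (simp add: m_def field_simps)
    then show ?thesis using r(2) by (metis mult.left_commute mult.right_neutral)
  qed
  \<comment> \<open>the definition of \<open>r\<close> makes the second application of Jensen's inequality return the kernel \<open>|z - y|\<^bsup>-s\<^esup>\<close>; \<open>exp2\<close> expresses that both sides scale alike\<close>
  have exp1: "(- s + (s + 1 - n) * p) * m = - s"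
  proof -
    have "(- s + (s + 1 - n) * p) * m = (n - 1) * (r * (m * (p - 1) + 1) - p * m) - s" by (simp add: s_def algebra_simps)
    then show ?thesis using rm m by simp
  qed
  have exp2: "\<theta> * (p - 1) * m + m * (n - p) - n = - \<theta>"
  proof -
    have "\<theta> * (p - 1) * m + m * (n - p) - n + \<theta> = n * (p * m) - (n - 1) * (r * (m * (p - 1) + 1)) - p * m"
      by (simp add: \<theta>_def s_def algebra_simps)
    also have "\<dots> = 0" unfolding rm m(2) by (simp add: algebra_simps)
    finally show ?thesis by simp
  qed
  have "s < real DIM('a)" using sn by (simp add: n_def)
  from nn_integral_ball_powr_le[OF this]
  obtain C3 where C3: "0 < C3" and kernel': "\<forall>w::'a. \<forall>\<rho>>0. (\<integral>\<^sup>+z. ennreal (dist z w powr (- s)) * indicator (ball w \<rho>) z \<partial>lborel)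
    \<le> ennreal (C3 * \<rho> powr (real DIM('a) - s))" by (elim exE conjE)
  note kernel = kernel'[rule_format, folded n_def, folded \<theta>_def]
  define c where "c = (2 powr p * (C3 * (1/2) powr \<theta>) powr (p - 1) * 2 powr (1 - b)) powr m * 2 powr m"
  have c: "0 < c" using C3 by (simp add: c_def)
  define C where "C = c * (2 powr \<theta> * C3)"
  have C: "0 < C" using c C3 by (simp add: C_def)
  show ?thesis unfolding n_def[symmetric] m_def[symmetric]
  proof (intro exI[of _ C] conjI C allI impI)
    fix \<gamma> :: real and u g assume \<gamma>: "0 < \<gamma>" "\<gamma> \<le> 1" and ug: "upper_pair u g"
    define b0 where "b0 = b - \<gamma>"
    have b0: "b0 \<le> 0" using b \<gamma> by (simp add: b0_def)
    define h where "h = energy_density g p b0"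
    define F where "F z = ennreal (g z) * indicator G z" for z
    have [measurable]: "h \<in> borel_measurable borel" "F \<in> borel_measurable borel"
      unfolding h_def F_def[abs_def] by (rule energy_density_measurable[OF ug] density_measurable[OF ug])+
    define H where "H = (\<integral>\<^sup>+z. h z \<partial>lborel)"
    define I where "I y = (\<integral>\<^sup>+z. F z * ennreal (dist z y powr (1 - n)) * indicator (ball y (\<delta> y / 2)) z \<partial>lborel)" for y
    define E where "E = m * (n - p + b0) - n"
    define A where "A y z = ennreal (\<delta> y powr (- \<theta>)) * (h z * ennreal (dist z y powr (- s))) * indicator {y\<in>G. dist y z < \<delta> y / 2} y" for y z
    have A_meas[measurable]: "case_prod A \<in> borel_measurable (borel \<Otimes>\<^sub>M borel)"
      unfolding A_def[abs_def] by measurable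
    have pt: "ennreal_powr (I y) q * ennreal (\<delta> y powr E) * indicator G y
      \<le> ennreal c * ennreal_powr H (m - 1) * (\<integral>\<^sup>+z. A y z \<partial>lborel)" for y
    proof (cases "y \<in> G")
      case True
      define d where "d = \<delta> y"
      have d: "0 < d" using \<delta>_pos[OF True] by (simp add: d_def)
      define K where "K z = ennreal (dist z y powr (- s)) * indicator (ball y (d / 2)) z" for z
      define \<phi> where "\<phi> z = F z * ennreal (dist z y powr (s + 1 - n))" for z
      define \<psi> where "\<psi> z = ennreal (dist z y powr (- s / m)) * indicator (ball y (d / 2)) z" for z
      have [measurable]: "K \<in> borel_measurable borel" "\<phi> \<in> borel_measurable borel" "\<psi> \<in> borel_measurable borel"
        unfolding K_def[abs_def] \<phi>_def[abs_def] \<psi>_def[abs_def] by measurable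
      have IK: "I y = (\<integral>\<^sup>+z. K z * \<phi> z \<partial>lborel)"
        unfolding I_def
      proof (rule nn_integral_cong)
        fix z
        have "dist z y powr (1 - n) = dist z y powr (- s) * dist z y powr (s + 1 - n)" by (simp flip: powr_add)
        then have "ennreal (dist z y powr (1 - n)) = ennreal (dist z y powr (- s)) * ennreal (dist z y powr (s + 1 - n))"
          by (simp flip: ennreal_mult)
        then show "F z * ennreal (dist z y powr (1 - n)) * indicator (ball y (\<delta> y / 2)) z = K z * \<phi> z"
          by (simp add: K_def \<phi>_def d_def mult_ac)
      qed
      have s1: "ennreal_powr (I y) p
          \<le> ennreal (2 powr p * (C3 * (d / 2) powr \<theta>) powr (p - 1)) * (\<integral>\<^sup>+z. K z * ennreal_powr (\<phi> z) p \<partial>lborel)"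
      proof (rule le_scale_trans)
        show "ennreal_powr (I y) p \<le> ennreal (2 powr p) *
          (ennreal_powr (\<integral>\<^sup>+z. K z \<partial>lborel) (p - 1) * (\<integral>\<^sup>+z. K z * ennreal_powr (\<phi> z) p \<partial>lborel))"
          unfolding IK using p by (intro nn_integral_powr_le) auto
        have "ennreal_powr (\<integral>\<^sup>+z. K z \<partial>lborel) (p - 1) \<le> ennreal_powr (ennreal (C3 * (d / 2) powr \<theta>)) (p - 1)"
          unfolding K_def using p d by (intro ennreal_powr_mono kernel) auto
        also have "\<dots> = ennreal ((C3 * (d / 2) powr \<theta>) powr (p - 1))"
          using p C3 by (intro ennreal_powr_ennreal) auto
        finally show "ennreal_powr (\<integral>\<^sup>+z. K z \<partial>lborel) (p - 1) * (\<integral>\<^sup>+z. K z * ennreal_powr (\<phi> z) p \<partial>lborel)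
          \<le> ennreal ((C3 * (d / 2) powr \<theta>) powr (p - 1)) * (\<integral>\<^sup>+z. K z * ennreal_powr (\<phi> z) p \<partial>lborel)"
          by (intro mult_right_mono) auto
      qed auto
      have s2: "(\<integral>\<^sup>+z. K z * ennreal_powr (\<phi> z) p \<partial>lborel) \<le> ennreal (2 powr (1 - b) * d powr (- b0)) * (\<integral>\<^sup>+z. h z * \<psi> z \<partial>lborel)"
      proof -
        have "(\<integral>\<^sup>+z. K z * ennreal_powr (\<phi> z) p \<partial>lborel) \<le> (\<integral>\<^sup>+z. ennreal (2 powr (1 - b) * d powr (- b0)) * (h z * \<psi> z) \<partial>lborel)"
        proof (rule nn_integral_mono)
          fix z
          show "K z * ennreal_powr (\<phi> z) p \<le> ennreal (2 powr (1 - b) * d powr (- b0)) * (h z * \<psi> z)"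
          proof (cases "z \<in> G \<and> z \<in> ball y (d / 2)")
            case False
            then show ?thesis using p by (auto simp: K_def \<phi>_def F_def)
          next
            case z: True
            define t where "t = dist z y"
            have g: "0 \<le> g z" using ug z by (simp add: upper_pair_def)
            have \<delta>z: "0 < \<delta> z" using z \<delta>_pos by auto
            have "\<delta> z \<le> 2 * d" using \<delta>_lipschitz[of z y] z d by (simp add: d_def dist_commute)
            then have "(2 * d) powr b0 \<le> \<delta> z powr b0" using \<delta>z b0 by (intro powr_mono2') auto
            then have "(2 * d) powr (- b0) * (2 * d) powr b0 \<le> (2 * d) powr (- b0) * \<delta> z powr b0" by (intro mult_left_mono) auto
            then have "1 \<le> (2 * d) powr (- b0) * \<delta> z powr b0" using d by (simp flip: powr_add)
            also have "\<dots> = 2 powr (- b0) * d powr (- b0) * \<delta> z powr b0" using d by (simp add: powr_mult)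
            also have "\<dots> \<le> 2 powr (1 - b) * d powr (- b0) * \<delta> z powr b0"
              using \<gamma> by (intro mult_right_mono powr_mono) (auto simp: b0_def)
            finally have one: "1 \<le> 2 powr (1 - b) * d powr (- b0) * \<delta> z powr b0" .
            have "K z * ennreal_powr (\<phi> z) p = ennreal (t powr (- s) * (g z * t powr (s + 1 - n)) powr p)"
              using z g p by (simp add: K_def \<phi>_def F_def t_def ennreal_powr_ennreal ennreal_mult[symmetric])
            also have "t powr (- s) * (g z * t powr (s + 1 - n)) powr p = 1 * (g z powr p * t powr (- s / m))"
            proof -
              have "- s + (s + 1 - n) * p = - s / m" using exp1 m(1) by (simp add: field_simps)
              then have "t powr (- s) * t powr ((s + 1 - n) * p) = t powr (- s / m)"
                by (simp only: powr_add[symmetric])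
              moreover have "(g z * t powr (s + 1 - n)) powr p = g z powr p * t powr ((s + 1 - n) * p)"
                using g by (simp add: powr_mult powr_powr)
              ultimately show ?thesis by (simp add: mult_ac)
            qed
            also have "ennreal \<dots> \<le> ennreal ((2 powr (1 - b) * d powr (- b0) * \<delta> z powr b0) * (g z powr p * t powr (- s / m)))"
              using one by (intro ennreal_leI mult_right_mono) auto
            also have "\<dots> = ennreal (2 powr (1 - b) * d powr (- b0)) * (h z * \<psi> z)"
              using z by (simp add: h_def energy_density_def \<psi>_def t_def mult_ac flip: ennreal_mult)
            finally show ?thesis .
          qed
        qed
        also have "\<dots> = ennreal (2 powr (1 - b) * d powr (- b0)) * (\<integral>\<^sup>+z. h z * \<psi> z \<partial>lborel)"
          by (intro nn_integral_cmult) measurable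
        finally show ?thesis .
      qed
      let ?a = "2 powr p * (C3 * (d / 2) powr \<theta>) powr (p - 1) * (2 powr (1 - b) * d powr (- b0))"
      have a: "0 < ?a" using C3 d by simp
      have "ennreal_powr (I y) p \<le> ennreal ?a * (\<integral>\<^sup>+z. h z * \<psi> z \<partial>lborel)"
        by (intro le_scale_trans[OF s1 s2]) auto
      from ennreal_powr_scale_le[OF this a, of m]
      have s3: "ennreal_powr (I y) q \<le> ennreal (?a powr m) * ennreal_powr (\<integral>\<^sup>+z. h z * \<psi> z \<partial>lborel) m"
        using m p by (simp add: ennreal_powr_powr)
      have s4: "ennreal_powr (\<integral>\<^sup>+z. h z * \<psi> z \<partial>lborel) m \<le> ennreal (2 powr m) * (ennreal_powr H (m - 1) * (\<integral>\<^sup>+z. h z * ennreal_powr (\<psi> z) m \<partial>lborel))"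
        unfolding H_def using m by (intro nn_integral_powr_le) auto
      have \<psi>K: "ennreal_powr (\<psi> z) m = K z" for z
        using m by (auto simp: \<psi>_def K_def indicator_def ennreal_powr_ennreal powr_powr)
      have hKA: "ennreal (d powr (- \<theta>)) * (\<integral>\<^sup>+z. h z * K z \<partial>lborel) = (\<integral>\<^sup>+z. A y z \<partial>lborel)"
        unfolding A_def K_def d_def using True
        by (subst nn_integral_cmult[symmetric]) (auto intro!: nn_integral_cong simp: indicator_def mult_ac)
      have "ennreal_powr (I y) q \<le> ennreal (?a powr m * 2 powr m) * (ennreal_powr H (m - 1) * (\<integral>\<^sup>+z. h z * K z \<partial>lborel))"
        by (intro le_scale_trans[OF s3 s4[unfolded \<psi>K]]) auto
      then have "ennreal_powr (I y) q * ennreal (d powr E) \<le> ennreal (?a powr m * 2 powr m) * (ennreal_powr H (m - 1) * (\<integral>\<^sup>+z. h z * K z \<partial>lborel)) * ennreal (d powr E)"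
        by (intro mult_right_mono) auto
      also have "\<dots> = ennreal (?a powr m * 2 powr m * d powr E) * (ennreal_powr H (m - 1) * (\<integral>\<^sup>+z. h z * K z \<partial>lborel))"
        by (simp add: ennreal_mult mult_ac)
      also have "?a powr m * 2 powr m * d powr E = c * d powr (- \<theta>)"
      proof -
        have "\<theta> * (p - 1) * m + - b0 * m + E = - \<theta>" using exp2 by (simp add: E_def algebra_simps)
        then have *: "d powr (\<theta> * (p - 1) * m) * d powr (- b0 * m) * d powr E = d powr (- \<theta>)"
          by (simp only: powr_add[symmetric])
        have "?a = 2 powr p * (C3 * (1/2) powr \<theta>) powr (p - 1) * 2 powr (1 - b) * (d powr (\<theta> * (p - 1)) * d powr (- b0))"
        proof -
          have "(d / 2) powr \<theta> = (1/2) powr \<theta> * d powr \<theta>" using d by (simp add: powr_divide)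
          then have "(C3 * (d / 2) powr \<theta>) powr (p - 1) = (C3 * (1/2) powr \<theta>) powr (p - 1) * d powr (\<theta> * (p - 1))"
            using C3 d by (simp add: powr_mult powr_powr)
          then show ?thesis by (simp only: mult_ac)
        qed
        then have "?a powr m = (2 powr p * (C3 * (1/2) powr \<theta>) powr (p - 1) * 2 powr (1 - b)) powr m * (d powr (\<theta> * (p - 1) * m) * d powr (- b0 * m))"
          using C3 d by (simp add: powr_mult powr_powr)
        then show ?thesis unfolding *[symmetric] c_def by (simp only: mult_ac)
      qed
      also have "ennreal (c * d powr (- \<theta>)) * (ennreal_powr H (m - 1) * (\<integral>\<^sup>+z. h z * K z \<partial>lborel))
        = ennreal c * ennreal_powr H (m - 1) * (\<integral>\<^sup>+z. A y z \<partial>lborel)"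
        unfolding hKA[symmetric] using c by (simp add: ennreal_mult mult_ac)
      finally show ?thesis using True by (simp add: d_def)
    qed simp
    have "(\<integral>\<^sup>+y. ennreal_powr (I y) q * ennreal (\<delta> y powr E) * indicator G y \<partial>lborel)
      \<le> (\<integral>\<^sup>+y. ennreal c * ennreal_powr H (m - 1) * (\<integral>\<^sup>+z. A y z \<partial>lborel) \<partial>lborel)"
      by (intro nn_integral_mono pt)
    also have "\<dots> = ennreal c * ennreal_powr H (m - 1) * (\<integral>\<^sup>+y. \<integral>\<^sup>+z. A y z \<partial>lborel \<partial>lborel)"
      by (intro nn_integral_cmult) measurable
    also have "(\<integral>\<^sup>+y. \<integral>\<^sup>+z. A y z \<partial>lborel \<partial>lborel) = (\<integral>\<^sup>+z. \<integral>\<^sup>+y. A y z \<partial>lborel \<partial>lborel)"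
      by (intro lborel_pair.Fubini'[symmetric]) measurable
    also have "\<dots> \<le> (\<integral>\<^sup>+z. ennreal (2 powr \<theta> * C3) * h z \<partial>lborel)"
    proof (rule nn_integral_mono)
      fix z
      show "(\<integral>\<^sup>+y. A y z \<partial>lborel) \<le> ennreal (2 powr \<theta> * C3) * h z"
      proof (cases "z \<in> G")
        case True
        define d where "d = \<delta> z"
        have d: "0 < d" using \<delta>_pos True by (simp add: d_def)
        have "(\<integral>\<^sup>+y. A y z \<partial>lborel) \<le> (\<integral>\<^sup>+y. (h z * ennreal ((d / 2) powr (- \<theta>))) * (ennreal (dist y z powr (- s)) * indicator (ball z d) y) \<partial>lborel)"
        proof (rule nn_integral_mono)
          fix y
          show "A y z \<le> (h z * ennreal ((d / 2) powr (- \<theta>))) * (ennreal (dist y z powr (- s)) * indicator (ball z d) y)"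
          proof (cases "y \<in> G \<and> dist y z < \<delta> y / 2")
            case y: True
            have "\<delta> y \<le> d + dist y z" "d \<le> \<delta> y + dist y z"
              using \<delta>_lipschitz[of y z] \<delta>_lipschitz[of z y] by (simp_all add: d_def dist_commute)
            then have *: "dist y z < d" "d / 2 \<le> \<delta> y" using y by simp_all
            then have "\<delta> y powr (- \<theta>) \<le> (d / 2) powr (- \<theta>)" using d \<theta> by (intro powr_mono2') auto
            then have "ennreal (\<delta> y powr (- \<theta>)) * (h z * ennreal (dist z y powr (- s))) \<le> ennreal ((d / 2) powr (- \<theta>)) * (h z * ennreal (dist z y powr (- s)))"
              by (intro mult_right_mono ennreal_leI) auto
            then show ?thesis using y * by (simp add: A_def dist_commute mult_ac)
          qed (auto simp: A_def)
        qed
        also have "\<dots> = (h z * ennreal ((d / 2) powr (- \<theta>))) * (\<integral>\<^sup>+y. ennreal (dist y z powr (- s)) * indicator (ball z d) y \<partial>lborel)"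
          by (intro nn_integral_cmult) measurable
        also have "\<dots> \<le> (h z * ennreal ((d / 2) powr (- \<theta>))) * ennreal (C3 * d powr \<theta>)"
          using d by (intro mult_left_mono kernel) auto
        also have "\<dots> = ennreal (((d / 2) powr (- \<theta>)) * (C3 * d powr \<theta>)) * h z"
          using C3 by (simp add: ennreal_mult mult_ac)
        also have "((d / 2) powr (- \<theta>)) * (C3 * d powr \<theta>) = 2 powr \<theta> * C3"
          using d by (simp add: powr_divide powr_minus field_simps)
        finally show ?thesis .
      qed (simp add: A_def h_def energy_density_def)
    qed
    also have "\<dots> = ennreal (2 powr \<theta> * C3) * H" unfolding H_def by (intro nn_integral_cmult) measurable
    finally have "(\<integral>\<^sup>+y. ennreal_powr (I y) q * ennreal (\<delta> y powr E) * indicator G y \<partial>lborel)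
      \<le> ennreal c * ennreal_powr H (m - 1) * (ennreal (2 powr \<theta> * C3) * H)" by (simp add: mult_left_mono)
    also have "\<dots> = ennreal C * ennreal_powr H m"
      unfolding ennreal_powr_split[OF m(1), of H] C_def using c C3
      by (simp add: ennreal_mult mult_ac)
    finally show "(\<integral>\<^sup>+y. ennreal_powr (\<integral>\<^sup>+z. (ennreal (g z) * indicator G z) * ennreal (dist z y powr (1 - n)) * indicator (ball y (\<delta> y / 2)) z \<partial>lborel) q
        * ennreal (\<delta> y powr (m * (n - p + (b - \<gamma>)) - n)) * indicator G y \<partial>lborel)
      \<le> ennreal C * ennreal_powr (\<integral>\<^sup>+z. energy_density g p (b - \<gamma>) z \<partial>lborel) m"
      unfolding I_def E_def H_def h_def b0_def F_def .
  qed
qed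

end

section \<open>The inequality with a gap in the weight exponent\<close>

context proper_open_set begin

lemma pointwise_le_average_plus_riesz:
  assumes ug: "upper_pair u g" and y: "y \<in> G"
  shows "ennreal (unit_ball_vol (real DIM('a)) * (\<delta> y / 2) ^ DIM('a)) * ennreal \<bar>u y\<bar>
    \<le> (\<integral>\<^sup>+v. ennreal \<bar>u v\<bar> * indicator (ball y (\<delta> y / 2)) v \<partial>lborel)
      + ennreal ((\<delta> y / 2) ^ DIM('a) / real DIM('a)) *
        (\<integral>\<^sup>+z. (ennreal (g z) * indicator G z) * ennreal (dist z y powr (1 - real DIM('a))) * indicator (ball y (\<delta> y / 2)) z \<partial>lborel)"
proof -
  note [measurable] = density_measurable[OF ug] upper_pair_measurable[OF ug]
  define \<rho> where "\<rho> = \<delta> y / 2"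
  have \<rho>: "0 < \<rho>" "\<rho> < \<delta> y" using \<delta>_pos[OF y] by (auto simp: \<rho>_def)
  define F where "F z = ennreal (g z) * indicator G z" for z
  have [measurable]: "F \<in> borel_measurable borel" unfolding F_def[abs_def] by measurable
  let ?S = "\<lambda>v. ennreal (dist v y) * (\<integral>\<^sup>+s. F (y + s *\<^sub>R (v - y)) * indicator {0<..<1} s \<partial>lborel) * indicator (ball y \<rho>) v"
  have "ennreal (unit_ball_vol (real DIM('a)) * \<rho> ^ DIM('a)) * ennreal \<bar>u y\<bar> = (\<integral>\<^sup>+v. ennreal \<bar>u y\<bar> * indicator (ball y \<rho>) v \<partial>lborel)"
    using \<rho> by (subst nn_integral_cmult_indicator) (auto simp: emeasure_ball mult.commute)
  also have "\<dots> \<le> (\<integral>\<^sup>+v. ennreal \<bar>u v\<bar> * indicator (ball y \<rho>) v + ?S v \<partial>lborel)"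
  proof (rule nn_integral_mono)
    fix v
    show "ennreal \<bar>u y\<bar> * indicator (ball y \<rho>) v \<le> ennreal \<bar>u v\<bar> * indicator (ball y \<rho>) v + ?S v"
    proof (cases "v \<in> ball y \<rho>")
      case True
      have "y + s *\<^sub>R (v - y) \<in> G" if "0 < s" "s \<le> 1" for s
      proof (rule in_G_if_dist_less[OF y])
        have "dist y (y + s *\<^sub>R (v - y)) = s * dist y v" using that by (simp add: dist_norm norm_minus_commute)
        also have "\<dots> \<le> 1 * dist y v" using that by (intro mult_right_mono) auto
        finally show "dist y (y + s *\<^sub>R (v - y)) < \<delta> y" using True \<rho> by simp
      qed
      then have "ennreal \<bar>u v - u (y + 0 *\<^sub>R (v - y))\<bar> \<le> ?S v"
        using upper_pair_segment[OF ug, of 0 y v] True by (simp add: F_def)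
      moreover have "ennreal \<bar>u y\<bar> \<le> ennreal \<bar>u v\<bar> + ennreal \<bar>u v - u y\<bar>"
      proof -
        have "ennreal \<bar>u y\<bar> \<le> ennreal (\<bar>u v\<bar> + \<bar>u v - u y\<bar>)" by (intro ennreal_leI) linarith
        also have "\<dots> = ennreal \<bar>u v\<bar> + ennreal \<bar>u v - u y\<bar>" by (rule ennreal_plus) auto
        finally show ?thesis .
      qed
      ultimately show ?thesis using True by (simp add: order_trans[OF _ add_left_mono])
    qed simp
  qed
  also have "\<dots> = (\<integral>\<^sup>+v. ennreal \<bar>u v\<bar> * indicator (ball y \<rho>) v \<partial>lborel) + (\<integral>\<^sup>+v. ?S v \<partial>lborel)"
    by (intro nn_integral_add) measurable
  also have "(\<integral>\<^sup>+v. ?S v \<partial>lborel) \<le> ennreal (\<rho> ^ DIM('a) / real DIM('a)) * (\<integral>\<^sup>+z. F z * ennreal (dist z y powr (1 - real DIM('a))) * indicator (ball y \<rho>) z \<partial>lborel)"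
    using \<rho> by (intro nn_integral_segments_le_riesz) auto
  finally show ?thesis by (simp add: F_def \<rho>_def add_left_mono)
qed

text \<open>The constant is uniform in \<open>\<gamma>\<close> apart from the factor \<open>1/\<gamma>\<close>, although the weight exponent \<open>b - \<gamma>\<close> on
both sides varies with \<open>\<gamma>\<close>.\<close>

lemma sobolev_hardy_below_critical:
  assumes c: "0 < c" and cov: "\<And>x r R. x \<in> - G \<Longrightarrow> 0 < r \<Longrightarrow> r < R \<Longrightarrow>
      c * (r / R) powr (- l) \<le> real (covering_number (- G \<inter> ball x R) r)"
    and p: "1 < p" and q: "p \<le> q" and sub: "q * (real DIM('a) - p) < real DIM('a) * p"
    and b: "b \<le> 0" and l: "real DIM('a) - p + b < l"
  shows "\<exists>C>0. \<forall>\<gamma> u g. 0 < \<gamma> \<longrightarrow> \<gamma> \<le> 1 \<longrightarrow> upper_pair u g \<longrightarrow>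
    (\<integral>\<^sup>+y. ennreal (\<bar>u y\<bar> powr q * \<delta> y powr (q / p * (real DIM('a) - p + (b - \<gamma>)) - real DIM('a))) * indicator G y \<partial>lborel)
      \<le> ennreal (C / \<gamma>) * ennreal_powr (\<integral>\<^sup>+z. energy_density g p (b - \<gamma>) z \<partial>lborel) (q / p)"
proof -
  define n where "n = real DIM('a)"
  have n: "1 \<le> n" using DIM_positive[where 'a='a] by (simp add: n_def Suc_leI)
  obtain C1 where C1: "0 < C1" and avg: "\<forall>\<gamma> u g. 0 < \<gamma> \<longrightarrow> \<gamma> \<le> 1 \<longrightarrow> upper_pair u g \<longrightarrow>
    (\<integral>\<^sup>+y. ennreal_powr (\<integral>\<^sup>+v. ennreal \<bar>u v\<bar> * indicator (ball y (\<delta> y / 2)) v \<partial>lborel) q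
        * ennreal (\<delta> y powr (q / p * (n - p + (b - \<gamma>)) - n - n * q)) * indicator G y \<partial>lborel)
      \<le> ennreal (C1 / \<gamma>) * ennreal_powr (\<integral>\<^sup>+z. energy_density g p (b - \<gamma>) z \<partial>lborel) (q / p)"
    using average_integral_le[OF c cov p q b l] unfolding n_def by blast
  obtain C2 where C2: "0 < C2" and riesz: "\<forall>\<gamma> u g. 0 < \<gamma> \<longrightarrow> \<gamma> \<le> 1 \<longrightarrow> upper_pair u g \<longrightarrow>
    (\<integral>\<^sup>+y. ennreal_powr (\<integral>\<^sup>+z. (ennreal (g z) * indicator G z) * ennreal (dist z y powr (1 - n)) * indicator (ball y (\<delta> y / 2)) z \<partial>lborel) q
        * ennreal (\<delta> y powr (q / p * (n - p + (b - \<gamma>)) - n)) * indicator G y \<partial>lborel)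
      \<le> ennreal C2 * ennreal_powr (\<integral>\<^sup>+z. energy_density g p (b - \<gamma>) z \<partial>lborel) (q / p)"
    using riesz_integral_le[OF p q sub b] unfolding n_def by blast
  define k where "k = 2 powr n / unit_ball_vol n"
  have k: "0 < k" using n by (simp add: k_def)
  define C where "C = (2 * k) powr q * (C1 + C2)"
  have C: "0 < C" using C1 C2 k by (simp add: C_def)
  show ?thesis unfolding n_def[symmetric]
  proof (intro exI[of _ C] conjI C allI impI)
    fix \<gamma> :: real and u g assume \<gamma>: "0 < \<gamma>" "\<gamma> \<le> 1" and ug: "upper_pair u g"
    note [measurable] = density_measurable[OF ug] upper_pair_measurable[OF ug]
    define a where "a y = (\<integral>\<^sup>+v. ennreal \<bar>u v\<bar> * indicator (ball y (\<delta> y / 2)) v \<partial>lborel)" for y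
    define I where "I y = (\<integral>\<^sup>+z. (ennreal (g z) * indicator G z) * ennreal (dist z y powr (1 - n)) * indicator (ball y (\<delta> y / 2)) z \<partial>lborel)" for y
    have [measurable]: "a \<in> borel_measurable borel" "I \<in> borel_measurable borel"
      unfolding a_def[abs_def] I_def[abs_def] ball_def by measurable
    define E where "E = q / p * (n - p + (b - \<gamma>)) - n"
    define W where "W = ennreal_powr (\<integral>\<^sup>+z. energy_density g p (b - \<gamma>) z \<partial>lborel) (q / p)"
    have pt: "ennreal (\<bar>u y\<bar> powr q * \<delta> y powr E) * indicator G y \<le> ennreal ((2 * k) powr q) *
      (ennreal_powr (a y) q * ennreal (\<delta> y powr (E - n * q)) * indicator G y + ennreal_powr (I y) q * ennreal (\<delta> y powr E) * indicator G y)" for y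
    proof (cases "y \<in> G")
      case True
      define d where "d = \<delta> y"
      have d: "0 < d" using \<delta>_pos[OF True] by (simp add: d_def)
      define \<omega> where "\<omega> = unit_ball_vol n"
      have \<omega>: "0 < \<omega>" using n by (simp add: \<omega>_def)
      have base: "ennreal (\<omega> * (d / 2) powr n) * ennreal \<bar>u y\<bar> \<le> a y + ennreal ((d / 2) powr n / n) * I y"
        using pointwise_le_average_plus_riesz[OF ug True] d
        by (simp add: a_def I_def d_def \<omega>_def n_def powr_realpow)
      have inv: "k * d powr (- n) * (\<omega> * (d / 2) powr n) = 1"
        using d \<omega> by (simp add: k_def \<omega>_def powr_divide powr_minus field_simps)
      have inv2: "k * d powr (- n) * ((d / 2) powr n / n) \<le> k"
      proof -
        have "d powr (- n) * ((d / 2) powr n / n) = 1 / (2 powr n * n)"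
          using d by (simp add: powr_divide powr_minus field_simps)
        also have "\<dots> \<le> 1" using n mult_mono[of 1 "2 powr n" 1 n] by (simp add: ge_one_powr_ge_zero)
        finally have "d powr (- n) * ((d / 2) powr n / n) \<le> 1" .
        from mult_left_mono[OF this, of k] k show ?thesis by (simp only: mult.assoc mult_1_right)
      qed
      have "ennreal \<bar>u y\<bar> = ennreal (k * d powr (- n)) * (ennreal (\<omega> * (d / 2) powr n) * ennreal \<bar>u y\<bar>)"
        using k \<omega> inv by (simp add: mult.assoc[symmetric] flip: ennreal_mult)
      also have "\<dots> \<le> ennreal (k * d powr (- n)) * (a y + ennreal ((d / 2) powr n / n) * I y)"
        by (intro mult_left_mono base) auto
      also have "\<dots> = ennreal k * (ennreal (d powr (- n)) * a y) + ennreal (k * d powr (- n) * ((d / 2) powr n / n)) * I y"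
      proof -
        have "ennreal (k * e * x) = ennreal k * (ennreal e * ennreal x)" if "0 \<le> e" "0 \<le> x" for e x
          using that k by (simp add: ennreal_mult mult.assoc)
        from this[of "d powr (- n)" "(d / 2) powr n / n"] show ?thesis
          using k n by (simp only: distrib_left ennreal_mult[OF less_imp_le[OF k]] powr_ge_zero) (simp add: distrib_left mult.assoc)
      qed
      also have "\<dots> \<le> ennreal k * (ennreal (d powr (- n)) * a y) + ennreal k * I y"
        by (intro add_left_mono mult_right_mono ennreal_leI inv2) auto
      also have "\<dots> = ennreal k * (ennreal (d powr (- n)) * a y + I y)" by (simp add: distrib_left)
      finally have "ennreal_powr (ennreal \<bar>u y\<bar>) q \<le> ennreal (k powr q) * ennreal_powr (ennreal (d powr (- n)) * a y + I y) q"
        using k p q by (intro ennreal_powr_scale_le) auto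
      moreover have "ennreal_powr (ennreal (d powr (- n)) * a y + I y) q \<le> ennreal (2 powr q) * (ennreal_powr (ennreal (d powr (- n)) * a y) q + ennreal_powr (I y) q)"
        using p q by (intro ennreal_powr_add_le) auto
      ultimately have "ennreal_powr (ennreal \<bar>u y\<bar>) q \<le> ennreal (k powr q * 2 powr q) * (ennreal_powr (ennreal (d powr (- n)) * a y) q + ennreal_powr (I y) q)"
        by (rule le_scale_trans) auto
      also have "k powr q * 2 powr q = (2 * k) powr q" using k by (simp add: powr_mult)
      also have "ennreal_powr (ennreal (d powr (- n)) * a y) q = ennreal (d powr (- n * q)) * ennreal_powr (a y) q"
        using p q by (simp add: ennreal_powr_mult ennreal_powr_ennreal powr_powr)
      finally have "ennreal (\<bar>u y\<bar> powr q) \<le> ennreal ((2 * k) powr q) * (ennreal (d powr (- n * q)) * ennreal_powr (a y) q + ennreal_powr (I y) q)"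
        using p q by (simp add: ennreal_powr_ennreal)
      then have "ennreal (\<bar>u y\<bar> powr q) * ennreal (d powr E) \<le> ennreal ((2 * k) powr q) * (ennreal (d powr (- n * q)) * ennreal_powr (a y) q + ennreal_powr (I y) q) * ennreal (d powr E)"
        by (intro mult_right_mono) auto
      also have "\<dots> = ennreal ((2 * k) powr q) * (ennreal_powr (a y) q * (ennreal (d powr (- n * q)) * ennreal (d powr E)) + ennreal_powr (I y) q * ennreal (d powr E))"
        by (simp add: distrib_left distrib_right mult_ac)
      also have "ennreal (d powr (- n * q)) * ennreal (d powr E) = ennreal (d powr (E - n * q))"
        by (simp add: mult_ac flip: ennreal_mult powr_add)
      finally show ?thesis using True by (simp add: d_def ennreal_mult)
    qed simp
    have "(\<integral>\<^sup>+y. ennreal (\<bar>u y\<bar> powr q * \<delta> y powr E) * indicator G y \<partial>lborel)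
      \<le> (\<integral>\<^sup>+y. ennreal ((2 * k) powr q) *
      (ennreal_powr (a y) q * ennreal (\<delta> y powr (E - n * q)) * indicator G y + ennreal_powr (I y) q * ennreal (\<delta> y powr E) * indicator G y) \<partial>lborel)"
      by (intro nn_integral_mono pt)
    also have "\<dots> = ennreal ((2 * k) powr q) * ((\<integral>\<^sup>+y. ennreal_powr (a y) q * ennreal (\<delta> y powr (E - n * q)) * indicator G y \<partial>lborel)
      + (\<integral>\<^sup>+y. ennreal_powr (I y) q * ennreal (\<delta> y powr E) * indicator G y \<partial>lborel))"
      by (subst nn_integral_cmult, measurable, subst nn_integral_add, measurable)
    also have "\<dots> \<le> ennreal ((2 * k) powr q) * (ennreal (C1 / \<gamma>) * W + ennreal (C2 / \<gamma>) * W)"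
    proof (intro mult_left_mono add_mono)
      show "(\<integral>\<^sup>+y. ennreal_powr (a y) q * ennreal (\<delta> y powr (E - n * q)) * indicator G y \<partial>lborel) \<le> ennreal (C1 / \<gamma>) * W"
        using avg \<gamma> ug unfolding a_def E_def W_def by blast
      have "(\<integral>\<^sup>+y. ennreal_powr (I y) q * ennreal (\<delta> y powr E) * indicator G y \<partial>lborel) \<le> ennreal C2 * W"
        using riesz \<gamma> ug unfolding I_def E_def W_def by blast
      also have "\<dots> \<le> ennreal (C2 / \<gamma>) * W"
        using C2 \<gamma> by (intro mult_right_mono ennreal_leI) (auto simp: field_simps)
      finally show "(\<integral>\<^sup>+y. ennreal_powr (I y) q * ennreal (\<delta> y powr E) * indicator G y \<partial>lborel) \<le> ennreal (C2 / \<gamma>) * W" .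
    qed auto
    also have "\<dots> = ennreal ((2 * k) powr q * (C1 / \<gamma> + C2 / \<gamma>)) * W"
    proof -
      have "ennreal x * (ennreal e * W + ennreal e' * W) = ennreal (x * (e + e')) * W"
        if "0 \<le> x" "0 \<le> e" "0 \<le> e'" for x e e'
        using that by (simp add: ennreal_mult ennreal_plus distrib_right distrib_left mult.assoc)
      then show ?thesis using C1 C2 \<gamma> by simp
    qed
    also have "(2 * k) powr q * (C1 / \<gamma> + C2 / \<gamma>) = C / \<gamma>" by (simp add: C_def add_divide_distrib distrib_left)
    finally show "(\<integral>\<^sup>+y. ennreal (\<bar>u y\<bar> powr q * \<delta> y powr (q / p * (n - p + (b - \<gamma>)) - n)) * indicator G y \<partial>lborel)
      \<le> ennreal (C / \<gamma>) * ennreal_powr (\<integral>\<^sup>+z. energy_density g p (b - \<gamma>) z \<partial>lborel) (q / p)"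
      unfolding E_def W_def .
  qed
qed

end

section \<open>Closing the gap by absorption\<close>

context proper_open_set begin

lemma upper_pair_times_powr:
  assumes ug: "upper_pair u g" and t: "0 < t"
  shows "upper_pair (\<lambda>x. u x * \<delta> x powr t) (\<lambda>x. g x * \<delta> x powr t + t * \<bar>u x\<bar> * \<delta> x powr (t - 1))"
  unfolding upper_pair_def
proof (intro conjI ballI allI impI)
  have u: "continuous_on UNIV u" and g: "continuous_on G g" and g0: "\<And>x. x \<in> G \<Longrightarrow> 0 \<le> g x"
    and lip: "\<And>z \<epsilon>. z \<in> G \<Longrightarrow> 0 < \<epsilon> \<Longrightarrow> \<exists>d>0. \<forall>y. dist y z < d \<longrightarrow> \<bar>u y - u z\<bar> \<le> (g z + \<epsilon>) * dist y z"
    using ug by (auto simp: upper_pair_def)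
  have \<delta>: "continuous_on S \<delta>" for S unfolding \<delta>_def by (intro continuous_intros)
  show "continuous_on UNIV (\<lambda>x. u x * \<delta> x powr t)"
    using t by (intro continuous_intros u continuous_on_powr' \<delta>) auto
  show "continuous_on G (\<lambda>x. g x * \<delta> x powr t + t * \<bar>u x\<bar> * \<delta> x powr (t - 1))"
    using \<delta>_pos by (intro continuous_on_add continuous_on_mult continuous_on_const continuous_on_rabs
        continuous_on_powr g \<delta> continuous_on_subset[OF u]) fastforce+
  show "0 \<le> g x * \<delta> x powr t + t * \<bar>u x\<bar> * \<delta> x powr (t - 1)" if "x \<in> G" for x
    using g0[OF that] t by simp
  show "u x * \<delta> x powr t = 0" if "x \<notin> G" for x using that ug by (simp add: upper_pair_def)
  fix z and \<epsilon> :: real assume z: "z \<in> G" and \<epsilon>: "0 < \<epsilon>"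
  have \<delta>z: "0 < \<delta> z" using \<delta>_pos z .
  \<comment> \<open>\<open>Q e\<close> bounds the difference quotient of the product when the errors of the factors are at most \<open>e\<close>\<close>
  define Q where "Q e = (g z + e) * (\<delta> z powr t + e) + \<bar>u z\<bar> * (t * \<delta> z powr (t - 1) + e)" for e
  have "(Q \<longlongrightarrow> Q 0) (at_right 0)" unfolding Q_def by (auto intro!: tendsto_eq_intros)
  moreover have "Q 0 < Q 0 + \<epsilon>" using \<epsilon> by simp
  ultimately have "\<forall>\<^sub>F e in at_right 0. Q e < Q 0 + \<epsilon>" by (rule order_tendstoD)
  moreover have "\<forall>\<^sub>F e in at_right (0::real). 0 < e" by (rule eventually_at_right_less)
  ultimately have "\<exists>e. 0 < e \<and> Q e < Q 0 + \<epsilon>"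
    using eventually_happens[OF eventually_conj] by (metis (mono_tags, lifting) trivial_limit_at_right_real)
  then obtain e where e: "0 < e" "Q e < Q 0 + \<epsilon>" by blast
  obtain d1 where d1: "0 < d1" "\<And>y. dist y z < d1 \<Longrightarrow> \<bar>u y - u z\<bar> \<le> (g z + e) * dist y z"
    using lip[OF z e(1)] by blast
  have "((\<lambda>s. s powr t) has_real_derivative t * \<delta> z powr (t - 1)) (at (\<delta> z))"
    using \<delta>z by (intro has_real_derivative_powr) auto
  then have der: "((\<lambda>s. s powr t) has_derivative (\<lambda>h. t * \<delta> z powr (t - 1) * h)) (at (\<delta> z))"
    by (simp add: has_field_derivative_def)
  then obtain d2 where d2: "0 < d2" "\<And>s. \<bar>s - \<delta> z\<bar> < d2 \<Longrightarrow>
      \<bar>s powr t - \<delta> z powr t - t * \<delta> z powr (t - 1) * (s - \<delta> z)\<bar> \<le> e * \<bar>s - \<delta> z\<bar>"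
    using e(1) unfolding has_derivative_at_alt by (auto simp: real_norm_def)
  have "isCont (\<lambda>s. s powr t) (\<delta> z)" using \<delta>z by (intro continuous_intros) auto
  then obtain d3 where d3: "0 < d3" "\<And>s. \<bar>s - \<delta> z\<bar> < d3 \<Longrightarrow> \<bar>s powr t - \<delta> z powr t\<bar> < e"
    using e(1) unfolding continuous_at_eps_delta by (auto simp: dist_real_def)
  show "\<exists>d>0. \<forall>y. dist y z < d \<longrightarrow> \<bar>u y * \<delta> y powr t - u z * \<delta> z powr t\<bar>
      \<le> (g z * \<delta> z powr t + t * \<bar>u z\<bar> * \<delta> z powr (t - 1) + \<epsilon>) * dist y z"
  proof (intro exI[of _ "min d1 (min d2 d3)"] conjI allI impI)
    fix y assume y: "dist y z < min d1 (min d2 d3)"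
    have \<delta>yz: "\<bar>\<delta> y - \<delta> z\<bar> \<le> dist y z" using \<delta>_lipschitz[of y z] \<delta>_lipschitz[of z y] by (simp add: dist_commute)
    have 1: "\<bar>u y - u z\<bar> \<le> (g z + e) * dist y z" using d1(2) y by simp
    have "\<bar>\<delta> y powr t - \<delta> z powr t\<bar> < e" using d3(2)[of "\<delta> y"] \<delta>yz y by simp
    then have 2: "\<delta> y powr t \<le> \<delta> z powr t + e" by linarith
    have "\<bar>\<delta> y powr t - \<delta> z powr t - t * \<delta> z powr (t - 1) * (\<delta> y - \<delta> z)\<bar> \<le> e * \<bar>\<delta> y - \<delta> z\<bar>"
      using d2(2)[of "\<delta> y"] \<delta>yz y by simp
    then have "\<bar>\<delta> y powr t - \<delta> z powr t\<bar> \<le> \<bar>t * \<delta> z powr (t - 1) * (\<delta> y - \<delta> z)\<bar> + e * \<bar>\<delta> y - \<delta> z\<bar>" by linarith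
    also have "\<dots> = (t * \<delta> z powr (t - 1) + e) * \<bar>\<delta> y - \<delta> z\<bar>" using t by (simp add: abs_mult distrib_right)
    also have "\<dots> \<le> (t * \<delta> z powr (t - 1) + e) * dist y z" using \<delta>yz t e by (intro mult_left_mono) auto
    finally have 3: "\<bar>\<delta> y powr t - \<delta> z powr t\<bar> \<le> (t * \<delta> z powr (t - 1) + e) * dist y z" .
    have "u y * \<delta> y powr t - u z * \<delta> z powr t = (u y - u z) * \<delta> y powr t + u z * (\<delta> y powr t - \<delta> z powr t)"
      by (simp add: algebra_simps)
    then have "\<bar>u y * \<delta> y powr t - u z * \<delta> z powr t\<bar> \<le> \<bar>u y - u z\<bar> * \<delta> y powr t + \<bar>u z\<bar> * \<bar>\<delta> y powr t - \<delta> z powr t\<bar>"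
      using abs_triangle_ineq[of "(u y - u z) * \<delta> y powr t" "u z * (\<delta> y powr t - \<delta> z powr t)"] by (simp add: abs_mult)
    also have "\<dots> \<le> ((g z + e) * dist y z) * (\<delta> z powr t + e) + \<bar>u z\<bar> * ((t * \<delta> z powr (t - 1) + e) * dist y z)"
      using 1 2 3 e g0[OF z] by (intro add_mono mult_mono mult_left_mono) auto
    also have "\<dots> = Q e * dist y z" by (simp add: Q_def algebra_simps)
    also have "\<dots> \<le> (Q 0 + \<epsilon>) * dist y z" using e by (intro mult_right_mono) auto
    finally show "\<bar>u y * \<delta> y powr t - u z * \<delta> z powr t\<bar>
      \<le> (g z * \<delta> z powr t + t * \<bar>u z\<bar> * \<delta> z powr (t - 1) + \<epsilon>) * dist y z"
      by (simp add: Q_def mult_ac)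
  qed (use d1 d2 d3 in auto)
qed

text \<open>The weight exponent \<open>- (p * t)\<close> cancels the factor \<open>\<delta>\<^sup>t\<close>, so the energy of \<open>u \<delta>\<^sup>t\<close> is compared with the
unweighted energy of \<open>u\<close> and the left-hand side of Hardy's inequality.\<close>

lemma energy_density_times_powr_le:
  assumes ug: "upper_pair u g" and t: "0 < t" and p: "1 < p"
  shows "(\<integral>\<^sup>+z. energy_density (\<lambda>x. g x * \<delta> x powr t + t * \<bar>u x\<bar> * \<delta> x powr (t - 1)) p (- (p * t)) z \<partial>lborel)
    \<le> ennreal (2 powr p) * ((\<integral>\<^sup>+z. energy_density g p 0 z \<partial>lborel)
        + ennreal (t powr p) * (\<integral>\<^sup>+z. ennreal (\<bar>u z\<bar> powr p * \<delta> z powr (- p)) * indicator G z \<partial>lborel))"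
proof -
  note [measurable] = energy_density_measurable[OF ug] upper_pair_measurable[OF ug]
  have "(\<integral>\<^sup>+z. energy_density (\<lambda>x. g x * \<delta> x powr t + t * \<bar>u x\<bar> * \<delta> x powr (t - 1)) p (- (p * t)) z \<partial>lborel)
    \<le> (\<integral>\<^sup>+z. ennreal (2 powr p) * (energy_density g p 0 z + ennreal (t powr p) * (ennreal (\<bar>u z\<bar> powr p * \<delta> z powr (- p)) * indicator G z)) \<partial>lborel)"
  proof (rule nn_integral_mono)
    fix z
    show "energy_density (\<lambda>x. g x * \<delta> x powr t + t * \<bar>u x\<bar> * \<delta> x powr (t - 1)) p (- (p * t)) z
      \<le> ennreal (2 powr p) * (energy_density g p 0 z + ennreal (t powr p) * (ennreal (\<bar>u z\<bar> powr p * \<delta> z powr (- p)) * indicator G z))"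
    proof (cases "z \<in> G")
      case True
      have \<delta>z: "0 < \<delta> z" using \<delta>_pos True .
      have g: "0 \<le> g z" using ug True by (simp add: upper_pair_def)
      let ?a = "g z * \<delta> z powr t" and ?b = "t * \<bar>u z\<bar> * \<delta> z powr (t - 1)"
      have ab: "0 \<le> ?a" "0 \<le> ?b" using g t by auto
      have "(?a + ?b) powr p \<le> (2 * max ?a ?b) powr p" using ab p by (intro powr_mono2) auto
      also have "\<dots> = 2 powr p * max ?a ?b powr p" using ab by (subst powr_mult) auto
      also have "\<dots> \<le> 2 powr p * (?a powr p + ?b powr p)" by (intro mult_left_mono) (auto simp: max_def)
      finally have "(?a + ?b) powr p * \<delta> z powr (- (p * t)) \<le> 2 powr p * (?a powr p + ?b powr p) * \<delta> z powr (- (p * t))"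
        by (intro mult_right_mono) auto
      also have "\<dots> = 2 powr p * (?a powr p * \<delta> z powr (- (p * t)) + ?b powr p * \<delta> z powr (- (p * t)))"
        by (simp add: algebra_simps)
      also have "?a powr p * \<delta> z powr (- (p * t)) = g z powr p * \<delta> z powr 0"
        using g \<delta>z by (simp add: powr_mult powr_powr powr_minus mult_ac)
      also have "?b powr p * \<delta> z powr (- (p * t)) = t powr p * (\<bar>u z\<bar> powr p * \<delta> z powr (- p))"
      proof -
        have "(t - 1) * p + - (p * t) = - p" by (simp add: algebra_simps)
        then have "\<delta> z powr ((t - 1) * p) * \<delta> z powr (- (p * t)) = \<delta> z powr (- p)" by (simp only: powr_add[symmetric])
        moreover have "?b powr p = t powr p * \<bar>u z\<bar> powr p * \<delta> z powr ((t - 1) * p)" using t by (simp add: powr_mult powr_powr)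
        ultimately show ?thesis by (simp add: mult.assoc)
      qed
      finally have "ennreal ((?a + ?b) powr p * \<delta> z powr (- (p * t)))
        \<le> ennreal (2 powr p * (g z powr p * \<delta> z powr 0 + t powr p * (\<bar>u z\<bar> powr p * \<delta> z powr (- p))))" by (rule ennreal_leI)
      then show ?thesis using True by (simp add: energy_density_def ennreal_mult ennreal_plus)
    qed (simp add: energy_density_def)
  qed
  also have "\<dots> = ennreal (2 powr p) * ((\<integral>\<^sup>+z. energy_density g p 0 z \<partial>lborel)
        + ennreal (t powr p) * (\<integral>\<^sup>+z. ennreal (\<bar>u z\<bar> powr p * \<delta> z powr (- p)) * indicator G z \<partial>lborel))"
    by (subst nn_integral_cmult, measurable, subst nn_integral_add, measurable, subst nn_integral_cmult, measurable)
  finally show ?thesis .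
qed


text \<open>The strict inequality \<open>n - p + b < l\<close> leaves room to raise \<open>b < 0\<close> by some \<open>\<gamma> > 0\<close>.\<close>

lemma sobolev_hardy_negative_weight:
  assumes c: "0 < c" and cov: "\<And>x r R. x \<in> - G \<Longrightarrow> 0 < r \<Longrightarrow> r < R \<Longrightarrow>
      c * (r / R) powr (- l) \<le> real (covering_number (- G \<inter> ball x R) r)"
    and p: "1 < p" and q: "p \<le> q" and sub: "q * (real DIM('a) - p) < real DIM('a) * p"
    and b: "b < 0" and l: "real DIM('a) - p + b < l"
  shows "\<exists>C>0. \<forall>u g. upper_pair u g \<longrightarrow>
    (\<integral>\<^sup>+y. ennreal (\<bar>u y\<bar> powr q * \<delta> y powr (q / p * (real DIM('a) - p + b) - real DIM('a))) * indicator G y \<partial>lborel)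
      \<le> ennreal C * ennreal_powr (\<integral>\<^sup>+z. energy_density g p b z \<partial>lborel) (q / p)"
proof -
  define e where "e = (l - (real DIM('a) - p + b)) / 2"
  have e: "0 < e" "real DIM('a) - p + b + 2 * e = l" using l by (simp_all add: e_def field_simps)
  define \<gamma> where "\<gamma> = min 1 (min (- b) e)"
  have \<gamma>: "0 < \<gamma>" "\<gamma> \<le> 1" "b + \<gamma> \<le> 0" "\<gamma> \<le> e"
    using b e(1) by (auto simp: \<gamma>_def)
  then have l': "real DIM('a) - p + (b + \<gamma>) < l" using e by linarith
  obtain C where C: "0 < C" "\<forall>\<gamma>' u g. 0 < \<gamma>' \<longrightarrow> \<gamma>' \<le> 1 \<longrightarrow> upper_pair u g \<longrightarrow>
    (\<integral>\<^sup>+y. ennreal (\<bar>u y\<bar> powr q * \<delta> y powr (q / p * (real DIM('a) - p + (b + \<gamma> - \<gamma>')) - real DIM('a))) * indicator G y \<partial>lborel)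
      \<le> ennreal (C / \<gamma>') * ennreal_powr (\<integral>\<^sup>+z. energy_density g p (b + \<gamma> - \<gamma>') z \<partial>lborel) (q / p)"
    using sobolev_hardy_below_critical[OF c cov p q sub \<gamma>(3) l'] by blast
  show ?thesis
    using C(1) C(2)[rule_format, OF \<gamma>(1,2)] \<gamma>(1) by (intro exI[of _ "C / \<gamma>"]) auto
qed

text \<open>Applied to \<open>u \<delta>\<^sup>t\<close> with \<open>\<gamma> = p t\<close>, the inequality with a gap bounds the left-hand side \<open>X\<close> by a constant
times \<open>1/\<gamma>\<close> times the energy plus \<open>t\<^sup>p X\<close>. Since \<open>\<gamma>\<^bsup>p-1\<^esup>\<close> tends to \<open>0\<close> with \<open>\<gamma>\<close>, half of
\<open>X\<close> can be absorbed, provided that \<open>X\<close> is finite.\<close>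

lemma hardy_unweighted:
  assumes c: "0 < c" and cov: "\<And>x r R. x \<in> - G \<Longrightarrow> 0 < r \<Longrightarrow> r < R \<Longrightarrow>
      c * (r / R) powr (- l) \<le> real (covering_number (- G \<inter> ball x R) r)"
    and p: "1 < p" and l: "real DIM('a) - p < l"
  shows "\<exists>C>0. \<forall>u g. upper_pair u g \<longrightarrow>
    (\<integral>\<^sup>+z. ennreal (\<bar>u z\<bar> powr p * \<delta> z powr (- p)) * indicator G z \<partial>lborel) < top \<longrightarrow>
    (\<integral>\<^sup>+z. ennreal (\<bar>u z\<bar> powr p * \<delta> z powr (- p)) * indicator G z \<partial>lborel)
      \<le> ennreal C * (\<integral>\<^sup>+z. energy_density g p 0 z \<partial>lborel)"
proof -
  define n where "n = real DIM('a)"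
  have sub: "p * (real DIM('a) - p) < real DIM('a) * p" using p by (simp add: algebra_simps)
  have l0: "real DIM('a) - p + 0 < l" using l by simp
  obtain C where C: "0 < C" and main: "\<forall>\<gamma> u g. 0 < \<gamma> \<longrightarrow> \<gamma> \<le> 1 \<longrightarrow> upper_pair u g \<longrightarrow>
    (\<integral>\<^sup>+y. ennreal (\<bar>u y\<bar> powr p * \<delta> y powr (p / p * (n - p + (0 - \<gamma>)) - n)) * indicator G y \<partial>lborel)
      \<le> ennreal (C / \<gamma>) * ennreal_powr (\<integral>\<^sup>+z. energy_density g p (0 - \<gamma>) z \<partial>lborel) (p / p)"
    using sobolev_hardy_below_critical[OF c cov p order_refl sub order_refl l0] unfolding n_def by blast
  \<comment> \<open>with \<open>\<gamma>\<^bsup>p-1\<^esup> \<le> s\<close> the coefficient of the absorbed term is at most one half\<close>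
  define s where "s = p powr p / (2 * C * 2 powr p)"
  have s: "0 < s" using C p by (simp add: s_def)
  define \<gamma> where "\<gamma> = min 1 (s powr (1 / (p - 1)))"
  have \<gamma>: "0 < \<gamma>" "\<gamma> \<le> 1" using s by (auto simp: \<gamma>_def)
  define t where "t = \<gamma> / p"
  have t: "0 < t" "p * t = \<gamma>" using \<gamma> p by (auto simp: t_def)
  have absorb: "C / \<gamma> * 2 powr p * t powr p \<le> 1 / 2"
  proof -
    have "\<gamma> powr (p - 1) \<le> (s powr (1 / (p - 1))) powr (p - 1)"
      using \<gamma> p by (intro powr_mono2) (auto simp: \<gamma>_def)
    also have "\<dots> = s" using s p by (simp add: powr_powr)
    finally have "\<gamma> powr (p - 1) \<le> s" .
    have "C / \<gamma> * 2 powr p * t powr p = C * 2 powr p / p powr p * \<gamma> powr (p - 1)"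
      using \<gamma> p by (simp add: t_def powr_divide powr_diff)
    also have "\<dots> \<le> C * 2 powr p / p powr p * s"
      using C by (intro mult_left_mono \<open>\<gamma> powr (p - 1) \<le> s\<close>) auto
    also have "\<dots> = 1 / 2" using C p by (simp add: s_def)
    finally show ?thesis .
  qed
  define K where "K = 2 * (C / \<gamma> * 2 powr p)"
  have K: "0 < K" using C \<gamma> by (simp add: K_def)
  show ?thesis
  proof (intro exI[of _ K] conjI K allI impI)
    fix u g assume ug: "upper_pair u g"
    define X where "X = (\<integral>\<^sup>+z. ennreal (\<bar>u z\<bar> powr p * \<delta> z powr (- p)) * indicator G z \<partial>lborel)"
    define D where "D = (\<integral>\<^sup>+z. energy_density g p 0 z \<partial>lborel)"
    assume "(\<integral>\<^sup>+z. ennreal (\<bar>u z\<bar> powr p * \<delta> z powr (- p)) * indicator G z \<partial>lborel) < top"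
    then have fin: "X < top" by (simp add: X_def)
    let ?g = "\<lambda>x. g x * \<delta> x powr t + t * \<bar>u x\<bar> * \<delta> x powr (t - 1)"
    have "X = (\<integral>\<^sup>+y. ennreal (\<bar>u y * \<delta> y powr t\<bar> powr p * \<delta> y powr (p / p * (n - p + (0 - \<gamma>)) - n)) * indicator G y \<partial>lborel)"
      unfolding X_def
    proof (rule nn_integral_cong)
      fix y
      have "t * p + (- p - \<gamma>) = - p" using t by (simp add: mult.commute)
      then have "\<delta> y powr (t * p) * \<delta> y powr (- p - \<gamma>) = \<delta> y powr (- p)" by (simp only: powr_add[symmetric])
      then show "ennreal (\<bar>u y\<bar> powr p * \<delta> y powr (- p)) * indicator G y
        = ennreal (\<bar>u y * \<delta> y powr t\<bar> powr p * \<delta> y powr (p / p * (n - p + (0 - \<gamma>)) - n)) * indicator G y"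
        using p by (simp add: abs_mult powr_mult powr_powr mult.assoc)
    qed
    also have "\<dots> \<le> ennreal (C / \<gamma>) * ennreal_powr (\<integral>\<^sup>+z. energy_density ?g p (0 - \<gamma>) z \<partial>lborel) (p / p)"
      using main \<gamma> upper_pair_times_powr[OF ug t(1)] by blast
    also have "\<dots> = ennreal (C / \<gamma>) * (\<integral>\<^sup>+z. energy_density ?g p (- (p * t)) z \<partial>lborel)"
      using p t by simp
    also have "\<dots> \<le> ennreal (C / \<gamma>) * (ennreal (2 powr p) * (D + ennreal (t powr p) * X))"
      unfolding D_def X_def by (intro mult_left_mono energy_density_times_powr_le ug t p) auto
    also have "\<dots> = ennreal (C / \<gamma> * 2 powr p) * D + ennreal (C / \<gamma> * 2 powr p * t powr p) * X"
    proof -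
      have "ennreal x * (ennreal e * (D + ennreal e' * X)) = ennreal (x * e) * D + ennreal (x * e * e') * X"
        if "0 \<le> x" "0 \<le> e" "0 \<le> e'" for x e e'
        using that by (simp add: ennreal_mult distrib_left mult.assoc)
      then show ?thesis using C \<gamma> by simp
    qed
    also have "\<dots> \<le> ennreal (C / \<gamma> * 2 powr p) * D + ennreal (1 / 2) * X"
      by (intro add_left_mono mult_right_mono ennreal_leI absorb) auto
    finally have XX: "X \<le> ennreal (C / \<gamma> * 2 powr p) * D + ennreal (1 / 2) * X" .
    have "X \<le> ennreal K * D"
    proof (cases "D = top")
      case True
      then show ?thesis using K by (simp add: ennreal_mult_top)
    next
      case False
      then obtain x d where xd: "X = ennreal x" "D = ennreal d" "0 \<le> x" "0 \<le> d"
        using fin by (metis ennreal_cases less_irrefl)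
      have "ennreal x \<le> ennreal (C / \<gamma> * 2 powr p * d + 1 / 2 * x)"
      proof -
        have "ennreal (e * d + e' * x) = ennreal e * D + ennreal e' * X" if "0 \<le> e" "0 \<le> e'" for e e'
          using that xd by (simp add: ennreal_plus ennreal_mult)
        from this[of "C / \<gamma> * 2 powr p" "1 / 2"] have "ennreal (C / \<gamma> * 2 powr p * d + 1 / 2 * x)
            = ennreal (C / \<gamma> * 2 powr p) * D + ennreal (1 / 2) * X"
          using C \<gamma> by simp
        with XX show ?thesis by (simp only: xd(1))
      qed
      then have "x \<le> C / \<gamma> * 2 powr p * d + 1 / 2 * x"
        using C \<gamma> xd by (subst (asm) ennreal_le_iff) auto
      then have "x \<le> K * d" by (simp add: K_def)
      then show ?thesis using xd K by (simp add: ennreal_mult[symmetric] ennreal_leI)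
    qed
    then show "(\<integral>\<^sup>+z. ennreal (\<bar>u z\<bar> powr p * \<delta> z powr (- p)) * indicator G z \<partial>lborel)
      \<le> ennreal K * (\<integral>\<^sup>+z. energy_density g p 0 z \<partial>lborel)" by (simp add: X_def D_def)
  qed
qed

text \<open>The same substitution, now with a fixed \<open>t\<close>: the additional term in the energy of \<open>u \<delta>\<^sup>t\<close> is bounded by
Hardy's inequality.\<close>

lemma sobolev_hardy_unweighted:
  assumes c: "0 < c" and cov: "\<And>x r R. x \<in> - G \<Longrightarrow> 0 < r \<Longrightarrow> r < R \<Longrightarrow>
      c * (r / R) powr (- l) \<le> real (covering_number (- G \<inter> ball x R) r)"
    and p: "1 < p" and q: "p \<le> q" and sub: "q * (real DIM('a) - p) < real DIM('a) * p"
    and l: "real DIM('a) - p < l"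
  shows "\<exists>C>0. \<forall>u g. upper_pair u g \<longrightarrow>
    (\<integral>\<^sup>+z. ennreal (\<bar>u z\<bar> powr p * \<delta> z powr (- p)) * indicator G z \<partial>lborel) < top \<longrightarrow>
    (\<integral>\<^sup>+y. ennreal (\<bar>u y\<bar> powr q * \<delta> y powr (q / p * (real DIM('a) - p) - real DIM('a))) * indicator G y \<partial>lborel)
      \<le> ennreal C * ennreal_powr (\<integral>\<^sup>+z. energy_density g p 0 z \<partial>lborel) (q / p)"
proof -
  define n where "n = real DIM('a)"
  define m where "m = q / p"
  have m: "1 \<le> m" "p * m = q" "m * p = q" using p q by (auto simp: m_def)
  have l0: "real DIM('a) - p + 0 < l" using l by simp
  obtain C where C: "0 < C" and main: "\<forall>\<gamma> u g. 0 < \<gamma> \<longrightarrow> \<gamma> \<le> 1 \<longrightarrow> upper_pair u g \<longrightarrow>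
    (\<integral>\<^sup>+y. ennreal (\<bar>u y\<bar> powr q * \<delta> y powr (m * (n - p + (0 - \<gamma>)) - n)) * indicator G y \<partial>lborel)
      \<le> ennreal (C / \<gamma>) * ennreal_powr (\<integral>\<^sup>+z. energy_density g p (0 - \<gamma>) z \<partial>lborel) m"
    using sobolev_hardy_below_critical[OF c cov p q sub order_refl l0] unfolding n_def m_def by blast
  obtain K where K: "0 < K" and hardy: "\<forall>u g. upper_pair u g \<longrightarrow>
    (\<integral>\<^sup>+z. ennreal (\<bar>u z\<bar> powr p * \<delta> z powr (- p)) * indicator G z \<partial>lborel) < top \<longrightarrow>
    (\<integral>\<^sup>+z. ennreal (\<bar>u z\<bar> powr p * \<delta> z powr (- p)) * indicator G z \<partial>lborel)
      \<le> ennreal K * (\<integral>\<^sup>+z. energy_density g p 0 z \<partial>lborel)"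
    using hardy_unweighted[OF c cov p l] by blast
  \<comment> \<open>the largest \<open>t\<close> for which the gap \<open>p * t\<close> is at most \<open>1\<close>\<close>
  define t where "t = 1 / p"
  have t: "0 < t" "p * t = 1" using p by (auto simp: t_def)
  define k where "k = 2 powr p * (1 + t powr p * K)"
  have k: "0 < k" using K by (auto simp: k_def intro!: mult_pos_pos add_pos_nonneg)
  define C' where "C' = C * k powr m"
  have C': "0 < C'" using C k by (simp add: C'_def)
  show ?thesis unfolding n_def[symmetric] m_def[symmetric]
  proof (intro exI[of _ C'] conjI C' allI impI)
    fix u g assume ug: "upper_pair u g"
      and fin: "(\<integral>\<^sup>+z. ennreal (\<bar>u z\<bar> powr p * \<delta> z powr (- p)) * indicator G z \<partial>lborel) < top"
    define X where "X = (\<integral>\<^sup>+z. ennreal (\<bar>u z\<bar> powr p * \<delta> z powr (- p)) * indicator G z \<partial>lborel)"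
    define D where "D = (\<integral>\<^sup>+z. energy_density g p 0 z \<partial>lborel)"
    let ?g = "\<lambda>x. g x * \<delta> x powr t + t * \<bar>u x\<bar> * \<delta> x powr (t - 1)"
    have "X \<le> ennreal K * D" using hardy ug fin by (auto simp: X_def D_def)
    then have "D + ennreal (t powr p) * X \<le> D + ennreal (t powr p) * (ennreal K * D)"
      by (intro add_left_mono mult_left_mono) auto
    also have "\<dots> = ennreal (1 + t powr p * K) * D"
      using K by (simp add: ennreal_plus ennreal_mult distrib_right mult.assoc)
    finally have "ennreal (2 powr p) * (D + ennreal (t powr p) * X) \<le> ennreal (2 powr p) * (ennreal (1 + t powr p * K) * D)"
      by (intro mult_left_mono) auto
    also have "\<dots> = ennreal k * D" using K by (simp add: k_def ennreal_mult mult.assoc)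
    finally have kD: "ennreal (2 powr p) * (D + ennreal (t powr p) * X) \<le> ennreal k * D" .
    have "(\<integral>\<^sup>+z. energy_density ?g p (- (p * t)) z \<partial>lborel) \<le> ennreal k * D"
      using energy_density_times_powr_le[OF ug t(1) p] kD unfolding D_def X_def by (rule order_trans)
    then have en: "ennreal_powr (\<integral>\<^sup>+z. energy_density ?g p (0 - 1) z \<partial>lborel) m \<le> ennreal (k powr m) * ennreal_powr D m"
      using t k m by (intro ennreal_powr_scale_le) auto
    have "(\<integral>\<^sup>+y. ennreal (\<bar>u y\<bar> powr q * \<delta> y powr (m * (n - p) - n)) * indicator G y \<partial>lborel)
      = (\<integral>\<^sup>+y. ennreal (\<bar>u y * \<delta> y powr t\<bar> powr q * \<delta> y powr (m * (n - p + (0 - 1)) - n)) * indicator G y \<partial>lborel)"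
    proof (rule nn_integral_cong)
      fix y
      have "t * q = m" by (simp add: t_def m_def)
      then have "t * q + (m * (n - p + (0 - 1)) - n) = m * (n - p) - n" by (simp add: algebra_simps)
      then have "\<delta> y powr (t * q) * \<delta> y powr (m * (n - p + (0 - 1)) - n) = \<delta> y powr (m * (n - p) - n)"
        by (simp only: powr_add[symmetric])
      then show "ennreal (\<bar>u y\<bar> powr q * \<delta> y powr (m * (n - p) - n)) * indicator G y
        = ennreal (\<bar>u y * \<delta> y powr t\<bar> powr q * \<delta> y powr (m * (n - p + (0 - 1)) - n)) * indicator G y"
        by (simp add: abs_mult powr_mult powr_powr mult.assoc)
    qed
    also have "\<dots> \<le> ennreal (C / 1) * ennreal_powr (\<integral>\<^sup>+z. energy_density ?g p (0 - 1) z \<partial>lborel) m"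
      using main[rule_format, OF zero_less_one order_refl upper_pair_times_powr[OF ug t(1)]] .
    also have "\<dots> \<le> ennreal (C * k powr m) * ennreal_powr D m"
      using C by (intro le_scale_trans[OF _ en]) auto
    finally show "(\<integral>\<^sup>+y. ennreal (\<bar>u y\<bar> powr q * \<delta> y powr (m * (n - p) - n)) * indicator G y \<partial>lborel)
      \<le> ennreal C' * ennreal_powr (\<integral>\<^sup>+z. energy_density g p 0 z \<partial>lborel) m"
      by (simp add: C'_def D_def)
  qed
qed

end

section \<open>Test functions and the main inequality\<close>

lemma ediameter_unbounded:
  fixes E :: "'a::metric_space set"
  assumes "\<not> bounded E" "0 \<le> R" shows "ennreal R < ediameter E"
proof -
  obtain x where x: "x \<in> E" using assms(1) by (cases "E = {}") auto
  obtain y where y: "y \<in> E" "R < dist x y"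
    using assms(1) unfolding bounded_any_center[of E x] by (meson linorder_not_le)
  have "ennreal R < ennreal (dist x y)" using y(2) assms(2) by (simp add: ennreal_less_iff)
  also have "\<dots> \<le> (SUP y\<in>E. ennreal (dist x y))" using y by (intro SUP_upper)
  also have "\<dots> \<le> ediameter E" unfolding ediameter_def using x by (intro SUP_upper)
  finally show ?thesis .
qed

text \<open>Unboundedness removes the restriction \<open>R < d(E)\<close>, so the covering bound holds at all scales.\<close>

lemma lower_assouad_dim_unbounded_obtain:
  fixes E :: "'a::metric_space set"
  assumes "ereal a < lower_assouad_dim E" "\<not> bounded E"
  obtains l c where "a < l" "0 < c" "\<And>x r R. x \<in> E \<Longrightarrow> 0 < r \<Longrightarrow> r < R \<Longrightarrow>
    c * (r / R) powr (- l) \<le> real (covering_number (E \<inter> ball x R) r)"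
proof -
  obtain l c where "a < l" "0 < c" and *: "\<forall>x\<in>E. \<forall>r R. 0 < r \<and> r < R \<and> ennreal R < ediameter E \<longrightarrow>
          real (covering_number (E \<inter> ball x R) r) \<ge> c * (r / R) powr (- l)"
    using assms(1) unfolding lower_assouad_dim_def less_Sup_iff by auto
  show thesis
  proof (rule that[of l c])
    fix x and r R :: real assume "x \<in> E" "0 < r" "r < R"
    then show "c * (r / R) powr (- l) \<le> real (covering_number (E \<inter> ball x R) r)"
      using * ediameter_unbounded[OF assms(2), of R] by auto
  qed fact+
qed

lemma frechet_derivative_eq_gradient_inner:
  fixes f :: "real ^ 'n::finite \<Rightarrow> real"
  assumes "f differentiable (at x)"
  shows "frechet_derivative f (at x) v = gradient f x \<bullet> v"
proof -
  let ?D = "frechet_derivative f (at x)"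
  have lin: "linear ?D" using assms by (rule linear_frechet_derivative)
  have "?D v = ?D (\<Sum>i\<in>UNIV. (v $ i) *\<^sub>R axis i 1)"
    using basis_expansion[of v] by (simp add: scalar_mult_eq_scaleR)
  also have "\<dots> = (\<Sum>i\<in>UNIV. v $ i * ?D (axis i 1))"
    using lin by (simp add: linear_sum linear_scale)
  also have "\<dots> = gradient f x \<bullet> v"
    by (simp add: inner_vec_def gradient_def partial_deriv_def mult.commute)
  finally show ?thesis .
qed

lemma test_function_C1:
  assumes "test_function f"
  shows "f differentiable (at x)" "continuous_on UNIV (gradient f)"
proof -
  have *: "Ck (Suc 0) f" using assms by (simp only: test_function_def)
  then show "f differentiable (at x)" by simp
  have "continuous_on UNIV (partial_deriv i f)" for i using * by simp
  then show "continuous_on UNIV (gradient f)"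
    unfolding gradient_def[abs_def] by (intro continuous_on_vec_lambda) auto
qed

lemma test_function_gradient_bounded:
  fixes f :: "real ^ 'n::finite \<Rightarrow> real"
  assumes f: "test_function f"
  obtains L where "0 \<le> L" "\<And>x. norm (gradient f x) \<le> L"
proof -
  let ?K = "closure {x. f x \<noteq> 0}"
  have "compact ?K" using f by (simp add: test_function_def)
  then have "bounded (gradient f ` ?K)"
    using test_function_C1(2)[OF f] by (intro compact_imp_bounded compact_continuous_image) (auto intro: continuous_on_subset)
  then obtain L where L: "0 < L" "\<And>x. x \<in> ?K \<Longrightarrow> norm (gradient f x) \<le> L"
    unfolding bounded_pos by auto
  have "gradient f x = 0" if "x \<notin> ?K" for x
  proof -
    have K: "open (- ?K)" "x \<in> - ?K" using that by auto
    have "0 = f y" if "y \<in> - ?K" for y using that closure_subset[of "{x. f x \<noteq> 0}"] by auto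
    then have "(f has_derivative (\<lambda>_. 0)) (at x)"
      by (rule has_derivative_transform_within_open[OF has_derivative_const K])
    then have "frechet_derivative f (at x) = (\<lambda>_. 0)" by (simp add: frechet_derivative_at[symmetric])
    then show ?thesis by (simp add: gradient_def partial_deriv_def vec_eq_iff)
  qed
  then have "norm (gradient f x) \<le> L" for x using L by (cases "x \<in> ?K") auto
  then show thesis using L(1) that[of L] by auto
qed

lemma test_function_lipschitz:
  fixes f :: "real ^ 'n::finite \<Rightarrow> real"
  assumes f: "test_function f" and L: "\<And>x. norm (gradient f x) \<le> L"
  shows "\<bar>f x - f y\<bar> \<le> L * dist x y"
proof -
  have "norm (f x - f y) \<le> L * norm (x - y)"
  proof (rule differentiable_bound[OF convex_UNIV])
    fix z
    show "(f has_derivative frechet_derivative f (at z)) (at z within UNIV)"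
      using test_function_C1(1)[OF f] by (simp add: frechet_derivative_works)
    show "onorm (frechet_derivative f (at z)) \<le> L"
    proof (rule onorm_le)
      fix v
      have "norm (frechet_derivative f (at z) v) \<le> norm (gradient f z) * norm v"
        unfolding frechet_derivative_eq_gradient_inner[OF test_function_C1(1)[OF f]] real_norm_def
        by (rule Cauchy_Schwarz_ineq2)
      also have "\<dots> \<le> L * norm v" by (intro mult_right_mono L) auto
      finally show "norm (frechet_derivative f (at z) v) \<le> L * norm v" .
    qed
  qed auto
  then show ?thesis by (simp add: dist_norm)
qed

lemma (in proper_open_set) bdry_weight_eq:
  "x \<in> G \<Longrightarrow> bdry_weight G s x = ennreal (\<delta> x powr s)"
  using \<delta>_pos[of x] by (auto simp: bdry_weight_def \<delta>_def ennreal_powr_def)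

lemma test_function_upper_pair:
  fixes f :: "real ^ 'n::finite \<Rightarrow> real"
  assumes G: "proper_open_set G" and f: "test_function f" and zero: "\<And>x. x \<notin> G \<Longrightarrow> f x = 0"
  shows "proper_open_set.upper_pair G f (\<lambda>x. norm (gradient f x))"
  unfolding proper_open_set.upper_pair_def[OF G]
proof (intro conjI allI impI ballI)
  have diff: "f differentiable (at x)" for x using test_function_C1(1)[OF f] .
  show "continuous_on UNIV f"
    using diff by (intro continuous_at_imp_continuous_on ballI differentiable_imp_continuous_within)
  show "continuous_on G (\<lambda>x. norm (gradient f x))"
    using test_function_C1(2)[OF f] by (intro continuous_on_norm) (auto intro: continuous_on_subset)
  fix z :: "real ^ 'n" and \<epsilon> :: real assume "0 < \<epsilon>"
  have "(f has_derivative frechet_derivative f (at z)) (at z)"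
    using diff by (simp add: frechet_derivative_works)
  then obtain d where d: "0 < d" "\<And>y. norm (y - z) < d \<Longrightarrow>
      norm (f y - f z - frechet_derivative f (at z) (y - z)) \<le> \<epsilon> * norm (y - z)"
    using \<open>0 < \<epsilon>\<close> unfolding has_derivative_at_alt by blast
  show "\<exists>d>0. \<forall>y. dist y z < d \<longrightarrow> \<bar>f y - f z\<bar> \<le> (norm (gradient f z) + \<epsilon>) * dist y z"
  proof (intro exI[of _ d] conjI allI impI)
    fix y assume "dist y z < d"
    then have "\<bar>f y - f z - gradient f z \<bullet> (y - z)\<bar> \<le> \<epsilon> * norm (y - z)"
      using d(2)[of y] by (simp add: frechet_derivative_eq_gradient_inner[OF diff] dist_norm)
    moreover have "\<bar>gradient f z \<bullet> (y - z)\<bar> \<le> norm (gradient f z) * norm (y - z)"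
      by (rule Cauchy_Schwarz_ineq2)
    ultimately show "\<bar>f y - f z\<bar> \<le> (norm (gradient f z) + \<epsilon>) * dist y z"
      by (simp add: dist_norm distrib_right)
  qed (rule d)
qed (use zero in auto)

text \<open>The function is Lipschitz and vanishes off \<open>G\<close>, so \<open>|f| \<le> L \<delta>\<close> and the integrand is bounded; its support
is compact. The finiteness is needed for the absorption in \<open>hardy_unweighted\<close>.\<close>

lemma test_function_hardy_quotient_finite:
  fixes f :: "real ^ 'n::finite \<Rightarrow> real"
  assumes G: "proper_open_set G" and f: "test_function f" and zero: "\<And>x. x \<notin> G \<Longrightarrow> f x = 0" and p: "1 < p"
  shows "(\<integral>\<^sup>+z. ennreal (\<bar>f z\<bar> powr p * proper_open_set.\<delta> G z powr (- p)) * indicator G z \<partial>lborel) < top"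
proof -
  interpret proper_open_set G by (rule G)
  obtain L where L: "0 \<le> L" "\<And>x. norm (gradient f x) \<le> L" using test_function_gradient_bounded[OF f] by blast
  let ?K = "closure {x. f x \<noteq> 0}"
  have K: "compact ?K" using f by (simp add: test_function_def)
  have "(\<integral>\<^sup>+z. ennreal (\<bar>f z\<bar> powr p * \<delta> z powr (- p)) * indicator G z \<partial>lborel)
    \<le> (\<integral>\<^sup>+z. ennreal (L powr p) * indicator ?K z \<partial>lborel)"
  proof (rule nn_integral_mono)
    fix z
    show "ennreal (\<bar>f z\<bar> powr p * \<delta> z powr (- p)) * indicator G z \<le> ennreal (L powr p) * indicator ?K z"
    proof (cases "z \<in> G \<and> f z \<noteq> 0")
      case True
      then have zK: "z \<in> ?K" by (intro subsetD[OF closure_subset]) simp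
      have \<delta>z: "0 < \<delta> z" using \<delta>_pos True by auto
      obtain w where w: "w \<notin> G" "dist z w = \<delta> z" using nearest_point .
      have "\<bar>f z\<bar> \<le> L * \<delta> z" using test_function_lipschitz[OF f L(2), of z w] w zero by simp
      then have "\<bar>f z\<bar> powr p \<le> (L * \<delta> z) powr p" using p by (intro powr_mono2) auto
      also have "\<dots> = L powr p * \<delta> z powr p" using L \<delta>z by (simp add: powr_mult)
      finally have "\<bar>f z\<bar> powr p * \<delta> z powr (- p) \<le> L powr p * \<delta> z powr p * \<delta> z powr (- p)"
        by (intro mult_right_mono) auto
      also have "\<dots> = L powr p" using \<delta>z by (simp add: powr_minus)
      finally show ?thesis using True zK by (simp add: ennreal_leI)
    qed (use p in auto)
  qed
  also have "\<dots> = ennreal (L powr p) * emeasure lborel ?K"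
    by (intro nn_integral_cmult_indicator) auto
  also have "\<dots> < top" using emeasure_compact_finite[OF K] by (simp add: ennreal_mult_less_top)
  finally show ?thesis .
qed

theorem theorem7p1:
  fixes G :: "(real ^ 'n::finite) set" and p q \<beta> n :: real
  assumes n_def: "n = real CARD('n)" and "CARD('n) \<ge> 2"
    and "\<beta> \<le> 0"
    and "1 < p" and "p < q" and "p < n" and "q < n * p / (n - p)"
    and "open G" and "G \<noteq> {}" and "G \<noteq> UNIV"
    and "lower_assouad_dim (- G) > ereal (n - p + \<beta>)"
    and "\<not> bounded G \<longrightarrow> \<not> bounded (- G)"
  shows "\<exists>C::real. C > 0 \<and>
    (\<forall>f :: real ^ 'n \<Rightarrow> real. test_function f \<and> (\<forall>x\<in>- G. f x = 0) \<longrightarrow>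
      ennreal_powr
        (\<integral>\<^sup>+x\<in>G. ennreal (\<bar>f x\<bar> powr q) * bdry_weight G (q / p * (n - p + \<beta>) - n) x \<partial>lborel)
        (1 / q)
      \<le> ennreal C * ennreal_powr
        (\<integral>\<^sup>+x. ennreal (norm (gradient f x) powr p) * bdry_weight G \<beta> x \<partial>lborel)
        (1 / p))"
proof -
  have pos: "proper_open_set G" using assms by unfold_locales
  interpret proper_open_set G by (rule pos)
  have n: "real DIM(real ^ 'n) = n" by (simp add: n_def)
  have sub: "q * (real DIM(real ^ 'n) - p) < real DIM(real ^ 'n) * p"
    unfolding n using \<open>q < n * p / (n - p)\<close> \<open>p < n\<close> by (simp add: field_simps)
  have "\<not> bounded (- G)"
  proof (cases "bounded G")
    case True
    then show ?thesis using bounded_Un[of G "- G"] not_bounded_UNIV[where 'a = "real ^ 'n"] by auto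
  qed (use assms in auto)
  then obtain l c where l: "n - p + \<beta> < l" and c: "0 < c"
    and cov: "\<And>x r R. x \<in> - G \<Longrightarrow> 0 < r \<Longrightarrow> r < R \<Longrightarrow>
      c * (r / R) powr (- l) \<le> real (covering_number (- G \<inter> ball x R) r)"
    using lower_assouad_dim_unbounded_obtain[OF \<open>lower_assouad_dim (- G) > ereal (n - p + \<beta>)\<close>] by metis
  have pq: "1 < p" "p \<le> q" "0 < p" "0 < q" using assms by auto
  have "\<exists>C>0. \<forall>f. test_function f \<and> (\<forall>x\<in>- G. f x = 0) \<longrightarrow>
    (\<integral>\<^sup>+y. ennreal (\<bar>f y\<bar> powr q * \<delta> y powr (q / p * (n - p + \<beta>) - n)) * indicator G y \<partial>lborel)
      \<le> ennreal C * ennreal_powr (\<integral>\<^sup>+z. energy_density (\<lambda>x. norm (gradient f x)) p \<beta> z \<partial>lborel) (q / p)"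
  proof (cases "\<beta> < 0")
    case True
    obtain C where "0 < C" "\<forall>u g. upper_pair u g \<longrightarrow>
      (\<integral>\<^sup>+y. ennreal (\<bar>u y\<bar> powr q * \<delta> y powr (q / p * (n - p + \<beta>) - n)) * indicator G y \<partial>lborel)
        \<le> ennreal C * ennreal_powr (\<integral>\<^sup>+z. energy_density g p \<beta> z \<partial>lborel) (q / p)"
      using sobolev_hardy_negative_weight[OF c cov pq(1,2) sub True] l unfolding n by blast
    then show ?thesis using test_function_upper_pair[OF pos] by (intro exI[of _ C]) auto
  next
    case False
    then have \<beta>: "\<beta> = 0" using assms by simp
    obtain C where "0 < C" "\<forall>u g. upper_pair u g \<longrightarrow>
      (\<integral>\<^sup>+z. ennreal (\<bar>u z\<bar> powr p * \<delta> z powr (- p)) * indicator G z \<partial>lborel) < top \<longrightarrow>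
      (\<integral>\<^sup>+y. ennreal (\<bar>u y\<bar> powr q * \<delta> y powr (q / p * (n - p) - n)) * indicator G y \<partial>lborel)
        \<le> ennreal C * ennreal_powr (\<integral>\<^sup>+z. energy_density g p 0 z \<partial>lborel) (q / p)"
      using sobolev_hardy_unweighted[OF c cov pq(1,2) sub] l \<beta> unfolding n by auto
    then show ?thesis using test_function_upper_pair[OF pos] test_function_hardy_quotient_finite[OF pos _ _ pq(1)] \<beta>
      by (intro exI[of _ C]) auto
  qed
  then obtain C where C: "0 < C" and main: "\<And>f. test_function f \<Longrightarrow> (\<And>x. x \<in> - G \<Longrightarrow> f x = 0) \<Longrightarrow>
    (\<integral>\<^sup>+y. ennreal (\<bar>f y\<bar> powr q * \<delta> y powr (q / p * (n - p + \<beta>) - n)) * indicator G y \<partial>lborel)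
      \<le> ennreal C * ennreal_powr (\<integral>\<^sup>+z. energy_density (\<lambda>x. norm (gradient f x)) p \<beta> z \<partial>lborel) (q / p)"
    by blast
  show ?thesis
  proof (intro exI[of _ "C powr (1 / q)"] conjI allI impI)
    show "0 < C powr (1 / q)" using C by simp
    fix f :: "real ^ 'n \<Rightarrow> real" assume f: "test_function f \<and> (\<forall>x\<in>- G. f x = 0)"
    define A where "A = (\<integral>\<^sup>+x\<in>G. ennreal (\<bar>f x\<bar> powr q) * bdry_weight G (q / p * (n - p + \<beta>) - n) x \<partial>lborel)"
    define D where "D = (\<integral>\<^sup>+z. energy_density (\<lambda>x. norm (gradient f x)) p \<beta> z \<partial>lborel)"
    define R where "R = (\<integral>\<^sup>+x. ennreal (norm (gradient f x) powr p) * bdry_weight G \<beta> x \<partial>lborel)"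
    have "A = (\<integral>\<^sup>+y. ennreal (\<bar>f y\<bar> powr q * \<delta> y powr (q / p * (n - p + \<beta>) - n)) * indicator G y \<partial>lborel)"
      unfolding A_def by (intro nn_integral_cong) (auto simp: indicator_def bdry_weight_eq ennreal_mult)
    also have "\<dots> \<le> ennreal C * ennreal_powr D (q / p)"
      unfolding D_def using f by (intro main) auto
    finally have "ennreal_powr A (1 / q) \<le> ennreal (C powr (1 / q)) * ennreal_powr (ennreal_powr D (q / p)) (1 / q)"
      using C pq by (intro ennreal_powr_scale_le) auto
    also have "ennreal_powr (ennreal_powr D (q / p)) (1 / q) = ennreal_powr D (1 / p)"
      using pq by (subst ennreal_powr_powr) auto
    also have "ennreal (C powr (1 / q)) * ennreal_powr D (1 / p) \<le> ennreal (C powr (1 / q)) * ennreal_powr R (1 / p)"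
    proof (intro mult_left_mono ennreal_powr_mono)
      show "D \<le> R" unfolding D_def R_def
        by (intro nn_integral_mono) (auto simp: energy_density_def indicator_def bdry_weight_eq ennreal_mult)
    qed (use pq in auto)
    finally show "ennreal_powr A (1 / q) \<le> ennreal (C powr (1 / q)) * ennreal_powr R (1 / p)" .
  qed
qed

end
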